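(* Let $\Sigma:\ \dot x=\mathbf{A}x+\mathbf{B}u+\mathbf{G}v$, $x\in X,\ u\in U,\ v\in V$, be an asymptotically stable linear control system (with the standing assumptions listed in the context). Let $\varepsilon,\delta,\tau,\eta,\mu\in\mathbb{R}_{+}$, let $\varphi_0$ be an LTL$_{-X}$ formula and let $T\in T_{\tau,\eta,\mu}(\Sigma)$ be a finite abstraction of $\Sigma$. Assume that $\|e^{\mathbf{A}\tau}\|\varepsilon+\mu+\eta/2<\varepsilon$ and that $\|\mathbf{x}(t)-\mathbf{x}((n-1)\tau)\|\le\delta$ for any trajectory $\mathbf{x}:\mathbb{R}_+^0\to X$ of $\Sigma$, any $n\in\mathbb{N}$ and any $t\in[(n-1)\tau,n\tau)$. If there exist a state $q_0$ and a control strategy $f$ of $T$ such that $\sigma\models tr_{\varepsilon}^{\delta}(tr_{\delta}(\varphi_0))$ for every $\sigma\in Out_T(q_0,f)$, then there exists a $\tau$-controller $C=(X_0,f_c)$ of $\Sigma$ derived from $q_0$ and $f$ such that: (1) there exists at least one trajectory of $\Sigma$ with $\tau$-controller $C$; and (2) all trajectories of $\Sigma$ with $\tau$-controller $C$ satisfy $\varphi_0$.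
   Context: **Notation.** $\mathbb{N}$ is the set of positive integers, $\mathbb{R}_+$ the positive reals, $\mathbb{R}_+^0$ the nonnegative reals. On $\mathbb{R}^n$, $\|x\|=\max_i|x_i|$ and $\mathbf{d}(x,y)=\|x-y\|$; $\|M\|$ is the infinity norm (maximal absolute row sum) of a matrix. $\mathcal{B}_r(x)$ is the closed ball of radius $r$ about $x$. $[A]_\mu=\{x\in A: x_i\in\mu\mathbb{Z}\text{ for all }i\}$ for $A\subseteq\mathbb{R}^n$. $\mathbf{d}_h(X_1,X_2)=\max\{\sup_{x_1\in X_1}\inf_{x_2\in X_2}\mathbf{d}(x_1,x_2),\ \sup_{x_2\in X_2}\inf_{x_1\in X_1}\mathbf{d}(x_1,x_2)\}$. $A^+$ is the set of non-empty finite strings over $A$ and $A^\omega$ the set of infinite strings; $s[i]$ is the $i$-th element (indices start at 1), $s[end]$ the last element, $s[i,j]=s[i]\cdots s[j]$. **System.** $\mathbf{A}\in\mathbb{R}^{n\times n}$, $\mathbf{B}\in\mathbb{R}^{n\times m}$, $\mathbf{G}\in\mathbb{R}^{n\times k}$, $X\subseteq\mathbb{R}^n$, $U\subseteq\mathbb{R}^m$, $V\subseteq\mathbb{R}^k$. $\mathcal{U},\mathcal{V}$ are the sets of measurable, locally essentially bounded functions from intervals $D\subseteq\mathbb{R}_+^0$ of the form $[t_1,t_2]$ or $[t,\theta)$ ($\theta\le\infty$) to $U$, $V$. A (locally) absolutely continuous $\mathbf{x}:D\to X$ is a trajectory of $\Sigma$ if for some $\mathbf{u}\in\mathcal{U},\mathbf{v}\in\mathcal{V}$,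 $\dot{\mathbf{x}}(t)=\mathbf{A}\mathbf{x}(t)+\mathbf{B}\mathbf{u}(t)+\mathbf{G}\mathbf{v}(t)$ for almost all $t\in D$. $\mathbf{x}(t,x_0,\mathbf{u},\mathbf{v})$ is the value at time $t$ of the solution of this equation starting at $x_0$ at time $0$ (with $0$ in place of $\mathbf u$ or $\mathbf v$ meaning the zero function); so $\mathbf{x}(t,x_0,\mathbf{u},\mathbf{v})=e^{\mathbf{A}t}x_0+\mathbf{x}(t,0,\mathbf{u},0)+\mathbf{x}(t,0,0,\mathbf{v})$. Standing assumptions: $U\times V$ is compact; $X$ is a bounded polytope (convex hull of finitely many points) with non-empty interior and $0\in X$; $\Sigma$ is asymptotically stable (standard sense) and forward complete, i.e. for all $x\in X$ and inputs $\mathbf{u}:\mathbb{R}_+^0\to U$ in $\mathcal U$, $\mathbf{v}:\mathbb{R}_+^0\to V$ in $\mathcal V$ there is a trajectory $\mathbf{x}:\mathbb{R}_+^0\to X$ with $\mathbf{x}(0)=x$ generated by $\mathbf{u},\mathbf{v}$. **Alternating transition systems.** $T=(Q,A,B,\to,O,H)$: states $Q$, control labels $A$, disturbance labels $B$, $\to\subseteq Q\times A\times B\times Q$, observation set $O$, observation map $H:Q\to O$. It is non-blocking if for all $q,a,b$ there is $q'$ with $q\xrightarrow{a,b}q'$; finite if $Q,A,B$ are finite; metric if $O$ carries a metric. **Sampling system.** $T_\tau(\Sigma)=(X,A_\tau,B_\tau,\to_\tau,X,\mathrm{id}_X)$, where $A_\tau=\{\mathbf{u}\in\mathcal{U}:\mathrm{dom}\,\mathbf{u}=[0,\tau]\}$,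 $B_\tau=\{\mathbf{v}\in\mathcal{V}:\mathrm{dom}\,\mathbf{v}=[0,\tau]\}$ and $q\xrightarrow{\mathbf{u},\mathbf{v}}_\tau q'$ iff $\mathbf{x}(\tau,q,\mathbf{u},\mathbf{v})=q'$. **Finite abstractions.** Let $\mathcal{R}_{A_\tau}=\{\mathbf{x}(\tau,0,\mathbf{u},0):\mathbf{u}\in A_\tau\}$, $\mathcal{R}_{B_\tau}=\{\mathbf{x}(\tau,0,0,\mathbf{v}):\mathbf{v}\in B_\tau\}$. $T_{\tau,\eta,\mu}(\Sigma)$ is the set of alternating transition systems $T=([X]_\eta,A,B,\to,\mathbb{R}^n,H)$ with $A,B\subseteq[\mathbb{R}^n]_\mu$, $\mathbf{d}_h(A,\mathcal{R}_{A_\tau})\le\mu/2$, $\mathbf{d}_h(B,\mathcal{R}_{B_\tau})\le\mu/2$; $q\xrightarrow{a,b}q'$ iff $\|\mathbf{x}(\tau,q,0,0)+a+b-q'\|\le\eta/2$; and $H$ the inclusion. As in the paper, $T_\tau(\Sigma)$ and all $T\in T_{\tau,\eta,\mu}(\Sigma)$ are taken to be non-blocking and every such $T$ is finite. Observations of both are compared in $\mathbb{R}^n$ with metric $\mathbf{d}$. **Alternating $\varepsilon$-approximate (A$\varepsilon$A) bisimulation.** For metric non-blocking $T_i=(Q_i,A_i,B_i,\to_i,O,H_i)$, $i=1,2$, with common metric $\mathbf{d}$ on $O$, $R\subseteq Q_1\times Q_2$ is an A$\varepsilon$A bisimulation if for all $(q_1,q_2)\in R$: (i) $\mathbf{d}(H_1(q_1),H_2(q_2))\le\varepsilon$;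 (ii) $\forall a_1\in A_1\,\exists a_2\in A_2\,\forall b_2\in B_2\,\forall q_2'\in Q_2$: $q_2\xrightarrow{a_2,b_2}_2q_2'$ implies $\exists b_1\in B_1\,\exists q_1'\in Q_1$ with $q_1\xrightarrow{a_1,b_1}_1q_1'$ and $(q_1',q_2')\in R$; (iii) $\forall a_2\in A_2\,\exists a_1\in A_1\,\forall b_1\in B_1\,\forall q_1'\in Q_1$: $q_1\xrightarrow{a_1,b_1}_1q_1'$ implies $\exists b_2\in B_2\,\exists q_2'\in Q_2$ with $q_2\xrightarrow{a_2,b_2}_2q_2'$ and $(q_1',q_2')\in R$. $q_1\sim_\varepsilon q_2$ means some A$\varepsilon$A bisimulation contains $(q_1,q_2)$; the notion is symmetric in the two systems. For strings, $\alpha_1\sim_\varepsilon\alpha_2$ iff they have the same (possibly infinite) length and $\alpha_1[i]\sim_\varepsilon\alpha_2[i]$ for all $i$. Here $\sim_\varepsilon$ is used between states (strings) of $T_\tau(\Sigma)$ and of $T$. **Control strategies.** A control strategy for $T=(Q,A,B,\to,O,H)$ is a function $f:Q^+\to2^A\setminus\{\emptyset\}$. $Out_T^n(q,f)$ is the set of $s\in Q^n$ with $s[1]=q$ such that for all $1\le i<n$ there are $a_i\in f(s[1,i])$, $b_i\in B$ with $s[i]\xrightarrow{a_i,b_i}s[i+1]$; $Out_T(q,f)$ is the set of $\sigma\in Q^\omega$ with $\sigma[1]=q$ such that for all $i\in\mathbb{N}$ there are $a_i\in f(\sigma[1,i])$, $b_i\in B$ with $\sigma[i]\xrightarrow{a_i,b_i}\sigma[i+1]$;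 $Out_T^+(q,f)=\bigcup_nOut^n_T(q,f)$. **Logics.** $\mathbb{P}_h$ is a fixed finite set of propositions, each $p\in\mathbb{P}_h$ an open half-space $p=\{x\in\mathbb{R}^n:c_p^Tx+d_p<0\}$, $c_p\in\mathbb{R}^n,d_p\in\mathbb{R}$. LTL$_{-X}$ formulas: $\varphi::=p\mid\neg p\mid\varphi_1\wedge\varphi_2\mid\varphi_1\vee\varphi_2\mid\varphi_1\mathbf{U}\varphi_2\mid\varphi_1\tilde{\mathbf{U}}\varphi_2$. For a trajectory $\mathbf{x}:\mathbb{R}_+^0\to X$ and $t\ge0$: $\mathbf{x}(t)\models p$ iff $\mathbf{x}(t)\in p$; $\mathbf{x}(t)\models\neg p$ iff $\mathbf{x}(t)\notin p$; $\wedge,\vee$ as usual; $\mathbf{x}(t)\models\varphi_1\mathbf{U}\varphi_2$ iff for some $t\le t_1<t_2$ either [$\mathbf{x}(t_1)\models\varphi_2$ and $\mathbf{x}(t')\models\varphi_1$ for all $t'\in[t,t_1)$] or [$\mathbf{x}(t')\models\varphi_1$ for all $t'\in[t,t_1]$ and $\mathbf{x}(t'')\models\varphi_2$ for all $t''\in(t_1,t_2]$]; $\mathbf{x}(t)\models\varphi_1\tilde{\mathbf{U}}\varphi_2$ iff for all $t\le t_1<t_2$: if $\mathbf{x}(t_1)\not\models\varphi_2$ then $\mathbf{x}(t')\models\varphi_1$ for some $t'\in[t,t_1)$, and if $\mathbf{x}(t')\not\models\varphi_2$ for all $t'\in(t_1,t_2]$ then $\mathbf{x}(t'')\models\varphi_1$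 for some $t''\in[t,t_1]$. $\mathbf{x}$ satisfies $\varphi$ ($\mathbf{x}\models\varphi$) iff $\mathbf{x}(0)\models\varphi$. For $\delta\in\mathbb{R}_+$, LTL$_{-X}^\delta$ formulas: $\psi::=[\delta]p\mid[\delta]\neg p\mid\psi_1\wedge\psi_2\mid\psi_1\vee\psi_2\mid\psi_1\mathbf{U}\psi_2\mid\psi_1\tilde{\mathbf{U}}\psi_2$, $p\in\mathbb{P}_h$. For $\sigma\in(\mathbb{R}^n)^\omega$, $i\in\mathbb{N}$: $\sigma[i]\models[\delta]p$ iff $\mathcal{B}_\delta(\sigma[i])\subseteq p$; $\sigma[i]\models[\delta]\neg p$ iff $\mathcal{B}_\delta(\sigma[i])\cap p=\emptyset$; $\wedge,\vee$ as usual; $\sigma[i]\models\psi_1\mathbf{U}\psi_2$ iff there is $j\ge i$ with $\sigma[j]\models\psi_2$ and $\sigma[k]\models\psi_1$ for all $i\le k<j$; $\sigma[i]\models\psi_1\tilde{\mathbf{U}}\psi_2$ iff for all $j\ge i$ with $\sigma[j]\not\models\psi_2$ there is $i\le k<j$ with $\sigma[k]\models\psi_1$. $\sigma\models\psi$ iff $\sigma[1]\models\psi$. $tr_\delta:$ LTL$_{-X}\to$ LTL$_{-X}^\delta$ replaces each literal $p$ by $[\delta]p$ and each literal $\neg p$ by $[\delta]\neg p$ and commutes with $\wedge,\vee,\mathbf{U},\tilde{\mathbf{U}}$. $tr_\varepsilon^\delta:$ LTL$_{-X}^\delta\to$ LTL$_{-X}^{\delta+\varepsilon}$ replaces every $[\delta]$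 by $[\delta+\varepsilon]$. **Controllers.** A $\tau$-controller of $\Sigma$ is a pair $C=(X_0,f_c)$ with $X_0\subseteq X$ and $f_c$ a partial function from $X^+$ to $A_\tau$. Given $q_0\in Q=[X]_\eta$ and a control strategy $f$ of $T$, $C$ is derived from $q_0$ and $f$ iff (1) $X_0=\{q\in X:\mathbf{d}(q,q_0)\le\varepsilon\}$; (2) for every $s\in X^+$: if there is $s_1\in Out_T^+(q_0,f)$ with $s\sim_\varepsilon s_1$, then $f_c(s)$ is defined and $\|\mathbf{x}(\tau,0,f_c(s),0)-a\|\le\mu/2$ for some $s'\in Out_T^+(q_0,f)$ with $s\sim_\varepsilon s'$ and some $a\in f(s')$; otherwise $f_c(s)$ is undefined. A (locally absolutely continuous) $\mathbf{x}:\mathbb{R}_+^0\to X$ is a trajectory of $\Sigma$ with $\tau$-controller $C$ iff, with $\sigma_{\mathbf{x}}=\mathbf{x}(0)\mathbf{x}(\tau)\mathbf{x}(2\tau)\cdots$, for every $n\in\mathbb{N}$, $f_c(\sigma_{\mathbf{x}}[1,n])$ is defined and there is $\mathbf{v}_n\in B_\tau$ such that $\dot{\mathbf{x}}(t)=\mathbf{A}\mathbf{x}(t)+\mathbf{B}f_c(\sigma_{\mathbf{x}}[1,n])(t-(n-1)\tau)+\mathbf{G}\mathbf{v}_n(t-(n-1)\tau)$ for almost all $t\in[(n-1)\tau,n\tau)$. *)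

theory Defs
  imports "HOL-Analysis.Analysis"
begin

text \<open>
  \<^term>\<open>norm\<close> and \<^term>\<open>dist\<close> on \<^typ>\<open>real^'n\<close> are Euclidean, so all distances below are written with
  \<^term>\<open>infnorm\<close>, the maximum norm.
\<close>

definition dinf :: "real^'n \<Rightarrow> real^'n \<Rightarrow> real" where
  "dinf x y = infnorm (x - y)"

definition ball_inf :: "real \<Rightarrow> real^'n \<Rightarrow> (real^'n) set" where
  "ball_inf r x = {y. dinf x y \<le> r}"

definition row_sum_norm :: "real^'n^'m \<Rightarrow> real" where
  "row_sum_norm M = Max (range (\<lambda>i. \<Sum>j\<in>UNIV. \<bar>M $ i $ j\<bar>))"

definition mat_exp :: "real^'n^'n \<Rightarrow> real^'n^'n" where
  "mat_exp M = (\<Sum>k. (1 / fact k) *\<^sub>R (((**) M ^^ k) (mat 1)))"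

definition grid :: "real \<Rightarrow> (real^'n) set \<Rightarrow> (real^'n) set" where
  "grid \<mu> S = {x \<in> S. \<forall>i. \<exists>z::int. x $ i = \<mu> * of_int z}"

text \<open>
  Values in \<open>[0,\<infinity>]\<close>: the distance between the empty set and a non-empty set is \<open>\<infinity>\<close>.
\<close>

definition hausdorff_dist :: "(real^'n) set \<Rightarrow> (real^'n) set \<Rightarrow> ennreal" where
  "hausdorff_dist S1 S2 =
     max (SUP x1\<in>S1. INF x2\<in>S2. ennreal (dinf x1 x2))
         (SUP x2\<in>S2. INF x1\<in>S1. ennreal (dinf x1 x2))"

record ('n::finite, 'm::finite, 'k::finite) lin_sys =
  matA :: "real^'n^'n"
  matB :: "real^'m^'n"
  matG :: "real^'k^'n"
  Xset :: "(real^'n) set"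
  Uset :: "(real^'m) set"
  Vset :: "(real^'k) set"

text \<open>
  Measurable, locally essentially bounded functions with domain \<open>D\<close> and values in \<open>S\<close>; a function with
  domain \<open>D\<close> is represented by its extension with value \<^term>\<open>undefined\<close> outside \<open>D\<close>.
\<close>

definition signals :: "real set \<Rightarrow> (real^'m) set \<Rightarrow> (real \<Rightarrow> real^'m) set" where
  "signals D S = {u \<in> D \<rightarrow>\<^sub>E S.
     u \<in> borel_measurable (lebesgue_on D) \<and>
     (\<forall>K. compact K \<and> K \<subseteq> D \<longrightarrow> (\<exists>c. AE t in lebesgue_on K. norm (u t) \<le> c))}"

text \<open>
  The families \<open>\<D>\<close> with \<open>\<D> division_of \<Union>\<D>\<close> are the finite families of non-overlapping compact
  intervals.
\<close>

definition abs_continuous_on :: "real \<Rightarrow> real \<Rightarrow> (real \<Rightarrow> 'a::real_normed_vector) \<Rightarrow> bool" where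
  "abs_continuous_on a b x \<longleftrightarrow>
     (\<forall>e>0. \<exists>d>0. \<forall>\<D>. \<D> division_of \<Union>\<D> \<and> \<Union>\<D> \<subseteq> {a..b} \<and> (\<Sum>I\<in>\<D>. Sup I - Inf I) < d
        \<longrightarrow> (\<Sum>I\<in>\<D>. norm (x (Sup I) - x (Inf I))) < e)"

definition loc_abs_continuous_on :: "real set \<Rightarrow> (real \<Rightarrow> 'a::real_normed_vector) \<Rightarrow> bool" where
  "loc_abs_continuous_on D x \<longleftrightarrow> (\<forall>a b. a \<le> b \<and> {a..b} \<subseteq> D \<longrightarrow> abs_continuous_on a b x)"

definition ode_ae ::
  "('n::finite, 'm::finite, 'k::finite) lin_sys \<Rightarrow> real set \<Rightarrow> (real \<Rightarrow> real^'m) \<Rightarrow> (real \<Rightarrow> real^'k)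
     \<Rightarrow> (real \<Rightarrow> real^'n) \<Rightarrow> bool" where
  "ode_ae \<Sigma> D u v x \<longleftrightarrow>
     (AE t in lebesgue_on D.
        (x has_vector_derivative (matA \<Sigma> *v x t + matB \<Sigma> *v u t + matG \<Sigma> *v v t)) (at t within D))"

definition is_solution ::
  "('n::finite, 'm::finite, 'k::finite) lin_sys \<Rightarrow> real set \<Rightarrow> (real \<Rightarrow> real^'m) \<Rightarrow> (real \<Rightarrow> real^'k)
     \<Rightarrow> (real \<Rightarrow> real^'n) \<Rightarrow> bool" where
  "is_solution \<Sigma> D u v x \<longleftrightarrow> loc_abs_continuous_on D x \<and> ode_ae \<Sigma> D u v x"

text \<open>
  The solution is not required to stay in \<^const>\<open>Xset\<close>, nor are \<open>u\<close> and \<open>v\<close> required to have values in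
  \<^const>\<open>Uset\<close> and \<^const>\<open>Vset\<close>; in particular they may be zero.
\<close>

definition sol ::
  "('n::finite, 'm::finite, 'k::finite) lin_sys \<Rightarrow> real \<Rightarrow> real^'n \<Rightarrow> (real \<Rightarrow> real^'m)
     \<Rightarrow> (real \<Rightarrow> real^'k) \<Rightarrow> real^'n" where
  "sol \<Sigma> t x0 u v = (THE y. \<exists>x. is_solution \<Sigma> {0..t} u v x \<and> x 0 = x0 \<and> x t = y)"

definition generates ::
  "('n::finite, 'm::finite, 'k::finite) lin_sys \<Rightarrow> real set \<Rightarrow> (real \<Rightarrow> real^'m) \<Rightarrow> (real \<Rightarrow> real^'k)
     \<Rightarrow> (real \<Rightarrow> real^'n) \<Rightarrow> bool" where
  "generates \<Sigma> D u v x \<longleftrightarrow> (\<forall>t\<in>D. x t \<in> Xset \<Sigma>) \<and> is_solution \<Sigma> D u v x"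

definition trajectory ::
  "('n::finite, 'm::finite, 'k::finite) lin_sys \<Rightarrow> real set \<Rightarrow> (real \<Rightarrow> real^'n) \<Rightarrow> bool" where
  "trajectory \<Sigma> D x \<longleftrightarrow>
     (\<exists>u \<in> signals D (Uset \<Sigma>). \<exists>v \<in> signals D (Vset \<Sigma>). generates \<Sigma> D u v x)"

definition forward_complete :: "('n::finite, 'm::finite, 'k::finite) lin_sys \<Rightarrow> bool" where
  "forward_complete \<Sigma> \<longleftrightarrow>
     (\<forall>x0 \<in> Xset \<Sigma>. \<forall>u \<in> signals {0..} (Uset \<Sigma>). \<forall>v \<in> signals {0..} (Vset \<Sigma>).
        \<exists>x. generates \<Sigma> {0..} u v x \<and> x 0 = x0)"

text \<open>Lyapunov stability and attractivity of the origin for the unforced system.\<close>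

definition asymptotically_stable :: "('n::finite, 'm::finite, 'k::finite) lin_sys \<Rightarrow> bool" where
  "asymptotically_stable \<Sigma> \<longleftrightarrow>
     (\<forall>e>0. \<exists>d>0. \<forall>x0. infnorm x0 < d \<longrightarrow>
        (\<forall>t\<ge>0. infnorm (sol \<Sigma> t x0 (\<lambda>_. 0) (\<lambda>_. 0)) < e)) \<and>
     (\<exists>d>0. \<forall>x0. infnorm x0 < d \<longrightarrow>
        ((\<lambda>t. sol \<Sigma> t x0 (\<lambda>_. 0) (\<lambda>_. 0)) \<longlongrightarrow> 0) at_top)"

record ('q, 'a, 'b, 'o) ats =
  states :: "'q set"
  controls :: "'a set"
  disturbances :: "'b set"
  transitions :: "('q \<times> 'a \<times> 'b \<times> 'q) set"
  observations :: "'o set"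
  obs :: "'q \<Rightarrow> 'o"

definition non_blocking :: "('q, 'a, 'b, 'o) ats \<Rightarrow> bool" where
  "non_blocking T \<longleftrightarrow>
     (\<forall>q \<in> states T. \<forall>a \<in> controls T. \<forall>b \<in> disturbances T. \<exists>q' \<in> states T.
        (q, a, b, q') \<in> transitions T)"

definition finite_ats :: "('q, 'a, 'b, 'o) ats \<Rightarrow> bool" where
  "finite_ats T \<longleftrightarrow> finite (states T) \<and> finite (controls T) \<and> finite (disturbances T)"

definition A_signals ::
  "('n::finite, 'm::finite, 'k::finite) lin_sys \<Rightarrow> real \<Rightarrow> (real \<Rightarrow> real^'m) set" where
  "A_signals \<Sigma> \<tau> = signals {0..\<tau>} (Uset \<Sigma>)"

definition B_signals ::
  "('n::finite, 'm::finite, 'k::finite) lin_sys \<Rightarrow> real \<Rightarrow> (real \<Rightarrow> real^'k) set" where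
  "B_signals \<Sigma> \<tau> = signals {0..\<tau>} (Vset \<Sigma>)"

definition sampling_system ::
  "('n::finite, 'm::finite, 'k::finite) lin_sys \<Rightarrow> real
     \<Rightarrow> (real^'n, real \<Rightarrow> real^'m, real \<Rightarrow> real^'k, real^'n) ats" where
  "sampling_system \<Sigma> \<tau> =
     \<lparr> states = Xset \<Sigma>,
       controls = A_signals \<Sigma> \<tau>,
       disturbances = B_signals \<Sigma> \<tau>,
       transitions = {(q, u, v, q'). q \<in> Xset \<Sigma> \<and> u \<in> A_signals \<Sigma> \<tau> \<and> v \<in> B_signals \<Sigma> \<tau> \<and>
                        q' \<in> Xset \<Sigma> \<and> sol \<Sigma> \<tau> q u v = q'},
       observations = Xset \<Sigma>,
       obs = (\<lambda>q. q) \<rparr>"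

definition reach_A :: "('n::finite, 'm::finite, 'k::finite) lin_sys \<Rightarrow> real \<Rightarrow> (real^'n) set" where
  "reach_A \<Sigma> \<tau> = {sol \<Sigma> \<tau> 0 u (\<lambda>_. 0) | u. u \<in> A_signals \<Sigma> \<tau>}"

definition reach_B :: "('n::finite, 'm::finite, 'k::finite) lin_sys \<Rightarrow> real \<Rightarrow> (real^'n) set" where
  "reach_B \<Sigma> \<tau> = {sol \<Sigma> \<tau> 0 (\<lambda>_. 0) v | v. v \<in> B_signals \<Sigma> \<tau>}"

definition abstractions ::
  "('n::finite, 'm::finite, 'k::finite) lin_sys \<Rightarrow> real \<Rightarrow> real \<Rightarrow> real
     \<Rightarrow> (real^'n, real^'n, real^'n, real^'n) ats set" where
  "abstractions \<Sigma> \<tau> \<eta> \<mu> = {T.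
     states T = grid \<eta> (Xset \<Sigma>) \<and>
     controls T \<subseteq> grid \<mu> UNIV \<and> hausdorff_dist (controls T) (reach_A \<Sigma> \<tau>) \<le> ennreal (\<mu> / 2) \<and>
     disturbances T \<subseteq> grid \<mu> UNIV \<and> hausdorff_dist (disturbances T) (reach_B \<Sigma> \<tau>) \<le> ennreal (\<mu> / 2) \<and>
     transitions T = {(q, a, b, q'). q \<in> states T \<and> a \<in> controls T \<and> b \<in> disturbances T \<and> q' \<in> states T \<and>
        infnorm (sol \<Sigma> \<tau> q (\<lambda>_. 0) (\<lambda>_. 0) + a + b - q') \<le> \<eta> / 2} \<and>
     observations T = UNIV \<and>
     (\<forall>q \<in> states T. obs T q = q)}"

definition aea_bisimulation ::
  "('o \<Rightarrow> 'o \<Rightarrow> real) \<Rightarrow> real \<Rightarrow> ('q1, 'a1, 'b1, 'o) ats \<Rightarrow> ('q2, 'a2, 'b2, 'o) ats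
     \<Rightarrow> ('q1 \<times> 'q2) set \<Rightarrow> bool" where
  "aea_bisimulation d \<epsilon> T1 T2 R \<longleftrightarrow> R \<subseteq> states T1 \<times> states T2 \<and>
     (\<forall>(q1, q2) \<in> R.
        d (obs T1 q1) (obs T2 q2) \<le> \<epsilon> \<and>
        (\<forall>a1 \<in> controls T1. \<exists>a2 \<in> controls T2. \<forall>b2 \<in> disturbances T2. \<forall>q2' \<in> states T2.
           (q2, a2, b2, q2') \<in> transitions T2 \<longrightarrow>
           (\<exists>b1 \<in> disturbances T1. \<exists>q1' \<in> states T1.
              (q1, a1, b1, q1') \<in> transitions T1 \<and> (q1', q2') \<in> R)) \<and>
        (\<forall>a2 \<in> controls T2. \<exists>a1 \<in> controls T1. \<forall>b1 \<in> disturbances T1. \<forall>q1' \<in> states T1.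
           (q1, a1, b1, q1') \<in> transitions T1 \<longrightarrow>
           (\<exists>b2 \<in> disturbances T2. \<exists>q2' \<in> states T2.
              (q2, a2, b2, q2') \<in> transitions T2 \<and> (q1', q2') \<in> R)))"

definition aea_bisimilar ::
  "('o \<Rightarrow> 'o \<Rightarrow> real) \<Rightarrow> real \<Rightarrow> ('q1, 'a1, 'b1, 'o) ats \<Rightarrow> ('q2, 'a2, 'b2, 'o) ats
     \<Rightarrow> 'q1 \<Rightarrow> 'q2 \<Rightarrow> bool" where
  "aea_bisimilar d \<epsilon> T1 T2 q1 q2 \<longleftrightarrow> (\<exists>R. aea_bisimulation d \<epsilon> T1 T2 R \<and> (q1, q2) \<in> R)"

text \<open>Finite strings; \<^const>\<open>list_all2\<close> includes equality of the lengths.\<close>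

definition aea_bisimilar_strings ::
  "('o \<Rightarrow> 'o \<Rightarrow> real) \<Rightarrow> real \<Rightarrow> ('q1, 'a1, 'b1, 'o) ats \<Rightarrow> ('q2, 'a2, 'b2, 'o) ats
     \<Rightarrow> 'q1 list \<Rightarrow> 'q2 list \<Rightarrow> bool" where
  "aea_bisimilar_strings d \<epsilon> T1 T2 = list_all2 (aea_bisimilar d \<epsilon> T1 T2)"

text \<open>
  Non-empty finite strings are lists and infinite strings are functions on \<^typ>\<open>nat\<close>; both are indexed from
  0, so \<open>s ! i\<close> and \<open>\<sigma> i\<close> are the letters with number \<open>i + 1\<close>.
\<close>

definition plus_strings :: "'q set \<Rightarrow> 'q list set" where
  "plus_strings Q = {s. s \<noteq> [] \<and> set s \<subseteq> Q}"

definition control_strategy ::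
  "('q, 'a, 'b, 'o) ats \<Rightarrow> ('q list \<Rightarrow> 'a set) \<Rightarrow> bool" where
  "control_strategy T f \<longleftrightarrow> (\<forall>s \<in> plus_strings (states T). f s \<subseteq> controls T \<and> f s \<noteq> {})"

definition Out_n ::
  "('q, 'a, 'b, 'o) ats \<Rightarrow> 'q \<Rightarrow> ('q list \<Rightarrow> 'a set) \<Rightarrow> nat \<Rightarrow> 'q list set" where
  "Out_n T q f n = {s \<in> plus_strings (states T). length s = n \<and> s ! 0 = q \<and>
     (\<forall>i. Suc i < n \<longrightarrow>
        (\<exists>a \<in> f (take (Suc i) s). \<exists>b \<in> disturbances T. (s ! i, a, b, s ! Suc i) \<in> transitions T))}"

definition Out_plus ::
  "('q, 'a, 'b, 'o) ats \<Rightarrow> 'q \<Rightarrow> ('q list \<Rightarrow> 'a set) \<Rightarrow> 'q list set" where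
  "Out_plus T q f = (\<Union>n. Out_n T q f n)"

definition Out_inf ::
  "('q, 'a, 'b, 'o) ats \<Rightarrow> 'q \<Rightarrow> ('q list \<Rightarrow> 'a set) \<Rightarrow> (nat \<Rightarrow> 'q) set" where
  "Out_inf T q f = {\<sigma>. range \<sigma> \<subseteq> states T \<and> \<sigma> 0 = q \<and>
     (\<forall>i. \<exists>a \<in> f (map \<sigma> [0..<Suc i]). \<exists>b \<in> disturbances T. (\<sigma> i, a, b, \<sigma> (Suc i)) \<in> transitions T)}"

definition open_half_space :: "(real^'n) set \<Rightarrow> bool" where
  "open_half_space p \<longleftrightarrow> (\<exists>c d. p = {x. c \<bullet> x + d < 0})"

text \<open>
  Propositions are sets of points. \<open>DualUntil\<close> is the operator written as U with a tilde.
\<close>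

datatype (props: 'p) ltl =
    Prop 'p
  | NegProp 'p
  | And "'p ltl" "'p ltl"
  | Or "'p ltl" "'p ltl"
  | Until "'p ltl" "'p ltl"
  | DualUntil "'p ltl" "'p ltl"

primrec sat_ct :: "(real \<Rightarrow> 'x) \<Rightarrow> real \<Rightarrow> 'x set ltl \<Rightarrow> bool" where
  "sat_ct x t (Prop p) \<longleftrightarrow> x t \<in> p"
| "sat_ct x t (NegProp p) \<longleftrightarrow> x t \<notin> p"
| "sat_ct x t (And \<phi>1 \<phi>2) \<longleftrightarrow> sat_ct x t \<phi>1 \<and> sat_ct x t \<phi>2"
| "sat_ct x t (Or \<phi>1 \<phi>2) \<longleftrightarrow> sat_ct x t \<phi>1 \<or> sat_ct x t \<phi>2"
| "sat_ct x t (Until \<phi>1 \<phi>2) \<longleftrightarrow>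
     (\<exists>t1 t2. t \<le> t1 \<and> t1 < t2 \<and>
        ((sat_ct x t1 \<phi>2 \<and> (\<forall>t'\<in>{t..<t1}. sat_ct x t' \<phi>1)) \<or>
         ((\<forall>t'\<in>{t..t1}. sat_ct x t' \<phi>1) \<and> (\<forall>t''\<in>{t1<..t2}. sat_ct x t'' \<phi>2))))"
| "sat_ct x t (DualUntil \<phi>1 \<phi>2) \<longleftrightarrow>
     (\<forall>t1 t2. t \<le> t1 \<and> t1 < t2 \<longrightarrow>
        (\<not> sat_ct x t1 \<phi>2 \<longrightarrow> (\<exists>t'\<in>{t..<t1}. sat_ct x t' \<phi>1)) \<and>
        ((\<forall>t'\<in>{t1<..t2}. \<not> sat_ct x t' \<phi>2) \<longrightarrow> (\<exists>t''\<in>{t..t1}. sat_ct x t'' \<phi>1)))"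

definition satisfies_ct :: "(real \<Rightarrow> 'x) \<Rightarrow> 'x set ltl \<Rightarrow> bool" where
  "satisfies_ct x \<phi> \<longleftrightarrow> sat_ct x 0 \<phi>"

text \<open>
  The literals \<open>RProp \<delta> p\<close> and \<open>RNegProp \<delta> p\<close> stand for \<open>[\<delta>]p\<close> and \<open>[\<delta>]\<not>p\<close>; a formula of the logic with
  index \<open>\<delta>\<close> is one all of whose literals carry \<open>\<delta>\<close>.
\<close>

datatype 'p rltl =
    RProp real 'p
  | RNegProp real 'p
  | RAnd "'p rltl" "'p rltl"
  | ROr "'p rltl" "'p rltl"
  | RUntil "'p rltl" "'p rltl"
  | RDualUntil "'p rltl" "'p rltl"

primrec sat_dt :: "(nat \<Rightarrow> real^'n) \<Rightarrow> nat \<Rightarrow> (real^'n) set rltl \<Rightarrow> bool" where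
  "sat_dt \<sigma> i (RProp \<delta> p) \<longleftrightarrow> ball_inf \<delta> (\<sigma> i) \<subseteq> p"
| "sat_dt \<sigma> i (RNegProp \<delta> p) \<longleftrightarrow> ball_inf \<delta> (\<sigma> i) \<inter> p = {}"
| "sat_dt \<sigma> i (RAnd \<psi>1 \<psi>2) \<longleftrightarrow> sat_dt \<sigma> i \<psi>1 \<and> sat_dt \<sigma> i \<psi>2"
| "sat_dt \<sigma> i (ROr \<psi>1 \<psi>2) \<longleftrightarrow> sat_dt \<sigma> i \<psi>1 \<or> sat_dt \<sigma> i \<psi>2"
| "sat_dt \<sigma> i (RUntil \<psi>1 \<psi>2) \<longleftrightarrow>
     (\<exists>j\<ge>i. sat_dt \<sigma> j \<psi>2 \<and> (\<forall>k\<in>{i..<j}. sat_dt \<sigma> k \<psi>1))"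
| "sat_dt \<sigma> i (RDualUntil \<psi>1 \<psi>2) \<longleftrightarrow>
     (\<forall>j\<ge>i. \<not> sat_dt \<sigma> j \<psi>2 \<longrightarrow> (\<exists>k\<in>{i..<j}. sat_dt \<sigma> k \<psi>1))"

definition satisfies_dt :: "(nat \<Rightarrow> real^'n) \<Rightarrow> (real^'n) set rltl \<Rightarrow> bool" where
  "satisfies_dt \<sigma> \<psi> \<longleftrightarrow> sat_dt \<sigma> 0 \<psi>"

primrec tr :: "real \<Rightarrow> 'p ltl \<Rightarrow> 'p rltl" where
  "tr \<delta> (Prop p) = RProp \<delta> p"
| "tr \<delta> (NegProp p) = RNegProp \<delta> p"
| "tr \<delta> (And \<phi>1 \<phi>2) = RAnd (tr \<delta> \<phi>1) (tr \<delta> \<phi>2)"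
| "tr \<delta> (Or \<phi>1 \<phi>2) = ROr (tr \<delta> \<phi>1) (tr \<delta> \<phi>2)"
| "tr \<delta> (Until \<phi>1 \<phi>2) = RUntil (tr \<delta> \<phi>1) (tr \<delta> \<phi>2)"
| "tr \<delta> (DualUntil \<phi>1 \<phi>2) = RDualUntil (tr \<delta> \<phi>1) (tr \<delta> \<phi>2)"

text \<open>
  One function for all source indices: it replaces \<open>[\<delta>]\<close> by \<open>[\<delta> + \<epsilon>]\<close>, whatever the \<open>\<delta>\<close>.
\<close>

primrec tr_shift :: "real \<Rightarrow> 'p rltl \<Rightarrow> 'p rltl" where
  "tr_shift \<epsilon> (RProp \<delta> p) = RProp (\<delta> + \<epsilon>) p"
| "tr_shift \<epsilon> (RNegProp \<delta> p) = RNegProp (\<delta> + \<epsilon>) p"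
| "tr_shift \<epsilon> (RAnd \<psi>1 \<psi>2) = RAnd (tr_shift \<epsilon> \<psi>1) (tr_shift \<epsilon> \<psi>2)"
| "tr_shift \<epsilon> (ROr \<psi>1 \<psi>2) = ROr (tr_shift \<epsilon> \<psi>1) (tr_shift \<epsilon> \<psi>2)"
| "tr_shift \<epsilon> (RUntil \<psi>1 \<psi>2) = RUntil (tr_shift \<epsilon> \<psi>1) (tr_shift \<epsilon> \<psi>2)"
| "tr_shift \<epsilon> (RDualUntil \<psi>1 \<psi>2) = RDualUntil (tr_shift \<epsilon> \<psi>1) (tr_shift \<epsilon> \<psi>2)"

type_synonym ('n, 'm) controller = "(real^'n) set \<times> ((real^'n) list \<rightharpoonup> (real \<Rightarrow> real^'m))"

definition is_controller ::
  "('n::finite, 'm::finite, 'k::finite) lin_sys \<Rightarrow> real \<Rightarrow> ('n, 'm) controller \<Rightarrow> bool" where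
  "is_controller \<Sigma> \<tau> C \<longleftrightarrow> (case C of (X0, fc) \<Rightarrow>
     X0 \<subseteq> Xset \<Sigma> \<and> dom fc \<subseteq> plus_strings (Xset \<Sigma>) \<and> ran fc \<subseteq> A_signals \<Sigma> \<tau>)"

definition derived_from ::
  "('n::finite, 'm::finite, 'k::finite) lin_sys \<Rightarrow> real \<Rightarrow> real \<Rightarrow> real
     \<Rightarrow> (real^'n, real^'n, real^'n, real^'n) ats \<Rightarrow> real^'n \<Rightarrow> ((real^'n) list \<Rightarrow> (real^'n) set)
     \<Rightarrow> ('n, 'm) controller \<Rightarrow> bool" where
  "derived_from \<Sigma> \<tau> \<epsilon> \<mu> T q0 f C \<longleftrightarrow> (case C of (X0, fc) \<Rightarrow>
     let sim = aea_bisimilar_strings dinf \<epsilon> (sampling_system \<Sigma> \<tau>) T in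
     X0 = {q \<in> Xset \<Sigma>. dinf q q0 \<le> \<epsilon>} \<and>
     (\<forall>s \<in> plus_strings (Xset \<Sigma>).
        if \<exists>s1 \<in> Out_plus T q0 f. sim s s1
        then \<exists>u. fc s = Some u \<and>
               (\<exists>s' \<in> Out_plus T q0 f. sim s s' \<and>
                  (\<exists>a \<in> f s'. infnorm (sol \<Sigma> \<tau> 0 u (\<lambda>_. 0) - a) \<le> \<mu> / 2))
        else fc s = None))"

definition controlled_trajectory ::
  "('n::finite, 'm::finite, 'k::finite) lin_sys \<Rightarrow> real \<Rightarrow> ('n, 'm) controller
     \<Rightarrow> (real \<Rightarrow> real^'n) \<Rightarrow> bool" where
  "controlled_trajectory \<Sigma> \<tau> C x \<longleftrightarrow> (case C of (X0, fc) \<Rightarrow>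
     (\<forall>t\<ge>0. x t \<in> Xset \<Sigma>) \<and> loc_abs_continuous_on {0..} x \<and>
     (\<forall>n\<ge>1. \<exists>u. fc (map (\<lambda>i. x (real i * \<tau>)) [0..<n]) = Some u \<and>
        (\<exists>v \<in> B_signals \<Sigma> \<tau>.
           ode_ae \<Sigma> {(real n - 1) * \<tau>..<real n * \<tau>}
             (\<lambda>t. u (t - (real n - 1) * \<tau>)) (\<lambda>t. v (t - (real n - 1) * \<tau>)) x)))"

end

theory Submission
  imports Defs
begin

text \<open>
Being within \<open>\<epsilon>\<close> of a grid point is an alternating bisimulation. By superposition the state after one
sampling period is \<open>e\<^bsup>A\<tau>\<^esup> q\<close> plus the response to the control plus the response to the disturbance. Passing from the
system to the abstraction therefore multiplies the distance of the two states by at most \<open>\<parallel>e\<^bsup>A\<tau>\<^esup>\<parallel>\<close> and adds at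
most \<open>\<mu>/2\<close> for the control, \<open>\<mu>/2\<close> for the disturbance and \<open>\<eta>/2\<close> for rounding the state, and the total is
still below \<open>\<epsilon>\<close> (\<open>successors_close\<close>). Hence \<open>\<epsilon>\<close>-bisimilarity is nothing but distance at most \<open>\<epsilon>\<close>
(\<open>aea_bisimilar_iff\<close>), and the controller plays, on a string of sampled states that is \<open>\<epsilon>\<close>-close to an outcome of
the strategy, a signal whose response is within \<open>\<mu>/2\<close> of a symbolic control that the strategy allows.

That such a signal exists is the analytic core. The Hausdorff distance only bounds an infimum by \<open>\<mu>/2\<close>, so the
infimum must be attained, although the input set is compact but need not be convex: the set of states reachable from
the origin has to be compact (\<open>compact_reach_A\<close>). It is a set of integrals \<open>\<integral> F(s,u(s)) ds\<close> over the measurable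
selections \<open>u\<close> of a compact set. For the augmented integrand \<open>(u, F(s,u))\<close> this set is convex, by Lyapunov's theorem
applied to the difference of two integrands, which allows one to switch between two selections on a measurable set
(\<open>Lyapunov_convexity\<close>). Each extreme point of its closure is attained: switching between two members of a
sequence of selections whose integrals tend to an extreme point cannot move the integral far, so the sequence is Cauchy
in \<open>L\<^sup>1\<close> and a subsequence converges almost everywhere (\<open>extreme_point_attained\<close>). A compact convex set is the
convex hull of its extreme points, so the set of integrals is closed. Keeping \<open>u\<close> itself as a component of the
integrand makes the selections, and not only the integrands, converge.

Superposition rests on the fundamental theorem of calculus for absolutely continuous functions, which gives the
variation of constants formula and with it uniqueness. Existence of the response to the control alone, where zero need
not be an admissible disturbance, follows from forward completeness: take a solution with a constant admissible
disturbance and subtract the explicit solution for that constant.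

A controlled trajectory is obtained by iterating the controller against a constant disturbance, since closeness to an
outcome string is preserved from one sampling instant to the next (\<open>similar_extension\<close>). Conversely, along any
controlled trajectory the controller is defined at every sampling instant, so every finite prefix of the sampled
sequence is \<open>\<epsilon>\<close>-close to some outcome string. These strings need not extend each other, but there are finitely many of
each length, and Koenig's lemma gives an infinite outcome that is \<open>\<epsilon>\<close>-close to the sampled sequence throughout
(\<open>controlled_trajectory_shadowed\<close>). The margin \<open>\<epsilon>\<close> in the literals absorbs this distance (\<open>sat_dt_tr_shift\<close>), and
the margin \<open>\<delta>\<close> absorbs the motion between two sampling instants (\<open>sat_ct_of_sampled\<close>).
\<close>

section \<open>Absolutely continuous functions\<close>

lemma AE_lebesgue_on_iff_negligible:
  assumes "S \<in> sets lebesgue"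
  shows "(AE t in lebesgue_on S. P t) \<longleftrightarrow> (\<exists>N. negligible N \<and> (\<forall>t\<in>S - N. P t))"
proof -
  have "(AE t in lebesgue_on S. P t) \<longleftrightarrow> (AE t in lebesgue. t \<in> S \<longrightarrow> P t)"
    using assms by (subst AE_restrict_space_iff) auto
  also have "\<dots> \<longleftrightarrow> (\<exists>N. negligible N \<and> (\<forall>t\<in>S - N. P t))"
    unfolding eventually_ae_filter negligible_iff_null_sets by auto
  finally show ?thesis .
qed

lemma abs_continuous_onD:
  assumes "abs_continuous_on a b x" "e > 0"
  obtains d where "d > 0" "\<forall>\<D>. \<D> division_of \<Union>\<D> \<longrightarrow> \<Union>\<D> \<subseteq> {a..b} \<longrightarrow> (\<Sum>I\<in>\<D>. Sup I - Inf I) < d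
        \<longrightarrow> (\<Sum>I\<in>\<D>. norm (x (Sup I) - x (Inf I))) < e"
proof -
  from assms(1)[unfolded abs_continuous_on_def, rule_format, OF assms(2)]
  obtain d where "d > 0" and d: "\<forall>\<D>. \<D> division_of \<Union>\<D> \<and> \<Union>\<D> \<subseteq> {a..b} \<and> (\<Sum>I\<in>\<D>. Sup I - Inf I) < d
        \<longrightarrow> (\<Sum>I\<in>\<D>. norm (x (Sup I) - x (Inf I))) < e"
    by (elim exE conjE)
  then show ?thesis by (intro that[of d]) simp_all
qed

lemma division_of_real_interval:
  fixes \<D> :: "real set set"
  assumes "\<D> division_of S" "I \<in> \<D>"
  obtains u v where "u \<le> v" "I = {u..v}" "Inf I = u" "Sup I = v" "u \<in> S" "v \<in> S"
proof -
  obtain u v where I: "I = cbox u v" "I \<noteq> {}" "I \<subseteq> S"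
    using division_ofD(2-4)[OF assms(1)] assms(2) by metis
  then have "u \<le> v" by auto
  moreover have "u \<in> S" "v \<in> S" using I \<open>u \<le> v\<close> by auto
  ultimately show ?thesis using that[of u v] I by (simp add: cbox_interval)
qed

text \<open>
The increments of \<open>y\<close> are controlled by those of \<open>x\<close> and by the length of the interval. This one criterion covers
Lipschitz functions and products of a Lipschitz function with an absolutely continuous one.
\<close>

lemma abs_continuous_on_dominated:
  fixes x :: "real \<Rightarrow> 'a::real_normed_vector" and y :: "real \<Rightarrow> 'b::real_normed_vector"
  assumes ac: "abs_continuous_on a b x"
    and dom: "\<And>s t. \<lbrakk>a \<le> s; s \<le> t; t \<le> b\<rbrakk> \<Longrightarrow> norm (y t - y s) \<le> C * norm (x t - x s) + L * (t - s)"
  shows "abs_continuous_on a b y"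
  unfolding abs_continuous_on_def
proof (intro allI impI)
  fix e :: real assume e: "e > 0"
  define C' L' where "C' = max C 1" and "L' = max L 1"
  have pos: "C' > 0" "L' > 0" "C \<le> C'" "L \<le> L'" by (auto simp: C'_def L'_def)
  obtain d where d: "d > 0" "\<forall>\<D>. \<D> division_of \<Union>\<D> \<longrightarrow> \<Union>\<D> \<subseteq> {a..b} \<longrightarrow> (\<Sum>I\<in>\<D>. Sup I - Inf I) < d
        \<longrightarrow> (\<Sum>I\<in>\<D>. norm (x (Sup I) - x (Inf I))) < e / (2 * C')"
    by (rule abs_continuous_onD[OF ac, of "e / (2 * C')"]) (use e pos in auto)
  show "\<exists>d>0. \<forall>\<D>. \<D> division_of \<Union>\<D> \<and> \<Union>\<D> \<subseteq> {a..b} \<and> (\<Sum>I\<in>\<D>. Sup I - Inf I) < d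
        \<longrightarrow> (\<Sum>I\<in>\<D>. norm (y (Sup I) - y (Inf I))) < e"
  proof (rule exI[of _ "min d (e / (2 * L'))"], intro conjI allI impI)
    show "0 < min d (e / (2 * L'))" using d e pos by simp
    fix \<D> :: "real set set"
    assume D: "\<D> division_of \<Union>\<D> \<and> \<Union>\<D> \<subseteq> {a..b} \<and> (\<Sum>I\<in>\<D>. Sup I - Inf I) < min d (e / (2 * L'))"
    have "(\<Sum>I\<in>\<D>. norm (y (Sup I) - y (Inf I)))
        \<le> (\<Sum>I\<in>\<D>. C' * norm (x (Sup I) - x (Inf I)) + L' * (Sup I - Inf I))"
    proof (rule sum_mono)
      fix I assume "I \<in> \<D>"
      then obtain u v where uv: "u \<le> v" "I = {u..v}" "Inf I = u" "Sup I = v" "u \<in> \<Union>\<D>" "v \<in> \<Union>\<D>"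
        using division_of_real_interval D by metis
      then have "a \<le> u" "v \<le> b" using D by auto
      then have "norm (y v - y u) \<le> C * norm (x v - x u) + L * (v - u)"
        using dom uv(1) by blast
      also have "\<dots> \<le> C' * norm (x v - x u) + L' * (v - u)"
        using pos uv(1) by (intro add_mono mult_right_mono) auto
      finally show "norm (y (Sup I) - y (Inf I)) \<le> C' * norm (x (Sup I) - x (Inf I)) + L' * (Sup I - Inf I)"
        using uv by simp
    qed
    also have "\<dots> = C' * (\<Sum>I\<in>\<D>. norm (x (Sup I) - x (Inf I))) + L' * (\<Sum>I\<in>\<D>. Sup I - Inf I)"
      by (simp add: sum.distrib sum_distrib_left)
    also have "\<dots> < C' * (e / (2 * C')) + L' * (e / (2 * L'))"
      using D d(2)[rule_format, of \<D>] pos by (intro add_strict_mono mult_strict_left_mono) auto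
    also have "\<dots> = e" using pos by (simp add: field_simps)
    finally show "(\<Sum>I\<in>\<D>. norm (y (Sup I) - y (Inf I))) < e" .
  qed
qed

lemma abs_continuous_on_const: "abs_continuous_on a b (\<lambda>_. c)"
  unfolding abs_continuous_on_def by (auto intro: exI[of _ 1])

lemma abs_continuous_on_Lipschitz:
  fixes y :: "real \<Rightarrow> 'b::real_normed_vector"
  assumes "\<And>s t. \<lbrakk>a \<le> s; s \<le> t; t \<le> b\<rbrakk> \<Longrightarrow> norm (y t - y s) \<le> L * (t - s)"
  shows "abs_continuous_on a b y"
  by (rule abs_continuous_on_dominated[OF abs_continuous_on_const[of a b "0::real"], of y 0 L]) (use assms in auto)

lemma abs_continuous_on_mono:
  assumes "abs_continuous_on a b x" "a \<le> c" "d \<le> b"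
  shows "abs_continuous_on c d x"
proof -
  have "{c..d} \<subseteq> {a..b}" using assms by auto
  then show ?thesis using assms(1) unfolding abs_continuous_on_def by (meson order_trans)
qed

lemma abs_continuous_on_imp_continuous_on:
  assumes "abs_continuous_on a b x"
  shows "continuous_on {a..b} x"
  unfolding continuous_on_iff
proof (intro ballI allI impI)
  fix t e :: real assume t: "t \<in> {a..b}" and e: "e > 0"
  obtain d where d: "d > 0" "\<forall>\<D>. \<D> division_of \<Union>\<D> \<longrightarrow> \<Union>\<D> \<subseteq> {a..b} \<longrightarrow> (\<Sum>I\<in>\<D>. Sup I - Inf I) < d
        \<longrightarrow> (\<Sum>I\<in>\<D>. norm (x (Sup I) - x (Inf I))) < e"
    by (rule abs_continuous_onD[OF assms e])
  have key: "dist (x v) (x u) < e" if "u \<le> v" "u \<in> {a..b}" "v \<in> {a..b}" "v - u < d" for u v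
  proof -
    have "{cbox u v} division_of \<Union>{cbox u v}" using division_of_self[of u v] that by simp
    from d(2)[rule_format, OF this] that show ?thesis by (simp add: dist_norm)
  qed
  show "\<exists>d>0. \<forall>x'\<in>{a..b}. dist x' t < d \<longrightarrow> dist (x x') (x t) < e"
  proof (intro exI[of _ d] conjI ballI impI d(1))
    fix s assume s: "s \<in> {a..b}" "dist s t < d"
    show "dist (x s) (x t) < e"
    proof (cases "s \<le> t")
      case True then show ?thesis using key[of s t] s t by (auto simp: dist_commute dist_real_def)
    next
      case False then show ?thesis using key[of t s] s t by (auto simp: dist_real_def)
    qed
  qed
qed

lemma abs_continuous_on_diff:
  fixes x y :: "real \<Rightarrow> 'a::real_normed_vector"
  assumes x: "abs_continuous_on a b x" and y: "abs_continuous_on a b y"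
  shows "abs_continuous_on a b (\<lambda>t. x t - y t)"
  unfolding abs_continuous_on_def
proof (intro allI impI)
  fix e :: real assume e: "e > 0"
  obtain d where d: "d > 0" "\<forall>\<D>. \<D> division_of \<Union>\<D> \<longrightarrow> \<Union>\<D> \<subseteq> {a..b} \<longrightarrow> (\<Sum>I\<in>\<D>. Sup I - Inf I) < d
        \<longrightarrow> (\<Sum>I\<in>\<D>. norm (x (Sup I) - x (Inf I))) < e/2"
    by (rule abs_continuous_onD[OF x half_gt_zero[OF e]])
  obtain r where r: "r > 0" "\<forall>\<D>. \<D> division_of \<Union>\<D> \<longrightarrow> \<Union>\<D> \<subseteq> {a..b} \<longrightarrow> (\<Sum>I\<in>\<D>. Sup I - Inf I) < r
        \<longrightarrow> (\<Sum>I\<in>\<D>. norm (y (Sup I) - y (Inf I))) < e/2"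
    by (rule abs_continuous_onD[OF y half_gt_zero[OF e]])
  show "\<exists>d>0. \<forall>\<D>. \<D> division_of \<Union>\<D> \<and> \<Union>\<D> \<subseteq> {a..b} \<and> (\<Sum>I\<in>\<D>. Sup I - Inf I) < d
        \<longrightarrow> (\<Sum>I\<in>\<D>. norm (x (Sup I) - y (Sup I) - (x (Inf I) - y (Inf I)))) < e"
  proof (intro exI[of _ "min d r"] conjI allI impI)
    show "0 < min d r" using d r by simp
    fix \<D> :: "real set set"
    assume D: "\<D> division_of \<Union>\<D> \<and> \<Union>\<D> \<subseteq> {a..b} \<and> (\<Sum>I\<in>\<D>. Sup I - Inf I) < min d r"
    have "(\<Sum>I\<in>\<D>. norm (x (Sup I) - y (Sup I) - (x (Inf I) - y (Inf I))))
        \<le> (\<Sum>I\<in>\<D>. norm (x (Sup I) - x (Inf I)) + norm (y (Sup I) - y (Inf I)))"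
    proof (rule sum_mono)
      fix I
      show "norm (x (Sup I) - y (Sup I) - (x (Inf I) - y (Inf I)))
          \<le> norm (x (Sup I) - x (Inf I)) + norm (y (Sup I) - y (Inf I))"
        using norm_triangle_ineq4[of "x (Sup I) - x (Inf I)" "y (Sup I) - y (Inf I)"]
        by (simp add: algebra_simps)
    qed
    also have "\<dots> < e/2 + e/2"
      unfolding sum.distrib using D d(2)[rule_format, of \<D>] r(2)[rule_format, of \<D>]
      by (intro add_strict_mono) auto
    finally show "(\<Sum>I\<in>\<D>. norm (x (Sup I) - y (Sup I) - (x (Inf I) - y (Inf I)))) < e" by simp
  qed
qed

lemma abs_continuous_on_shift:
  fixes x :: "real \<Rightarrow> 'a::real_normed_vector"
  assumes ac: "abs_continuous_on (c + a) (c + b) x"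
  shows "abs_continuous_on a b (\<lambda>s. x (c + s))"
  unfolding abs_continuous_on_def
proof (intro allI impI)
  fix e :: real assume e: "e > 0"
  obtain d where d: "d > 0" "\<forall>\<D>. \<D> division_of \<Union>\<D> \<longrightarrow> \<Union>\<D> \<subseteq> {c+a..c+b} \<longrightarrow> (\<Sum>I\<in>\<D>. Sup I - Inf I) < d
        \<longrightarrow> (\<Sum>I\<in>\<D>. norm (x (Sup I) - x (Inf I))) < e"
    by (rule abs_continuous_onD[OF ac e])
  show "\<exists>d>0. \<forall>\<D>. \<D> division_of \<Union>\<D> \<and> \<Union>\<D> \<subseteq> {a..b} \<and> (\<Sum>I\<in>\<D>. Sup I - Inf I) < d
        \<longrightarrow> (\<Sum>I\<in>\<D>. norm (x (c + Sup I) - x (c + Inf I))) < e"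
  proof (intro exI[of _ d] conjI allI impI d(1))
    fix \<D> :: "real set set"
    assume "\<D> division_of \<Union>\<D> \<and> \<Union>\<D> \<subseteq> {a..b} \<and> (\<Sum>I\<in>\<D>. Sup I - Inf I) < d"
    then have D: "\<D> division_of \<Union>\<D>" "\<Union>\<D> \<subseteq> {a..b}" "(\<Sum>I\<in>\<D>. Sup I - Inf I) < d" by auto
    define S where "S I = (+) c ` I" for I
    have inj: "inj_on S \<D>" unfolding S_def by (rule inj_onI) (simp add: inj_image_eq_iff)
    have ends: "Sup (S I) = c + Sup I" "Inf (S I) = c + Inf I" "\<exists>u v. S I = cbox u v" "S I \<noteq> {}" if I: "I \<in> \<D>" for I
    proof -
      obtain u v where uv: "u \<le> v" "I = {u..v}" "Inf I = u" "Sup I = v"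
        using division_of_real_interval[OF D(1) I] by metis
      then have SI: "S I = {c+u..c+v}" by (simp add: S_def image_add_atLeastAtMost)
      then show "Sup (S I) = c + Sup I" "Inf (S I) = c + Inf I" "S I \<noteq> {}" using uv by auto
      show "\<exists>u v. S I = cbox u v" using SI by (metis box_real(2))
    qed
    have "(S ` \<D>) division_of \<Union>(S ` \<D>)"
    proof (rule division_ofI)
      show "finite (S ` \<D>)" using D(1) by auto
      fix K assume "K \<in> S ` \<D>"
      then obtain I where I: "I \<in> \<D>" "K = S I" by blast
      then show "K \<subseteq> \<Union>(S ` \<D>)" "K \<noteq> {}" "\<exists>a b. K = cbox a b" using ends[of I] by auto
      fix K' assume "K' \<in> S ` \<D>" "K \<noteq> K'"
      then obtain I' where I': "I' \<in> \<D>" "K' = S I'" "I \<noteq> I'" using I by blast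
      then have "interior I \<inter> interior I' = {}" using division_ofD(5)[OF D(1)] I by blast
      then show "interior K \<inter> interior K' = {}"
        unfolding I I' S_def interior_translation by auto
    qed simp
    moreover have "\<Union>(S ` \<D>) \<subseteq> {c+a..c+b}" using D(2) by (force simp: S_def)
    moreover have "(\<Sum>K\<in>S ` \<D>. Sup K - Inf K) = (\<Sum>I\<in>\<D>. Sup I - Inf I)"
      unfolding sum.reindex[OF inj] by (rule sum.cong) (simp_all add: ends)
    moreover have "(\<Sum>K\<in>S ` \<D>. norm (x (Sup K) - x (Inf K))) = (\<Sum>I\<in>\<D>. norm (x (c + Sup I) - x (c + Inf I)))"
      unfolding sum.reindex[OF inj] by (rule sum.cong) (simp_all add: ends)
    ultimately show "(\<Sum>I\<in>\<D>. norm (x (c + Sup I) - x (c + Inf I))) < e"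
      using d(2)[rule_format, of "S ` \<D>"] D(3) by simp
  qed
qed

lemma C1_imp_Lipschitz:
  fixes f :: "real \<Rightarrow> 'a::real_normed_vector"
  assumes der: "\<And>t. t \<in> {a..b} \<Longrightarrow> (f has_vector_derivative f' t) (at t within {a..b})"
    and cont: "continuous_on {a..b} f'"
  obtains L where "L \<ge> 0" "\<forall>s t. a \<le> s \<longrightarrow> s \<le> t \<longrightarrow> t \<le> b \<longrightarrow> norm (f t - f s) \<le> L * (t - s)"
proof -
  have "bounded (f' ` {a..b})" by (intro compact_imp_bounded compact_continuous_image cont compact_Icc)
  then obtain L where L: "L > 0" "\<And>t. t \<in> {a..b} \<Longrightarrow> norm (f' t) \<le> L"
    unfolding bounded_pos by auto
  have "norm (f t - f s) \<le> L * (t - s)" if "a \<le> s" "s \<le> t" "t \<le> b" for s t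
  proof -
    have "norm (f t - f s) \<le> L * norm (t - s)"
    proof (rule differentiable_bound[of "{a..b}" f "\<lambda>u h. h *\<^sub>R f' u" L t s])
      fix u assume u: "u \<in> {a..b}"
      show "(f has_derivative (\<lambda>h. h *\<^sub>R f' u)) (at u within {a..b})"
        using der[OF u] by (simp add: has_vector_derivative_def)
      show "onorm (\<lambda>h. h *\<^sub>R f' u) \<le> L"
        by (rule onorm_le) (use L(2)[OF u] in \<open>auto simp: mult.commute[of L] intro: mult_left_mono\<close>)
    qed (use that in auto)
    then show ?thesis using that by simp
  qed
  then show ?thesis using that[of L] L(1) by auto
qed

lemma abs_continuous_on_C1:
  fixes f :: "real \<Rightarrow> 'a::real_normed_vector"
  assumes "\<And>t. t \<in> {a..b} \<Longrightarrow> (f has_vector_derivative f' t) (at t within {a..b})"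
    and "continuous_on {a..b} f'"
  shows "abs_continuous_on a b f"
  by (rule C1_imp_Lipschitz[OF assms]) (auto intro: abs_continuous_on_Lipschitz)

text \<open>
The proof for a derivative that exists everywhere carries over to the tagged intervals whose tag lies outside \<open>N\<close>. For
the tags in \<open>N\<close> the gauge forces the intervals into an open set of small measure around \<open>N\<close>; their total length is
then small, and absolute continuity makes the increments of \<open>x\<close> over them small, while the integrand is set to zero
on \<open>N\<close>.
\<close>

theorem fundamental_theorem_of_calculus_abs_continuous:
  fixes x :: "real \<Rightarrow> 'a::banach"
  assumes ab: "a \<le> b" and ac: "abs_continuous_on a b x" and N: "negligible N"
    and der: "\<And>t. t \<in> {a..b} - N \<Longrightarrow> (x has_vector_derivative g t) (at t within {a..b})"
  shows "(g has_integral (x b - x a)) {a..b}"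
proof -
  define h where "h t = (if t \<in> N then 0 else g t)" for t
  have "(h has_integral (x b - x a)) {a..b}"
    unfolding box_real[symmetric] has_integral
  proof (intro allI impI)
    fix e :: real assume e: "e > 0"
    define e' where "e' = e / (2 * (b - a + 1))"
    have e': "e' > 0" using e ab by (simp add: e'_def)
    have "\<exists>d>0. t \<in> {a..b} - N \<longrightarrow>
         (\<forall>y\<in>{a..b}. norm (y-t) < d \<longrightarrow> norm (x y - x t - (y-t) *\<^sub>R g t) \<le> e' * norm (y-t))" for t
    proof (cases "t \<in> {a..b} - N")
      case True
      from der[OF this] e' show ?thesis unfolding has_vector_derivative_def has_derivative_within_alt by blast
    qed (auto intro: exI[of _ 1])
    then obtain d where d: "\<And>t. 0 < d t"
                 "\<And>t y. \<lbrakk>t \<in> {a..b} - N; y \<in> {a..b}; norm (y-t) < d t\<rbrakk>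
                        \<Longrightarrow> norm (x y - x t - (y-t) *\<^sub>R g t) \<le> e' * norm (y-t)"
      by metis
    obtain r where r: "r > 0" "\<forall>\<D>. \<D> division_of \<Union>\<D> \<longrightarrow> \<Union>\<D> \<subseteq> {a..b} \<longrightarrow> (\<Sum>I\<in>\<D>. Sup I - Inf I) < r
        \<longrightarrow> (\<Sum>I\<in>\<D>. norm (x (Sup I) - x (Inf I))) < e/2"
      by (rule abs_continuous_onD[OF ac half_gt_zero[OF e]])
    have Nset: "N \<in> sets lebesgue" "emeasure lebesgue N = 0"
      using N by (auto simp: negligible_iff_null_sets)
    \<comment> \<open>intervals tagged in the null set are confined to an open set of measure below \<open>r\<close>\<close>
    obtain W where W: "open W" "N \<subseteq> W" "W - N \<in> lmeasurable" "emeasure lebesgue (W - N) < ennreal r"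
      using sets_lebesgue_outer_open[OF Nset(1) r(1)] by metis
    have Wm: "W \<in> lmeasurable" "measure lebesgue W < r"
    proof -
      have N0: "N \<in> null_sets lebesgue" using N by (simp add: negligible_iff_null_sets)
      have "emeasure lebesgue (W - N) = emeasure lebesgue W"
        using W(1) by (intro emeasure_Diff_null_set[OF N0]) auto
      then have *: "emeasure lebesgue W < ennreal r" using W by simp
      then show Wl: "W \<in> lmeasurable"
        using W(1) order_less_trans[OF * ennreal_less_top] by (intro fmeasurableI) (auto simp: infinity_ennreal_def)
      show "measure lebesgue W < r"
        using * r(1) emeasure_eq_measure2[OF Wl] by (simp add: ennreal_less_iff)
    qed
    obtain c where c: "\<And>t. 0 < c t" "\<And>t. t \<in> N \<Longrightarrow> ball t (c t) \<subseteq> W"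
    proof -
      have "\<forall>t. \<exists>c>0. t \<in> N \<longrightarrow> ball t c \<subseteq> W"
        using W(1,2) unfolding open_contains_ball by (meson subsetD zero_less_one)
      then show ?thesis using that by metis
    qed
    define G where "G = (\<lambda>t. ball t (if t \<in> N then c t else d t))"
    show "\<exists>\<gamma>. gauge \<gamma> \<and> (\<forall>\<D>. \<D> tagged_division_of cbox a b \<and> \<gamma> fine \<D> \<longrightarrow>
        norm ((\<Sum>(x, k)\<in>\<D>. measure lborel k *\<^sub>R h x) - (x b - x a)) < e)"
    proof (intro exI[of _ G] conjI allI impI)
      show "gauge G" unfolding G_def using c(1) d(1) by (intro gauge_ball_dependent) auto
      fix p assume "p tagged_division_of cbox a b \<and> G fine p"
      then have p: "p tagged_division_of cbox a b" and fine: "G fine p" by auto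
      note fin = tagged_division_of_finite[OF p]
      define pN where "pN = {q \<in> p. fst q \<in> N}"
      define pg where "pg = {q \<in> p. fst q \<notin> N}"
      have split: "p = pN \<union> pg" "pN \<inter> pg = {}" and fins: "finite pN" "finite pg"
        using fin by (auto simp: pN_def pg_def)
      have int: "\<exists>u v. K = {u..v} \<and> u \<le> v \<and> t \<in> {u..v} \<and> {u..v} \<subseteq> {a..b} \<and> Sup K = v \<and> Inf K = u \<and> measure lborel K = v - u"
        if "(t, K) \<in> p" for t K
      proof -
        have "t \<in> K" "K \<subseteq> cbox a b" "\<exists>u v. K = cbox u v"
          using tagged_division_ofD[OF p] that by blast+
        then obtain u v where "K = {u..v}" by auto
        moreover have "u \<le> v" using \<open>t \<in> K\<close> calculation by auto
        ultimately show ?thesis using \<open>t \<in> K\<close> \<open>K \<subseteq> cbox a b\<close>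
          by (intro exI[of _ u] exI[of _ v]) auto
      qed
      have tele: "x b - x a = (\<Sum>(t,K)\<in>p. x (Sup K) - x (Inf K))"
        using additive_tagged_division_1[of a b p x] ab p by auto
      have tele1: "b - a = (\<Sum>(t,K)\<in>p. Sup K - Inf K)"
        using additive_tagged_division_1[of a b p "\<lambda>x. x"] ab p by auto
      have "(\<Sum>(t,K)\<in>p. measure lborel K *\<^sub>R h t) - (x b - x a)
          = (\<Sum>(t,K)\<in>p. measure lborel K *\<^sub>R h t - (x (Sup K) - x (Inf K)))"
        unfolding tele by (simp add: sum_subtractf split_def)
      also have "\<dots> = (\<Sum>(t,K)\<in>pN. measure lborel K *\<^sub>R h t - (x (Sup K) - x (Inf K)))
                    + (\<Sum>(t,K)\<in>pg. measure lborel K *\<^sub>R h t - (x (Sup K) - x (Inf K)))"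
        using split fins by (simp add: sum.union_disjoint)
      finally have eq: "(\<Sum>(t,K)\<in>p. measure lborel K *\<^sub>R h t) - (x b - x a) = \<dots>" .
      have bg: "norm (\<Sum>(t,K)\<in>pg. measure lborel K *\<^sub>R h t - (x (Sup K) - x (Inf K)))
          \<le> (\<Sum>(t,K)\<in>pg. e' * (Sup K - Inf K))"
      proof (rule sum_norm_le, clarify)
        fix t K assume tK: "(t, K) \<in> pg"
        then have "(t, K) \<in> p" "t \<notin> N" by (auto simp: pg_def)
        then obtain u v where uv: "K = {u..v}" "u \<le> v" "t \<in> {u..v}" "{u..v} \<subseteq> {a..b}" "Sup K = v" "Inf K = u" "measure lborel K = v - u"
          using int by blast
        have "K \<subseteq> G t" using fine \<open>(t, K) \<in> p\<close> unfolding fine_def by blast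
        then have "K \<subseteq> ball t (d t)" using \<open>t \<notin> N\<close> by (simp add: G_def)
        then have near: "norm (u - t) < d t" "norm (v - t) < d t"
        proof -
          have "u \<in> ball t (d t)" "v \<in> ball t (d t)" using \<open>K \<subseteq> ball t (d t)\<close> uv(1,2) by auto
          then show "norm (u - t) < d t" "norm (v - t) < d t" by (auto simp: dist_norm norm_minus_commute)
        qed
        have tin: "t \<in> {a..b} - N" using uv \<open>t \<notin> N\<close> by auto
        have "norm ((v - u) *\<^sub>R g t - (x v - x u))
          = norm ((x u - x t - (u - t) *\<^sub>R g t) - (x v - x t - (v - t) *\<^sub>R g t))"
          by (simp add: algebra_simps)
        also have "\<dots> \<le> norm (x u - x t - (u - t) *\<^sub>R g t) + norm (x v - x t - (v - t) *\<^sub>R g t)"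
          by (rule norm_triangle_ineq4)
        also have "\<dots> \<le> e' * norm (u - t) + e' * norm (v - t)"
          by (intro add_mono d(2)[OF tin _ near(1)] d(2)[OF tin _ near(2)]) (use uv in auto)
        also have "\<dots> = e' * (v - u)" using uv by (simp add: algebra_simps)
        finally show "norm (measure lborel K *\<^sub>R h t - (x (Sup K) - x (Inf K))) \<le> e' * (Sup K - Inf K)"
          using uv \<open>t \<notin> N\<close> by (simp add: h_def)
      qed
      also have "\<dots> \<le> (\<Sum>(t,K)\<in>p. e' * (Sup K - Inf K))"
      proof (rule sum_mono2[OF fin])
        fix q assume "q \<in> p - pg"
        moreover obtain t K where "q = (t, K)" by (cases q)
        ultimately show "0 \<le> (case q of (t, K) \<Rightarrow> e' * (Sup K - Inf K))" using int[of t K] e' by auto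
      qed (use split in auto)
      also have "\<dots> = e' * (b - a)" unfolding tele1 by (simp add: sum_distrib_left split_def)
      also have "\<dots> < e / 2"
      proof -
        have "e' * (b - a) < e' * (b - a + 1)" using e' by simp
        also have "\<dots> = e / 2" using ab by (simp add: e'_def field_simps)
        finally show ?thesis .
      qed
      finally have bg: "norm (\<Sum>(t,K)\<in>pg. measure lborel K *\<^sub>R h t - (x (Sup K) - x (Inf K))) < e/2" .
      have part: "pN tagged_partial_division_of cbox a b"
        using p tagged_partial_division_subset[of p "cbox a b" pN] by (auto simp: pN_def tagged_division_of_def)
      note pU = tagged_partial_division_of_Union_self[OF part]
      define \<D> where "\<D> = snd ` pN"
      have D: "\<D> division_of \<Union>\<D>" unfolding \<D>_def by (rule division_of_tagged_division[OF pU])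
      have Dp: "\<exists>t. (t, K) \<in> p" if "K \<in> \<D>" for K using that by (auto simp: \<D>_def pN_def)
      have Dsub: "\<Union>\<D> \<subseteq> {a..b}" using Dp int by blast
      have cont: "Sup K - Inf K = measure lebesgue K" if K: "K \<in> \<D>" for K
      proof -
        obtain t where "(t, K) \<in> p" using Dp[OF K] by blast
        from int[OF this] obtain u v where "K = {u..v}" "u \<le> v" "Sup K = v" "Inf K = u" by blast
        then show ?thesis by (simp only:) simp
      qed
      have "(\<Sum>K\<in>\<D>. Sup K - Inf K) = (\<Sum>K\<in>\<D>. measure lebesgue K)" using cont by simp
      also have "\<dots> = measure lebesgue (\<Union>\<D>)"
        using content_division[OF D] by simp
      also have "\<dots> \<le> measure lebesgue W"
      proof (rule measure_mono_fmeasurable)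
        show "\<Union>\<D> \<subseteq> W"
        proof
          fix s assume "s \<in> \<Union>\<D>"
          then obtain t K where "(t, K) \<in> p" "t \<in> N" "s \<in> K" by (auto simp: \<D>_def pN_def)
          then have "s \<in> G t" using fine unfolding fine_def by blast
          then have "s \<in> ball t (c t)" using \<open>t \<in> N\<close> by (simp add: G_def)
          then show "s \<in> W" using c(2)[OF \<open>t \<in> N\<close>] by auto
        qed
        show "\<Union>\<D> \<in> sets lebesgue" 
          using lmeasurable_division[OF D] by auto
      qed (rule Wm(1))
      also have "\<dots> < r" by (rule Wm(2))
      finally have "(\<Sum>K\<in>\<D>. norm (x (Sup K) - x (Inf K))) < e/2"
        using r(2)[rule_format, OF D Dsub] by blast
      moreover have "(\<Sum>(t,K)\<in>pN. norm (x (Sup K) - x (Inf K))) = (\<Sum>K\<in>\<D>. norm (x (Sup K) - x (Inf K)))"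
      proof -
        \<comment> \<open>The case distinction makes the summand vanish on every degenerate interval, the empty one included.\<close>
        define D where "D K = (if K = {} then 0 else norm (x (Sup K) - x (Inf K)))" for K
        have "(\<Sum>(t,K)\<in>pN. D K) = (\<Sum>K\<in>snd ` pN. D K)"
        proof (rule sum.over_tagged_division_lemma[OF pU])
          fix u v :: real assume "box u v = {}"
          then have "u = v \<or> cbox u v = {}" by auto
          then show "D (cbox u v) = 0" by (auto simp: D_def)
        qed
        moreover have "(\<Sum>(t,K)\<in>pN. D K) = (\<Sum>(t,K)\<in>pN. norm (x (Sup K) - x (Inf K)))"
          by (rule sum.cong) (auto simp: D_def pN_def dest: int)
        moreover have "(\<Sum>K\<in>snd ` pN. D K) = (\<Sum>K\<in>\<D>. norm (x (Sup K) - x (Inf K)))"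
          unfolding \<D>_def by (rule sum.cong) (auto simp: D_def pN_def dest: int)
        ultimately show ?thesis by simp
      qed
      moreover have "norm (\<Sum>(t,K)\<in>pN. measure lborel K *\<^sub>R h t - (x (Sup K) - x (Inf K)))
          \<le> (\<Sum>(t,K)\<in>pN. norm (x (Sup K) - x (Inf K)))"
        by (rule sum_norm_le) (auto simp: pN_def h_def norm_minus_commute)
      ultimately have bN: "norm (\<Sum>(t,K)\<in>pN. measure lborel K *\<^sub>R h t - (x (Sup K) - x (Inf K))) < e/2"
        by linarith
      show "norm ((\<Sum>(x, k)\<in>p. measure lborel k *\<^sub>R h x) - (x b - x a)) < e"
        unfolding eq using norm_triangle_lt[OF add_strict_mono[OF bN bg, simplified]] by simp
    qed
  qed
  then show ?thesis
    by (rule has_integral_spike[OF N, rotated]) (auto simp: h_def)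
qed

section \<open>The matrix exponential\<close>

abbreviation mat_power :: "real^'n^'n \<Rightarrow> nat \<Rightarrow> real^'n^'n" where
  "mat_power A k \<equiv> ((**) A ^^ k) (mat 1)"

lemma mat_power_Suc_right: "mat_power A (Suc k) = mat_power A k ** A"
proof (induction k)
  case (Suc k)
  have "mat_power A (Suc (Suc k)) = A ** (mat_power A k ** A)" using Suc.IH by simp
  then show ?case by (simp add: matrix_mul_assoc)
qed simp

lemma mat_power_scaleR: "mat_power (t *\<^sub>R A) k = t ^ k *\<^sub>R mat_power A k"
  by (induction k) (simp_all add: vec_eq_iff matrix_matrix_mult_def sum_distrib_left mult_ac)

lemma mat_power_entry_bound:
  fixes A :: "real^'n^'n"
  shows "\<bar>mat_power A k $ i $ j\<bar> \<le> (\<Sum>i\<in>UNIV. \<Sum>l\<in>UNIV. \<bar>A $ i $ l\<bar>) ^ k"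
proof (induction k arbitrary: i j)
  case 0 show ?case by (simp add: mat_def)
next
  case (Suc k)
  let ?c = "\<Sum>i\<in>UNIV. \<Sum>l\<in>UNIV. \<bar>A $ i $ l\<bar>"
  have c0: "?c \<ge> 0" by (intro sum_nonneg) auto
  have "\<bar>mat_power A (Suc k) $ i $ j\<bar> \<le> (\<Sum>l\<in>UNIV. \<bar>A $ i $ l\<bar> * \<bar>mat_power A k $ l $ j\<bar>)"
    by (auto simp: matrix_matrix_mult_def abs_mult intro: order_trans[OF sum_abs])
  also have "\<dots> \<le> (\<Sum>l\<in>UNIV. \<bar>A $ i $ l\<bar> * ?c ^ k)"
    by (intro sum_mono mult_left_mono Suc.IH) auto
  also have "\<dots> = (\<Sum>l\<in>UNIV. \<bar>A $ i $ l\<bar>) * ?c ^ k" by (simp add: sum_distrib_right)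
  also have "\<dots> \<le> ?c * ?c ^ k"
    using c0 by (intro mult_right_mono member_le_sum[of i UNIV "\<lambda>i. \<Sum>l\<in>UNIV. \<bar>A $ i $ l\<bar>"] sum_nonneg) auto
  finally show ?case by simp
qed

text \<open>
The exponential is treated entry by entry, because each entry of \<open>e\<^bsup>tA\<^esup>\<close> is a real power series in \<open>t\<close>, which can be
differentiated termwise.
\<close>

definition exp_entry :: "real^'n^'n \<Rightarrow> 'n \<Rightarrow> 'n \<Rightarrow> real \<Rightarrow> real" where
  "exp_entry A i j t = (\<Sum>k. (mat_power A k $ i $ j / fact k) * t ^ k)"

lemma summable_exp_entry: "summable (\<lambda>k. (mat_power A k $ i $ j / fact k) * t ^ k)"
proof (rule summable_comparison_test')
  let ?c = "\<Sum>i\<in>UNIV. \<Sum>l\<in>UNIV. \<bar>A $ i $ l\<bar>"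
  show "summable (\<lambda>k. inverse (fact k) * (?c * \<bar>t\<bar>) ^ k)" by (rule summable_exp)
  fix k
  show "norm ((mat_power A k $ i $ j / fact k) * t ^ k) \<le> inverse (fact k) * (?c * \<bar>t\<bar>) ^ k"
    using mult_right_mono[OF mat_power_entry_bound[where A = A and k = k and i = i and j = j], of "\<bar>t\<bar> ^ k / fact k"]
    by (simp add: abs_mult power_mult_distrib power_abs field_simps)
qed

lemma mat_exp_entry: "mat_exp (t *\<^sub>R A) $ i $ j = exp_entry A i j t"
proof -
  let ?f = "\<lambda>k. (1 / fact k) *\<^sub>R mat_power (t *\<^sub>R A) k"
  have "(\<lambda>k. ?f k $ i $ j) sums exp_entry A i j t" for i j
    using summable_sums[OF summable_exp_entry[of A i j t]]
    unfolding exp_entry_def by (simp add: mat_power_scaleR mult_ac)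
  then have "?f sums (\<chi> i j. exp_entry A i j t)"
    unfolding sums_def by (intro vec_tendstoI) simp
  then show ?thesis unfolding mat_exp_def by (simp add: sums_iff)
qed

lemma exp_entry_0: "exp_entry A i j 0 = mat 1 $ i $ j"
  unfolding exp_entry_def powser_zero by simp

lemma mat_exp_0: "mat_exp (0 *\<^sub>R A) = mat 1"
  unfolding vec_eq_iff mat_exp_entry exp_entry_0 by simp

lemma exp_entry_deriv:
  "(exp_entry A i j has_field_derivative (\<Sum>k. (mat_power A (Suc k) $ i $ j / fact k) * t ^ k)) (at t)"
proof -
  have "diffs (\<lambda>k. mat_power A k $ i $ j / fact k) = (\<lambda>k. mat_power A (Suc k) $ i $ j / fact k)"
    by (simp add: diffs_def fun_eq_iff del: of_nat_Suc funpow.simps)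
  then show ?thesis
    unfolding exp_entry_def[abs_def]
    using termdiffs_strong_converges_everywhere[OF summable_exp_entry, of A i j t] by simp
qed

lemma matrix_entries: "(M :: real^'n^'m) = (\<Sum>i\<in>UNIV. \<Sum>j\<in>UNIV. (M $ i $ j) *\<^sub>R axis i (axis j 1))"
proof -
  have "(M $ i $ j *\<^sub>R axis i (axis j 1) :: real^'n^'m) $ a $ b
      = (if j = b then (if i = a then M $ a $ b else 0) else 0)" for i j a b
    by (simp add: axis_def)
  then show ?thesis by (simp add: vec_eq_iff sum_component del: vector_scaleR_component)
qed

lemma has_vector_derivative_mat_exp_series:
  "((\<lambda>t. mat_exp (t *\<^sub>R A)) has_vector_derivative (\<chi> i j. \<Sum>k. (mat_power A (Suc k) $ i $ j / fact k) * t ^ k)) (at t within S)"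
proof -
  let ?D = "\<lambda>i j. \<Sum>k. (mat_power A (Suc k) $ i $ j / fact k) * t ^ k"
  have "(exp_entry A i j has_field_derivative ?D i j) (at t within S)" for i j
    by (rule has_field_derivative_at_within[OF exp_entry_deriv])
  then have "((\<lambda>t. \<Sum>i\<in>UNIV. \<Sum>j\<in>UNIV. exp_entry A i j t *\<^sub>R axis i (axis j 1) :: real^_^_) has_vector_derivative
        (\<Sum>i\<in>UNIV. \<Sum>j\<in>UNIV. ?D i j *\<^sub>R axis i (axis j 1))) (at t within S)"
    by (auto intro!: derivative_eq_intros)
  moreover have "(\<lambda>t. \<Sum>i\<in>UNIV. \<Sum>j\<in>UNIV. exp_entry A i j t *\<^sub>R axis i (axis j 1)) = (\<lambda>t. mat_exp (t *\<^sub>R A))"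
    using matrix_entries[of "mat_exp (_ *\<^sub>R A)"] by (simp add: mat_exp_entry)
  moreover have "(\<Sum>i\<in>UNIV. \<Sum>j\<in>UNIV. ?D i j *\<^sub>R axis i (axis j 1)) = (\<chi> i j. ?D i j)"
    using matrix_entries[of "\<chi> i j. ?D i j"] by simp
  ultimately show ?thesis by simp
qed

lemma sum_div_times: "(\<Sum>l\<in>S. a l * b l) / c * d = (\<Sum>l\<in>S. a l * (b l / c * d))" for c d :: real
  unfolding sum_divide_distrib sum_distrib_right by (intro sum.cong) auto

lemma has_vector_derivative_mat_exp:
  "((\<lambda>t. mat_exp (t *\<^sub>R A)) has_vector_derivative A ** mat_exp (t *\<^sub>R A)) (at t within S)"
proof -
  have "(\<Sum>k. (mat_power A (Suc k) $ i $ j / fact k) * t ^ k) = (A ** mat_exp (t *\<^sub>R A)) $ i $ j" for i j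
  proof -
    have "(\<Sum>k. (mat_power A (Suc k) $ i $ j / fact k) * t ^ k)
        = (\<Sum>k. \<Sum>l\<in>UNIV. A $ i $ l * ((mat_power A k $ l $ j / fact k) * t ^ k))"
      unfolding sum_div_times[symmetric] by (simp add: matrix_matrix_mult_def)
    also have "\<dots> = (\<Sum>l\<in>UNIV. \<Sum>k. A $ i $ l * ((mat_power A k $ l $ j / fact k) * t ^ k))"
      by (intro suminf_sum summable_mult summable_exp_entry)
    also have "\<dots> = (\<Sum>l\<in>UNIV. A $ i $ l * exp_entry A l j t)"
      unfolding exp_entry_def by (intro sum.cong refl suminf_mult summable_exp_entry)
    also have "\<dots> = (A ** mat_exp (t *\<^sub>R A)) $ i $ j"
      by (simp add: matrix_matrix_mult_def mat_exp_entry)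
    finally show ?thesis .
  qed
  then have "(\<chi> i j. \<Sum>k. (mat_power A (Suc k) $ i $ j / fact k) * t ^ k) = A ** mat_exp (t *\<^sub>R A)"
    by (simp add: vec_eq_iff del: funpow.simps)
  with has_vector_derivative_mat_exp_series[of A t S] show ?thesis by simp
qed

text \<open>
Both products are the derivative of \<open>e\<^bsup>tA\<^esup>\<close>, because a power of \<open>A\<close> can be peeled off on either side.
\<close>

lemma mat_exp_commute: "mat_exp (t *\<^sub>R A) ** A = A ** mat_exp (t *\<^sub>R A)"
proof -
  have "(\<Sum>k. (mat_power A (Suc k) $ i $ j / fact k) * t ^ k) = (mat_exp (t *\<^sub>R A) ** A) $ i $ j" for i j
  proof -
    have "(\<Sum>k. (mat_power A (Suc k) $ i $ j / fact k) * t ^ k)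
        = (\<Sum>k. \<Sum>l\<in>UNIV. A $ l $ j * ((mat_power A k $ i $ l / fact k) * t ^ k))"
      unfolding sum_div_times[symmetric] mat_power_Suc_right by (simp add: matrix_matrix_mult_def mult.commute)
    also have "\<dots> = (\<Sum>l\<in>UNIV. \<Sum>k. A $ l $ j * ((mat_power A k $ i $ l / fact k) * t ^ k))"
      by (intro suminf_sum summable_mult summable_exp_entry)
    also have "\<dots> = (\<Sum>l\<in>UNIV. A $ l $ j * exp_entry A i l t)"
      unfolding exp_entry_def by (intro sum.cong refl suminf_mult summable_exp_entry)
    also have "\<dots> = (mat_exp (t *\<^sub>R A) ** A) $ i $ j"
      by (simp add: matrix_matrix_mult_def mat_exp_entry mult.commute)
    finally show ?thesis .
  qed
  then have "(\<chi> i j. \<Sum>k. (mat_power A (Suc k) $ i $ j / fact k) * t ^ k) = mat_exp (t *\<^sub>R A) ** A"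
    by (simp add: vec_eq_iff del: funpow.simps)
  with has_vector_derivative_mat_exp_series[of A t UNIV]
  have "((\<lambda>t. mat_exp (t *\<^sub>R A)) has_vector_derivative mat_exp (t *\<^sub>R A) ** A) (at t)" by simp
  with has_vector_derivative_mat_exp[of A t UNIV] show ?thesis
    by (rule vector_derivative_unique_at[rotated])
qed

lemma bounded_bilinear_matrix_vector: "bounded_bilinear ((*v) :: real^'n^'m \<Rightarrow> real^'n \<Rightarrow> real^'m)"
proof -
  have "bilinear ((*v) :: real^'n^'m \<Rightarrow> real^'n \<Rightarrow> real^'m)"
    unfolding bilinear_def
    by (auto intro!: linearI simp: matrix_vector_mult_def vec_eq_iff algebra_simps sum.distrib sum_distrib_left)
  then show ?thesis by (simp add: bilinear_conv_bounded_bilinear)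
qed

lemma infnorm_mult_vec_le:
  fixes M :: "real^'n^'m"
  shows "infnorm (M *v x) \<le> row_sum_norm M * infnorm x"
proof -
  have "\<bar>(M *v x) $ i\<bar> \<le> row_sum_norm M * infnorm x" for i
  proof -
    have "\<bar>(M *v x) $ i\<bar> \<le> (\<Sum>j\<in>UNIV. \<bar>M $ i $ j\<bar> * \<bar>x $ j\<bar>)"
      by (auto simp: matrix_vector_mult_def abs_mult intro: order_trans[OF sum_abs])
    also have "\<dots> \<le> (\<Sum>j\<in>UNIV. \<bar>M $ i $ j\<bar> * infnorm x)"
      by (intro sum_mono mult_left_mono component_le_infnorm_cart) auto
    also have "\<dots> = (\<Sum>j\<in>UNIV. \<bar>M $ i $ j\<bar>) * infnorm x" by (simp add: sum_distrib_right)
    also have "\<dots> \<le> row_sum_norm M * infnorm x"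
      unfolding row_sum_norm_def by (intro mult_right_mono Max_ge infnorm_pos_le) auto
    finally show ?thesis .
  qed
  then show ?thesis unfolding infnorm_cart[of "M *v x"] by (intro cSup_least) auto
qed

section \<open>Solutions of the linear equation\<close>

lemma continuous_on_mat_exp [continuous_intros]:
  assumes "continuous_on S g"
  shows "continuous_on S (\<lambda>t. mat_exp (g t *\<^sub>R A))"
proof -
  have "continuous_on UNIV (\<lambda>t. mat_exp (t *\<^sub>R A))"
    by (rule continuous_on_vector_derivative[OF has_vector_derivative_mat_exp])
  from continuous_on_compose2[OF this assms] show ?thesis by simp
qed

lemmas continuous_on_matrix_vector [continuous_intros] =
  bounded_bilinear.continuous_on[OF bounded_bilinear_matrix_vector]

lemma has_vector_derivative_mat_exp_vec:
  "((\<lambda>t. mat_exp (t *\<^sub>R A) *v z) has_vector_derivative A *v (mat_exp (t *\<^sub>R A) *v z)) (at t within S)"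
  using bounded_bilinear.has_vector_derivative[OF bounded_bilinear_matrix_vector
      has_vector_derivative_mat_exp[of A t S] has_vector_derivative_const[of z]]
  by (simp add: matrix_vector_mul_assoc)

lemma loc_abs_continuous_on_Icc:
  "0 \<le> T \<Longrightarrow> loc_abs_continuous_on {0..T} x \<longleftrightarrow> abs_continuous_on 0 T x"
  unfolding loc_abs_continuous_on_def by (auto intro: abs_continuous_on_mono)

lemma ode_ae_iff_negligible:
  assumes "D \<in> sets lebesgue"
  shows "ode_ae \<Sigma> D u v x \<longleftrightarrow> (\<exists>N. negligible N \<and> (\<forall>t\<in>D - N.
    (x has_vector_derivative (matA \<Sigma> *v x t + matB \<Sigma> *v u t + matG \<Sigma> *v v t)) (at t within D)))"
  unfolding ode_ae_def by (rule AE_lebesgue_on_iff_negligible[OF assms])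

text \<open>
The derivative of \<open>s \<mapsto> e\<^bsup>(T-s)A\<^esup> x(s)\<close> is \<open>e\<^bsup>(T-s)A\<^esup>\<close> applied to the forcing term, since the contributions of \<open>A x\<close>
cancel. This function is absolutely continuous because the exponential factor is Lipschitz and both factors are
bounded.
\<close>

lemma variation_of_constants:
  fixes \<Sigma> :: "('n::finite, 'm::finite, 'k::finite) lin_sys"
  assumes sol: "is_solution \<Sigma> {0..T} u v x" and T: "0 \<le> T"
  shows "((\<lambda>s. mat_exp ((T - s) *\<^sub>R matA \<Sigma>) *v (matB \<Sigma> *v u s + matG \<Sigma> *v v s))
          has_integral (x T - mat_exp (T *\<^sub>R matA \<Sigma>) *v x 0)) {0..T}"
proof -
  define A where "A = matA \<Sigma>"
  define E where "E s = mat_exp ((T - s) *\<^sub>R A)" for s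
  interpret mv: bounded_bilinear "(*v) :: real^'n^'n \<Rightarrow> real^'n \<Rightarrow> real^'n"
    by (rule bounded_bilinear_matrix_vector)
  have ac: "abs_continuous_on 0 T x" using sol T by (simp add: is_solution_def loc_abs_continuous_on_Icc)
  obtain N where N: "negligible N" and der: "\<And>t. t \<in> {0..T} - N \<Longrightarrow>
      (x has_vector_derivative (A *v x t + matB \<Sigma> *v u t + matG \<Sigma> *v v t)) (at t within {0..T})"
    using sol unfolding is_solution_def ode_ae_iff_negligible[of "{0..T}", simplified] A_def
    by auto
  have Eder: "(E has_vector_derivative - (E t ** A)) (at t within S)" for t S
  proof -
    have "(((\<lambda>s. mat_exp (s *\<^sub>R A)) \<circ> (\<lambda>s. T - s)) has_vector_derivative (-1) *\<^sub>R (A ** mat_exp ((T - t) *\<^sub>R A))) (at t within S)"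
      by (rule vector_diff_chain_within) (auto intro!: derivative_eq_intros has_vector_derivative_mat_exp)
    then show ?thesis by (simp add: E_def[abs_def] o_def mat_exp_commute)
  qed
  have Econt: "continuous_on {0..T} E" unfolding E_def[abs_def] by (intro continuous_intros)
  have EAcont: "continuous_on {0..T} (\<lambda>t. - (E t ** A))"
    unfolding E_def mat_exp_commute
  proof -
    have "continuous_on {0..T} (\<lambda>t. E t ** A)"
    proof (rule bounded_linear.continuous_on[OF _ Econt])
      show "bounded_linear (\<lambda>M. M ** A)"
        by (intro linear_conv_bounded_linear[THEN iffD1] linearI)
           (simp_all add: matrix_matrix_mult_def vec_eq_iff sum.distrib distrib_right sum_distrib_left mult.assoc)
    qed
    then show "continuous_on {0..T} (\<lambda>t. - (A ** mat_exp ((T - t) *\<^sub>R A)))"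
      by (simp add: E_def mat_exp_commute continuous_on_minus)
  qed
  obtain L where L: "L \<ge> 0" "\<forall>s t. 0 \<le> s \<longrightarrow> s \<le> t \<longrightarrow> t \<le> T \<longrightarrow> norm (E t - E s) \<le> L * (t - s)"
    by (rule C1_imp_Lipschitz[OF Eder EAcont])
  have "bounded (E ` {0..T})" "bounded (x ` {0..T})"
    by (intro compact_imp_bounded compact_continuous_image compact_Icc Econt abs_continuous_on_imp_continuous_on ac)+
  then obtain C1 C2 where C1: "C1 > 0" "\<And>t. t \<in> {0..T} \<Longrightarrow> norm (E t) \<le> C1"
    and C2: "C2 > 0" "\<And>t. t \<in> {0..T} \<Longrightarrow> norm (x t) \<le> C2"
    unfolding bounded_pos by auto
  obtain K where K: "K > 0" "\<And>M z. norm (M *v z :: real^'n) \<le> norm (M :: real^'n^'n) * norm z * K"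
    using mv.pos_bounded by blast
  have acy: "abs_continuous_on 0 T (\<lambda>s. E s *v x s)"
  proof (rule abs_continuous_on_dominated[OF ac])
    fix s t assume st: "0 \<le> s" "s \<le> t" "t \<le> T"
    have "norm (E t *v x t - E s *v x s) = norm (E t *v (x t - x s) + (E t - E s) *v x s)"
      by (simp add: mv.diff_left mv.diff_right)
    also have "\<dots> \<le> norm (E t) * norm (x t - x s) * K + norm (E t - E s) * norm (x s) * K"
      by (intro order_trans[OF norm_triangle_ineq] add_mono K)
    also have "\<dots> \<le> C1 * norm (x t - x s) * K + (L * (t - s)) * C2 * K"
      by (intro add_mono mult_right_mono mult_mono C1 C2 L(2)[rule_format]) (use st L(1) K(1) C2(1) in auto)
    finally show "norm (E t *v x t - E s *v x s) \<le> (C1 * K) * norm (x t - x s) + (L * C2 * K) * (t - s)"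
      by (simp add: mult_ac)
  qed
  have dery: "((\<lambda>s. E s *v x s) has_vector_derivative E t *v (matB \<Sigma> *v u t + matG \<Sigma> *v v t)) (at t within {0..T})"
    if "t \<in> {0..T} - N" for t
    using mv.has_vector_derivative[OF Eder der[OF that]]
    by (simp add: mv.add_right mv.minus_left matrix_vector_mul_assoc algebra_simps)
  have "((\<lambda>t. E t *v (matB \<Sigma> *v u t + matG \<Sigma> *v v t)) has_integral (E T *v x T - E 0 *v x 0)) {0..T}"
    by (rule fundamental_theorem_of_calculus_abs_continuous[OF T acy N dery])
  then show ?thesis using mat_exp_0[of A] by (simp add: E_def A_def)
qed

lemma sol_eqI:
  assumes "is_solution \<Sigma> {0..t} u v x" "x 0 = x0" "0 \<le> t"
  shows "sol \<Sigma> t x0 u v = x t"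
  unfolding sol_def
proof (rule the_equality)
  fix y assume "\<exists>x. is_solution \<Sigma> {0..t} u v x \<and> x 0 = x0 \<and> x t = y"
  then obtain x' where "is_solution \<Sigma> {0..t} u v x'" "x' 0 = x0" "x' t = y" by auto
  with has_integral_unique[OF variation_of_constants[OF _ assms(3), of \<Sigma> u v x'] variation_of_constants[OF assms(1,3)]] assms(2)
  show "y = x t" by simp
qed (use assms in auto)

lemma is_solution_homogeneous:
  assumes "0 \<le> T"
  shows "is_solution \<Sigma> {0..T} (\<lambda>_. 0) (\<lambda>_. 0) (\<lambda>t. mat_exp (t *\<^sub>R matA \<Sigma>) *v z)"
  unfolding is_solution_def loc_abs_continuous_on_Icc[OF assms]
proof
  show "abs_continuous_on 0 T (\<lambda>t. mat_exp (t *\<^sub>R matA \<Sigma>) *v z)"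
    by (rule abs_continuous_on_C1[OF has_vector_derivative_mat_exp_vec]) (intro continuous_intros)
  show "ode_ae \<Sigma> {0..T} (\<lambda>_. 0) (\<lambda>_. 0) (\<lambda>t. mat_exp (t *\<^sub>R matA \<Sigma>) *v z)"
    unfolding ode_ae_def using has_vector_derivative_mat_exp_vec by (intro AE_I2) simp
qed

lemma sol_homogeneous: "0 \<le> T \<Longrightarrow> sol \<Sigma> T z (\<lambda>_. 0) (\<lambda>_. 0) = mat_exp (T *\<^sub>R matA \<Sigma>) *v z"
  by (rule sol_eqI[OF is_solution_homogeneous]) (simp_all add: mat_exp_0[of "matA \<Sigma>", simplified])

text \<open>
With \<open>w\<close> the constant forcing term, the solution is \<open>z(t) = \<integral>\<^sub>0\<^sup>t e\<^bsup>sA\<^esup> w ds\<close>; integrating the derivative of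
\<open>e\<^bsup>sA\<^esup> w\<close> shows \<open>e\<^bsup>tA\<^esup> w = A z(t) + w\<close>.
\<close>

lemma ex_solution_constant_inputs:
  assumes T: "0 \<le> T"
  shows "\<exists>z. z 0 = 0 \<and> is_solution \<Sigma> {0..T} (\<lambda>_. u0) (\<lambda>_. v0) z"
proof -
  define A where "A = matA \<Sigma>"
  define w where "w = matB \<Sigma> *v u0 + matG \<Sigma> *v v0"
  define E where "E t = mat_exp (t *\<^sub>R A) *v w" for t
  define z where "z t = integral {0..t} E" for t
  have Econt: "continuous_on S E" for S unfolding E_def[abs_def] by (intro continuous_intros)
  have zder: "(z has_vector_derivative E t) (at t within {0..T})" if "t \<in> {0..T}" for t
    unfolding z_def[abs_def] by (rule integral_has_vector_derivative[OF Econt that])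
  have E_eq: "E t = A *v z t + w" if t: "t \<in> {0..T}" for t
  proof -
    have "((\<lambda>s. A *v E s) has_integral (E t - E 0)) {0..t}"
      by (rule fundamental_theorem_of_calculus)
         (use t in \<open>auto simp: E_def[abs_def] intro: has_vector_derivative_mat_exp_vec\<close>)
    moreover have "((\<lambda>s. A *v E s) has_integral (A *v z t)) {0..t}"
      using has_integral_linear[OF integrable_integral[OF integrable_continuous_real[OF Econt]] matrix_vector_mul_bounded_linear]
      by (simp add: z_def o_def)
    ultimately have "E t - E 0 = A *v z t" by (rule has_integral_unique)
    then show ?thesis using mat_exp_0[of A] by (simp add: E_def algebra_simps)
  qed
  have "is_solution \<Sigma> {0..T} (\<lambda>_. u0) (\<lambda>_. v0) z"
    unfolding is_solution_def loc_abs_continuous_on_Icc[OF T]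
  proof
    show "abs_continuous_on 0 T z" by (rule abs_continuous_on_C1[OF zder Econt])
    show "ode_ae \<Sigma> {0..T} (\<lambda>_. u0) (\<lambda>_. v0) z"
      unfolding ode_ae_def
    proof (intro AE_I2)
      fix t assume "t \<in> space (lebesgue_on {0..T})"
      then have t: "t \<in> {0..T}" by simp
      show "(z has_vector_derivative matA \<Sigma> *v z t + matB \<Sigma> *v u0 + matG \<Sigma> *v v0) (at t within {0..T})"
        using zder[OF t] E_eq[OF t] by (simp add: A_def w_def add.assoc)
    qed
  qed
  moreover have "z 0 = 0" by (simp add: z_def)
  ultimately show ?thesis by blast
qed

lemma is_solution_diff:
  assumes x: "is_solution \<Sigma> {0..T} u v x" and y: "is_solution \<Sigma> {0..T} u' v' y" and T: "0 \<le> T"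
  shows "is_solution \<Sigma> {0..T} (\<lambda>t. u t - u' t) (\<lambda>t. v t - v' t) (\<lambda>t. x t - y t)"
  unfolding is_solution_def loc_abs_continuous_on_Icc[OF T]
proof
  show "abs_continuous_on 0 T (\<lambda>t. x t - y t)"
    using x y by (intro abs_continuous_on_diff) (auto simp: is_solution_def loc_abs_continuous_on_Icc[OF T])
  have "AE t in lebesgue_on {0..T}. (x has_vector_derivative (matA \<Sigma> *v x t + matB \<Sigma> *v u t + matG \<Sigma> *v v t)) (at t within {0..T})"
    "AE t in lebesgue_on {0..T}. (y has_vector_derivative (matA \<Sigma> *v y t + matB \<Sigma> *v u' t + matG \<Sigma> *v v' t)) (at t within {0..T})"
    using x y by (auto simp: is_solution_def ode_ae_def)
  then show "ode_ae \<Sigma> {0..T} (\<lambda>t. u t - u' t) (\<lambda>t. v t - v' t) (\<lambda>t. x t - y t)"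
    unfolding ode_ae_def
  proof eventually_elim
    case (elim t)
    from has_vector_derivative_diff[OF elim] show ?case
      by (simp add: matrix_vector_mult_diff_distrib algebra_simps)
  qed
qed

lemma is_solution_cong:
  assumes "is_solution \<Sigma> D u v x" "\<And>t. t \<in> D \<Longrightarrow> u t = u' t" "\<And>t. t \<in> D \<Longrightarrow> v t = v' t"
  shows "is_solution \<Sigma> D u' v' x"
proof -
  have "ode_ae \<Sigma> D u v x = ode_ae \<Sigma> D u' v' x"
    unfolding ode_ae_def by (rule AE_cong) (use assms(2,3) in auto)
  then show ?thesis using assms(1) by (simp add: is_solution_def)
qed

section \<open>Convexity of the range of a vector measure\<close>

lemma linear_dependence_family:
  fixes v :: "'j \<Rightarrow> 'b::euclidean_space"
  assumes F: "finite F" and card: "card F > DIM('b)"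
  obtains c where "\<exists>j\<in>F. c j \<noteq> (0::real)" "(\<Sum>j\<in>F. c j *\<^sub>R v j) = 0"
proof (cases "inj_on v F")
  case True
  then have "dependent (v ` F)" using F card by (intro dependent_biggerset) (auto simp: card_image)
  then obtain u where "\<exists>y\<in>v ` F. u y \<noteq> 0" "(\<Sum>y\<in>v ` F. u y *\<^sub>R y) = 0"
    using F by (auto simp: dependent_finite)
  then show ?thesis using True by (intro that[of "u \<circ> v"]) (auto simp: sum.reindex)
next
  case False
  then obtain i j where ij: "i \<in> F" "j \<in> F" "i \<noteq> j" "v i = v j" by (auto simp: inj_on_def)
  define c where "c k = (if k = i then 1 else if k = j then - 1 else 0 :: real)" for k
  have "(\<Sum>k\<in>F. c k *\<^sub>R v k) = (\<Sum>k\<in>{i, j}. c k *\<^sub>R v k)"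
    by (rule sum.mono_neutral_right) (use F ij in \<open>auto simp: c_def\<close>)
  also have "\<dots> = 0" using ij by (simp add: c_def)
  finally show ?thesis using ij by (intro that[of c]) (auto simp: c_def)
qed

text \<open>
As long as more than \<open>DIM('b)\<close> weights lie strictly between 0 and 1, their vectors are linearly dependent. Moving the
weights along a dependence keeps the weighted sum; it is continued until the first weight reaches 0 or 1.
\<close>

lemma round_weights:
  fixes v :: "'j \<Rightarrow> 'b::euclidean_space" and w :: "'j \<Rightarrow> real"
  assumes J: "finite J" and w: "\<forall>j\<in>J. 0 \<le> w j \<and> w j \<le> 1"
  shows "\<exists>w'. (\<forall>j\<in>J. 0 \<le> w' j \<and> w' j \<le> 1) \<and> (\<forall>j\<in>J. w j \<in> {0, 1} \<longrightarrow> w' j = w j)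
    \<and> (\<Sum>j\<in>J. w' j *\<^sub>R v j) = (\<Sum>j\<in>J. w j *\<^sub>R v j) \<and> card {j\<in>J. w' j \<notin> {0, 1}} \<le> DIM('b)"
  using w
proof (induction "card {j\<in>J. w j \<notin> {0, 1}}" arbitrary: w rule: less_induct)
  case less
  define F where "F = {j\<in>J. w j \<notin> {0, 1}}"
  have Fin: "finite F" "F \<subseteq> J" using J by (auto simp: F_def)
  show ?case
  proof (cases "card F \<le> DIM('b)")
    case True
    then show ?thesis using less.prems unfolding F_def by (intro exI[of _ w]) auto
  next
    case False
    obtain c where c: "\<exists>j\<in>F. c j \<noteq> (0::real)" "(\<Sum>j\<in>F. c j *\<^sub>R v j) = 0"
      by (rule linear_dependence_family[OF Fin(1), where v = v]) (use False in auto)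
    define G where "G = {j\<in>F. c j \<noteq> 0}"
    \<comment> \<open>the time at which coordinate \<open>j\<close> leaves \<open>[0,1]\<close> when moving in direction \<open>c\<close>\<close>
    define r where "r j = (if c j > 0 then (1 - w j) / c j else w j / (- c j))" for j
    define t where "t = Min (r ` G)"
    have G: "finite G" "G \<noteq> {}" using c Fin by (auto simp: G_def)
    have wF: "0 < w j" "w j < 1" if "j \<in> F" for j
      using that less.prems by (force simp: F_def less_le)+
    obtain j0 where j0: "j0 \<in> G" "t = r j0"
    proof -
      have "Min (r ` G) \<in> r ` G" using G by (intro Min_in) auto
      then show ?thesis using that by (auto simp: t_def)
    qed
    have t_le: "t \<le> r j" if "j \<in> G" for j using G that by (simp add: t_def)
    have t0: "t \<ge> 0"
      using j0 wF[of j0] by (auto simp: r_def G_def divide_le_0_iff not_less)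
    define w2 where "w2 j = (if j \<in> F then w j + t * c j else w j)" for j
    have w2: "0 \<le> w2 j \<and> w2 j \<le> 1" if "j \<in> J" for j
    proof (cases "j \<in> G")
      case True
      then have "j \<in> F" "c j \<noteq> 0" by (auto simp: G_def)
      show ?thesis
      proof (cases "c j > 0")
        case pos: True
        then have "t * c j \<le> 1 - w j" using t_le[OF True] by (simp add: r_def pos_le_divide_eq)
        then show ?thesis using pos t0 wF[OF \<open>j \<in> F\<close>] \<open>j \<in> F\<close> by (simp add: w2_def)
      next
        case neg: False
        then have "c j < 0" using \<open>c j \<noteq> 0\<close> by simp
        have "t \<le> w j / (- c j)" using t_le[OF True] unfolding r_def by (simp only: neg if_False)
        then have "t * (- c j) \<le> w j" using \<open>c j < 0\<close> by (subst (asm) pos_le_divide_eq) auto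
        moreover have "t * c j \<le> 0" using t0 \<open>c j < 0\<close> by (simp add: mult_le_0_iff)
        ultimately show ?thesis using wF[OF \<open>j \<in> F\<close>] \<open>j \<in> F\<close> by (simp add: w2_def)
      qed
    next
      case False
      then show ?thesis using less.prems that by (auto simp: w2_def G_def)
    qed
    have "w2 j0 \<in> {0, 1}"
      using j0 by (auto simp: w2_def G_def r_def)
    then have "{j\<in>J. w2 j \<notin> {0, 1}} \<subset> F"
      using j0 by (auto simp: F_def G_def w2_def)
    then have lt: "card {j\<in>J. w2 j \<notin> {0, 1}} < card {j\<in>J. w j \<notin> {0, 1}}"
      using psubset_card_mono Fin(1) unfolding F_def by blast
    have "(\<Sum>j\<in>J. w2 j *\<^sub>R v j) = (\<Sum>j\<in>J. w j *\<^sub>R v j + (if j \<in> F then (t * c j) *\<^sub>R v j else 0))"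
      by (intro sum.cong) (auto simp: w2_def scaleR_add_left)
    also have "\<dots> = (\<Sum>j\<in>J. w j *\<^sub>R v j) + t *\<^sub>R (\<Sum>j\<in>F. c j *\<^sub>R v j)"
      using J Fin(2) by (simp add: sum.distrib sum.If_cases Int_absorb1 scaleR_sum_right)
    finally have sum2: "(\<Sum>j\<in>J. w2 j *\<^sub>R v j) = (\<Sum>j\<in>J. w j *\<^sub>R v j)" using c(2) by simp
    have "\<forall>j\<in>J. 0 \<le> w2 j \<and> w2 j \<le> 1" using w2 by blast
    from less.hyps[OF lt this] obtain w' where w': "\<forall>j\<in>J. 0 \<le> w' j \<and> w' j \<le> 1"
      "\<forall>j\<in>J. w2 j \<in> {0, 1} \<longrightarrow> w' j = w2 j" "(\<Sum>j\<in>J. w' j *\<^sub>R v j) = (\<Sum>j\<in>J. w2 j *\<^sub>R v j)"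
      "card {j\<in>J. w' j \<notin> {0, 1}} \<le> DIM('b)" by blast
    have "\<forall>j\<in>J. w j \<in> {0, 1} \<longrightarrow> w' j = w j"
    proof (intro ballI impI)
      fix j assume "j \<in> J" "w j \<in> {0, 1}"
      then have "w2 j = w j" by (auto simp: w2_def F_def)
      then show "w' j = w j" using w'(2) \<open>j \<in> J\<close> \<open>w j \<in> {0, 1}\<close> by auto
    qed
    then show ?thesis using w' sum2 by (intro exI[of _ w']) simp
  qed
qed

lemma integral_of_cell_weights:
  fixes g :: "real \<Rightarrow> 'b::euclidean_space" and W :: "'j \<Rightarrow> real"
  assumes c: "simple_function M c" and g: "integrable M g"
  shows "(\<integral>x. W (c x) *\<^sub>R g x \<partial>M)
    = (\<Sum>j\<in>c ` space M. W j *\<^sub>R (\<integral>x. indicator (c -` {j} \<inter> space M) x *\<^sub>R g x \<partial>M))"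
proof -
  have fin: "finite (c ` space M)" and sets: "\<And>j. j \<in> c ` space M \<Longrightarrow> c -` {j} \<inter> space M \<in> sets M"
    using c by (auto simp: simple_function_def)
  have "(\<integral>x. W (c x) *\<^sub>R g x \<partial>M)
      = (\<integral>x. (\<Sum>j\<in>c ` space M. W j *\<^sub>R (indicator (c -` {j} \<inter> space M) x *\<^sub>R g x)) \<partial>M)"
  proof (rule Bochner_Integration.integral_cong[OF refl])
    fix x assume x: "x \<in> space M"
    have "(\<Sum>j\<in>c ` space M. W j *\<^sub>R (indicator (c -` {j} \<inter> space M) x *\<^sub>R g x))
        = (\<Sum>j\<in>c ` space M. if j = c x then W (c x) *\<^sub>R g x else 0)"
      by (rule sum.cong) (use x in \<open>auto simp: indicator_def\<close>)
    also have "\<dots> = W (c x) *\<^sub>R g x" using fin x by simp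
    finally show "W (c x) *\<^sub>R g x = (\<Sum>j\<in>c ` space M. W j *\<^sub>R (indicator (c -` {j} \<inter> space M) x *\<^sub>R g x))" by simp
  qed
  also have "\<dots> = (\<Sum>j\<in>c ` space M. \<integral>x. W j *\<^sub>R (indicator (c -` {j} \<inter> space M) x *\<^sub>R g x) \<partial>M)"
    by (intro Bochner_Integration.integral_sum integrable_scaleR_right integrable_mult_indicator[OF _ g] sets)
  also have "\<dots> = (\<Sum>j\<in>c ` space M. W j *\<^sub>R (\<integral>x. indicator (c -` {j} \<inter> space M) x *\<^sub>R g x \<partial>M))"
    by (intro sum.cong refl integral_scaleR_right integrable_mult_indicator[OF _ g] sets)
  finally show ?thesis .
qed

lemma floor_quotient_eq_iff:
  fixes x a h :: real
  assumes "h > 0"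
  shows "\<lfloor>(x - a) / h\<rfloor> = i \<longleftrightarrow> a + of_int i * h \<le> x \<and> x < a + (of_int i + 1) * h"
proof -
  have "\<lfloor>(x - a) / h\<rfloor> = i \<longleftrightarrow> of_int i \<le> (x - a) / h \<and> (x - a) / h < of_int i + 1"
    by (rule floor_eq_iff)
  then show ?thesis using assms by (simp add: pos_le_divide_eq pos_divide_less_eq le_diff_eq less_diff_eq diff_less_eq add.commute)
qed

lemma simple_function_floor_Icc:
  assumes "h > 0"
  shows "simple_function (lebesgue_on {a..b::real}) (\<lambda>x. \<lfloor>(x - a) / h\<rfloor>)"
  unfolding simple_function_def
proof (intro conjI ballI)
  have "(\<lambda>x. \<lfloor>(x - a) / h\<rfloor>) ` {a..b} \<subseteq> {0..\<lfloor>(b - a) / h\<rfloor>}"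
    using assms by (auto intro!: floor_mono divide_right_mono)
  then show "finite ((\<lambda>x. \<lfloor>(x - a) / h\<rfloor>) ` space (lebesgue_on {a..b}))"
    by (auto intro: finite_subset)
  fix i
  have "(\<lambda>x. \<lfloor>(x - a) / h\<rfloor>) -` {i} = {a + of_int i * h ..< a + (of_int i + 1) * h}"
    by (rule set_eqI) (use floor_quotient_eq_iff[OF assms] in \<open>simp\<close>)
  then show "(\<lambda>x. \<lfloor>(x - a) / h\<rfloor>) -` {i} \<inter> space (lebesgue_on {a..b}) \<in> sets (lebesgue_on {a..b})"
    by (auto simp: sets_restrict_space intro!: image_eqI[of _ _ "{a + of_int i * h ..< a + (of_int i + 1) * h}"])
qed

text \<open>
The level sets of \<open>w\<close> are cut by a mesh of width \<open>h\<close> and the weights of the resulting cells are rounded. At most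
\<open>DIM('b)\<close> cells keep a fractional weight, so the measure of the set where the new function is fractional tends to 0 with
\<open>h\<close>, whatever the number of cells.
\<close>

lemma round_weight_function:
  fixes g :: "real \<Rightarrow> 'b::euclidean_space" and a b :: real
  defines "M \<equiv> lebesgue_on {a..b}"
  assumes g: "integrable M g" and w: "simple_function M w" "\<forall>x\<in>space M. 0 \<le> w x \<and> w x \<le> 1"
    and e: "(e::real) > 0"
  shows "\<exists>w'. simple_function M w' \<and> (\<forall>x\<in>space M. 0 \<le> w' x \<and> w' x \<le> 1) \<and>
    (\<forall>x\<in>space M. w x \<in> {0, 1} \<longrightarrow> w' x = w x) \<and>
    (\<integral>x. w' x *\<^sub>R g x \<partial>M) = (\<integral>x. w x *\<^sub>R g x \<partial>M) \<and>
    measure M {x\<in>space M. w' x \<notin> {0, 1}} \<le> e"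
proof -
  define h where "h = e / DIM('b)"
  have h: "h > 0" using e by (simp add: h_def)
  \<comment> \<open>a cell is a level set of \<open>w\<close> intersected with an interval of length \<open>h\<close>\<close>
  define c where "c x = (w x, \<lfloor>(x - a) / h\<rfloor>)" for x
  have c: "simple_function M c"
    unfolding c_def[abs_def] M_def using w(1) simple_function_floor_Icc[OF h]
    by (intro simple_function_Pair) (auto simp: M_def)
  have fin: "finite (c ` space M)" and sets: "\<And>j. j \<in> c ` space M \<Longrightarrow> c -` {j} \<inter> space M \<in> sets M"
    using c by (auto simp: simple_function_def)
  define v where "v j = (\<integral>x. indicator (c -` {j} \<inter> space M) x *\<^sub>R g x \<partial>M)" for j
  have "\<forall>j\<in>c ` space M. 0 \<le> fst j \<and> fst j \<le> 1" using w(2) by (auto simp: c_def)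
  from round_weights[OF fin this, of v] obtain W where W: "\<forall>j\<in>c ` space M. 0 \<le> W j \<and> W j \<le> 1"
    "\<forall>j\<in>c ` space M. fst j \<in> {0, 1} \<longrightarrow> W j = fst j"
    "(\<Sum>j\<in>c ` space M. W j *\<^sub>R v j) = (\<Sum>j\<in>c ` space M. fst j *\<^sub>R v j)"
    "card {j\<in>c ` space M. W j \<notin> {0, 1}} \<le> DIM('b)" by blast
  define F where "F = {j\<in>c ` space M. W j \<notin> {0, 1}}"
  have "(\<integral>x. W (c x) *\<^sub>R g x \<partial>M) = (\<Sum>j\<in>c ` space M. W j *\<^sub>R v j)"
    unfolding v_def by (rule integral_of_cell_weights[OF c g])
  also have "\<dots> = (\<integral>x. fst (c x) *\<^sub>R g x \<partial>M)"
    unfolding W(3) unfolding v_def by (rule integral_of_cell_weights[OF c g, symmetric])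
  finally have int: "(\<integral>x. W (c x) *\<^sub>R g x \<partial>M) = (\<integral>x. w x *\<^sub>R g x \<partial>M)" by (simp add: c_def)
  have cell: "measure M (c -` {j} \<inter> space M) \<le> h" if "j \<in> c ` space M" for j
  proof -
    obtain y i where j: "j = (y, i)" by (cases j)
    have sub: "c -` {j} \<inter> space M \<subseteq> {a + of_int i * h .. a + (of_int i + 1) * h}"
      using floor_quotient_eq_iff[OF h] by (auto simp: j c_def)
    have S: "c -` {j} \<inter> space M \<in> sets lebesgue" "c -` {j} \<inter> space M \<subseteq> {a..b}"
      using sets[OF that] sets.Int[of "{a..b}" lebesgue] by (auto simp: M_def sets_restrict_space)
    have "measure M (c -` {j} \<inter> space M) = measure lebesgue (c -` {j} \<inter> space M)"
      unfolding M_def using S(2) by (subst measure_restrict_space) (auto simp: M_def)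
    also have "\<dots> \<le> measure lebesgue {a + of_int i * h .. a + (of_int i + 1) * h}"
      by (rule measure_mono_fmeasurable[OF sub S(1)]) simp
    also have "\<dots> = h" using h by (simp add: algebra_simps)
    finally show ?thesis .
  qed
  have "{x\<in>space M. W (c x) \<notin> {0, 1}} = (\<Union>j\<in>F. c -` {j} \<inter> space M)" by (auto simp: F_def)
  also have "measure M \<dots> \<le> (\<Sum>j\<in>F. measure M (c -` {j} \<inter> space M))"
    using fin sets by (intro measure_UNION_le) (auto simp: F_def)
  also have "\<dots> \<le> (\<Sum>j\<in>F. h)" using cell by (intro sum_mono) (auto simp: F_def)
  also have "\<dots> \<le> DIM('b) * h" using W(4) h by (simp add: F_def)
  also have "\<dots> = e" by (simp add: h_def)
  finally have small: "measure M {x\<in>space M. W (c x) \<notin> {0, 1}} \<le> e" .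
  have "simple_function M (\<lambda>x. W (c x))" using simple_function_compose[OF c, of W] by (simp add: o_def)
  moreover have "\<forall>x\<in>space M. w x \<in> {0, 1} \<longrightarrow> W (c x) = w x" using W(2) by (auto simp: c_def)
  moreover have "\<forall>x\<in>space M. 0 \<le> W (c x) \<and> W (c x) \<le> 1" using W(1) by auto
  ultimately show ?thesis using int small by (intro exI[of _ "\<lambda>x. W (c x)"]) blast
qed

text \<open>
The constant weight \<open>\<theta>\<close> has the right integral but is not an indicator function. Rounding it repeatedly, with the set
of fractional values shrinking to a null set and values 0 and 1 never changed again, yields a sequence that converges
almost everywhere to an indicator function; dominated convergence preserves the integral.
\<close>

theorem Lyapunov_convexity:
  fixes g :: "real \<Rightarrow> 'b::euclidean_space" and a b :: real
  defines "M \<equiv> lebesgue_on {a..b}"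
  assumes g: "integrable M g" and \<theta>: "0 \<le> \<theta>" "\<theta> \<le> 1"
  shows "\<exists>E\<in>sets M. (\<integral>x. indicator E x *\<^sub>R g x \<partial>M) = \<theta> *\<^sub>R (\<integral>x. g x \<partial>M)"
proof -
  define P where "P w \<longleftrightarrow> simple_function M w \<and> (\<forall>x\<in>space M. 0 \<le> w x \<and> w x \<le> (1::real))" for w
  define Q where "Q n w w' \<longleftrightarrow> (\<forall>x\<in>space M. w x \<in> {0, 1} \<longrightarrow> w' x = w x) \<and>
    (\<integral>x. w' x *\<^sub>R g x \<partial>M) = (\<integral>x. w x *\<^sub>R g x \<partial>M) \<and>
    measure M {x\<in>space M. w' x \<notin> {0, 1}} \<le> (1/2) ^ n" for n :: nat and w w' :: "real \<Rightarrow> real"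
  have "\<exists>s. s 0 = (\<lambda>_. \<theta>) \<and> (\<forall>n. P (s n) \<and> Q n (s n) (s (Suc n)))"
  proof -
    have step: "\<exists>w'. P w' \<and> Q n w w'" if "P w" for n w
      using round_weight_function[of a b g w "(1/2) ^ n"] g that unfolding P_def Q_def M_def by auto
    have P0: "P (\<lambda>_. \<theta>)" using \<theta> by (simp add: P_def)
    have "\<exists>s. \<forall>n. (P (s n) \<and> (n = 0 \<longrightarrow> s n = (\<lambda>_. \<theta>))) \<and> Q n (s n) (s (Suc n))"
      by (rule dependent_nat_choice) (use step P0 in auto)
    then show ?thesis by metis
  qed
  then obtain s where s0: "s 0 = (\<lambda>_. \<theta>)" and P: "\<And>n. P (s n)" and Q: "\<And>n. Q n (s n) (s (Suc n))" by blast
  have keep: "s (n + k) x = s n x" if "x \<in> space M" "s n x \<in> {0, 1}" for n k x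
    using Q that by (induction k) (auto simp: Q_def)
  have int: "(\<integral>x. s n x *\<^sub>R g x \<partial>M) = \<theta> *\<^sub>R (\<integral>x. g x \<partial>M)" for n
    using Q s0 by (induction n) (auto simp: Q_def)
  have meas: "s n \<in> borel_measurable M" for n
    using P by (auto simp: P_def intro: borel_measurable_simple_function)
  define E where "E = {x\<in>space M. \<exists>n. s n x = 1}"
  define Z where "Z = {x\<in>space M. \<forall>n. s n x \<notin> {0, 1}}"
  have [measurable]: "E \<in> sets M" "Z \<in> sets M" unfolding E_def Z_def using meas by measurable
  interpret finite_measure M unfolding M_def by (rule finite_measure_lebesgue_on) simp
  have "measure M Z \<le> (1/2) ^ n" for n
  proof -
    have "measure M Z \<le> measure M {x\<in>space M. s (Suc n) x \<notin> {0, 1}}"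
      using meas by (intro finite_measure_mono) (auto simp: Z_def)
    then show ?thesis using Q[of n] by (auto simp: Q_def)
  qed
  then have "measure M Z \<le> 0"
    by (intro LIMSEQ_le_const[OF LIMSEQ_realpow_zero[of "1/2::real"]]) auto
  then have Z0: "Z \<in> null_sets M" by (auto simp: null_sets_def emeasure_eq_measure measure_le_0_iff)
  have lim: "(\<lambda>n. s n x *\<^sub>R g x) \<longlonglongrightarrow> indicator E x *\<^sub>R g x" if x: "x \<in> space M" "x \<notin> Z" for x
  proof -
    obtain n where n: "s n x \<in> {0, 1}" using x by (auto simp: Z_def)
    have val: "s n x = indicator E x"
    proof (cases "x \<in> E")
      case True
      then obtain m where m: "s m x = 1" by (auto simp: E_def)
      have "s (n + m) x = s n x" "s (m + n) x = s m x" using keep[OF x(1)] n m by auto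
      then show ?thesis using True m by (simp add: add.commute)
    next
      case False
      then have "s n x \<noteq> 1" using x by (auto simp: E_def)
      then show ?thesis using n False by auto
    qed
    have "eventually (\<lambda>k. s k x = indicator E x) sequentially"
      using eventually_ge_at_top[of n] 
    proof eventually_elim
      case (elim k)
      then show ?case using keep[OF x(1) n, of "k - n"] val by simp
    qed
    then have "(\<lambda>k. s k x) \<longlonglongrightarrow> indicator E x" by (rule tendsto_eventually)
    then show ?thesis by (intro tendsto_intros)
  qed
  have "(\<lambda>n. \<integral>x. s n x *\<^sub>R g x \<partial>M) \<longlonglongrightarrow> (\<integral>x. indicator E x *\<^sub>R g x \<partial>M)"
  proof (rule integral_dominated_convergence[where w = "\<lambda>x. norm (g x)"])
    show "integrable M (\<lambda>x. norm (g x))" using g by simp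
    show "AE x in M. (\<lambda>n. s n x *\<^sub>R g x) \<longlonglongrightarrow> indicator E x *\<^sub>R g x"
      by (rule AE_I'[OF Z0]) (use lim in auto)
    show "AE x in M. norm (s n x *\<^sub>R g x) \<le> norm (g x)" for n
      using P[of n] by (intro AE_I2) (auto simp: P_def abs_mult intro!: mult_left_le_one_le)
  qed (use g meas in \<open>auto intro!: borel_measurable_scaleR borel_measurable_indicator\<close>)
  then have "(\<integral>x. indicator E x *\<^sub>R g x \<partial>M) = \<theta> *\<^sub>R (\<integral>x. g x \<partial>M)"
    unfolding int by (simp add: LIMSEQ_const_iff)
  then show ?thesis using \<open>E \<in> sets M\<close> by blast
qed

section \<open>Compactness of the set of integrals of selections\<close>

text \<open>
A quantitative form of extremality: on the compact set of pairs with \<open>x\<close> away from \<open>e\<close> the distance of the midpoint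
from \<open>e\<close> has a minimum, and the minimum is not 0, since \<open>e\<close> is not inside a segment.
\<close>

lemma midpoints_near_extreme_point:
  fixes K :: "'c::euclidean_space set"
  assumes K: "compact K" and e: "e extreme_point_of K" and d: "d > 0"
  obtains r where "r > 0" "\<forall>x\<in>K. \<forall>y\<in>K. norm (midpoint x y - e) < r \<longrightarrow> norm (x - e) < d"
proof -
  define S where "S = {p\<in>K \<times> K. d \<le> norm (fst p - e)}"
  have "closed {p :: 'c \<times> 'c. d \<le> norm (fst p - e)}"
    by (intro closed_Collect_le continuous_intros)
  then have "compact S" unfolding S_def
    using compact_Int_closed[OF compact_Times[OF K K]] by (simp add: Collect_conj_eq)
  have ncont: "continuous_on S (\<lambda>p. norm (midpoint (fst p) (snd p) - e))"
    unfolding midpoint_def by (intro continuous_intros)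
  show ?thesis
  proof (cases "S = {}")
    case True
    have "\<forall>x\<in>K. \<forall>y\<in>K. norm (midpoint x y - e) < 1 \<longrightarrow> norm (x - e) < d"
    proof (intro ballI impI)
      fix x y assume "x \<in> K" "y \<in> K"
      then have "(x, y) \<notin> S" using True by simp
      then show "norm (x - e) < d" using \<open>x \<in> K\<close> \<open>y \<in> K\<close> by (simp add: S_def)
    qed
    then show ?thesis by (intro that[of 1]) auto
  next
    case False
    obtain p where p: "p \<in> S" "\<And>q. q \<in> S \<Longrightarrow> norm (midpoint (fst p) (snd p) - e) \<le> norm (midpoint (fst q) (snd q) - e)"
      using continuous_attains_inf[OF \<open>compact S\<close> False ncont] by blast
    let ?r = "norm (midpoint (fst p) (snd p) - e)"
    have pK: "fst p \<in> K" "snd p \<in> K" "fst p \<noteq> e" using p(1) d by (auto simp: S_def)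
    have "midpoint (fst p) (snd p) \<noteq> e"
    proof
      assume m: "midpoint (fst p) (snd p) = e"
      then have "fst p \<noteq> snd p" using pK(3) by auto
      then have "e \<in> open_segment (fst p) (snd p)" using m midpoint_in_open_segment by blast
      then show False using e pK by (auto simp: extreme_point_of_def)
    qed
    then have "?r > 0" by simp
    moreover have "\<forall>x\<in>K. \<forall>y\<in>K. norm (midpoint x y - e) < ?r \<longrightarrow> norm (x - e) < d"
    proof (intro ballI impI, rule ccontr)
      fix x y assume "x \<in> K" "y \<in> K" "norm (midpoint x y - e) < ?r" "\<not> norm (x - e) < d"
      moreover from this have "(x, y) \<in> S" by (simp add: S_def)
      ultimately show False using p(2)[of "(x, y)"] by simp
    qed
    ultimately show ?thesis by (rule that)
  qed
qed

text \<open>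
The \<open>L\<^sup>1\<close> norm of a coordinate is its integral over the set where it is nonnegative minus its integral over the set
where it is negative.
\<close>

lemma L1_norm_le_of_set_integrals:
  fixes h :: "'x \<Rightarrow> 'c::euclidean_space" and d :: real
  assumes h: "integrable M h" and d: "\<And>E. E \<in> sets M \<Longrightarrow> norm (\<integral>x. indicator E x *\<^sub>R h x \<partial>M) \<le> (d::real)"
  shows "(\<integral>x. norm (h x) \<partial>M) \<le> 2 * DIM('c) * d"
proof -
  have comp: "(\<integral>x. \<bar>h x \<bullet> i\<bar> \<partial>M) \<le> 2 * d" if i: "i \<in> Basis" for i
  proof -
    have hi: "integrable M (\<lambda>x. h x \<bullet> i)" using h by (rule integrable_inner_left)
    have part: "\<bar>\<integral>x. indicator E x * (h x \<bullet> i) \<partial>M\<bar> \<le> d" if E: "E \<in> sets M" for E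
    proof -
      have "(\<integral>x. indicator E x * (h x \<bullet> i) \<partial>M) = (\<integral>x. (indicator E x *\<^sub>R h x) \<bullet> i \<partial>M)" by simp
      also have "\<dots> = (\<integral>x. indicator E x *\<^sub>R h x \<partial>M) \<bullet> i"
        using integrable_mult_indicator[OF E h] by (subst integral_inner_left) auto
      finally show ?thesis using Basis_le_norm[OF i] d[OF E] by (metis order_trans)
    qed
    define P where "P = {x\<in>space M. h x \<bullet> i \<ge> 0}"
    define N where "N = {x\<in>space M. h x \<bullet> i < 0}"
    have P: "P \<in> sets M" "N \<in> sets M" unfolding P_def N_def using hi by measurable
    have int: "integrable M (\<lambda>x. indicator E x * (h x \<bullet> i))" if "E \<in> sets M" for E
      using integrable_mult_indicator[OF that hi] by simp
    have "(\<integral>x. \<bar>h x \<bullet> i\<bar> \<partial>M) = (\<integral>x. indicator P x * (h x \<bullet> i) - indicator N x * (h x \<bullet> i) \<partial>M)"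
      by (rule Bochner_Integration.integral_cong[OF refl]) (auto simp: P_def N_def indicator_def)
    also have "\<dots> = (\<integral>x. indicator P x * (h x \<bullet> i) \<partial>M) - (\<integral>x. indicator N x * (h x \<bullet> i) \<partial>M)"
      by (rule Bochner_Integration.integral_diff[OF int[OF P(1)] int[OF P(2)]])
    also have "\<dots> \<le> 2 * d" using part[OF P(1)] part[OF P(2)] by linarith
    finally show ?thesis .
  qed
  have "(\<integral>x. norm (h x) \<partial>M) \<le> (\<integral>x. (\<Sum>i\<in>Basis. \<bar>h x \<bullet> i\<bar>) \<partial>M)"
    using h by (intro integral_mono) (auto intro!: Bochner_Integration.integrable_sum integrable_abs integrable_inner_left norm_le_l1)
  also have "\<dots> = (\<Sum>i\<in>Basis. \<integral>x. \<bar>h x \<bullet> i\<bar> \<partial>M)"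
    using h by (intro Bochner_Integration.integral_sum) (auto intro!: integrable_abs integrable_inner_left)
  also have "\<dots> \<le> (\<Sum>i\<in>(Basis::'c set). 2 * d)" by (intro sum_mono comp)
  finally show ?thesis by simp
qed

definition selections :: "real \<Rightarrow> real \<Rightarrow> 'a::euclidean_space set \<Rightarrow> (real \<Rightarrow> 'a) set" where
  "selections a b U = {u \<in> borel_measurable (lebesgue_on {a..b}). \<forall>s\<in>{a..b}. u s \<in> U}"

text \<open>
The selection itself is a component of the integrand, so that convergence of the integrands entails convergence of the
selections.
\<close>

definition graph_integral ::
  "(real \<Rightarrow> 'a::euclidean_space \<Rightarrow> 'b::euclidean_space) \<Rightarrow> real \<Rightarrow> real \<Rightarrow> (real \<Rightarrow> 'a) \<Rightarrow> 'a \<times> 'b" where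
  "graph_integral F a b u = (\<integral>s. (u s, F s (u s)) \<partial>lebesgue_on {a..b})"

context
  fixes F :: "real \<Rightarrow> 'a::euclidean_space \<Rightarrow> 'b::euclidean_space" and a b :: real and U :: "'a set"
  assumes U: "compact U" and F: "continuous_on ({a..b} \<times> U) (\<lambda>(s, u). F s u)"
begin

lemma graph_bounded:
  obtains C where "C > 0" "\<forall>s\<in>{a..b}. \<forall>y\<in>U. norm (y, F s y) \<le> C"
proof -
  have "continuous_on ({a..b} \<times> U) (\<lambda>p. (snd p, F (fst p) (snd p)))"
    using F by (auto intro!: continuous_intros simp: split_def)
  then have "bounded ((\<lambda>p. (snd p, F (fst p) (snd p))) ` ({a..b} \<times> U))"
    by (intro compact_imp_bounded compact_continuous_image compact_Times compact_Icc U)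
  then show ?thesis using that unfolding bounded_pos by fastforce
qed

lemma integrable_graph:
  assumes u: "u \<in> selections a b U"
  shows "integrable (lebesgue_on {a..b}) (\<lambda>s. (u s, F s (u s)))"
proof -
  let ?M = "lebesgue_on {a..b}"
  interpret finite_measure ?M by (rule finite_measure_lebesgue_on) simp
  have um: "u \<in> borel_measurable ?M" "\<And>s. s \<in> {a..b} \<Longrightarrow> u s \<in> U" using u by (auto simp: selections_def)
  have "(\<lambda>s. (s, u s)) \<in> borel_measurable ?M"
    by (intro borel_measurable_Pair um measurable_restrict_space1 measurable_completion) simp
  then have m1: "(\<lambda>s. (s, u s)) \<in> measurable ?M (restrict_space borel ({a..b} \<times> U))"
    by (rule measurable_restrict_space2[rotated]) (use um in auto)
  have m2: "(\<lambda>(s, u). F s u) \<in> borel_measurable (restrict_space borel ({a..b} \<times> U))"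
    by (rule borel_measurable_continuous_on_restrict[OF F])
  have "(\<lambda>s. F s (u s)) \<in> borel_measurable ?M"
    using measurable_compose[OF m1 m2] by simp
  then have m: "(\<lambda>s. (u s, F s (u s))) \<in> borel_measurable ?M"
    by (intro borel_measurable_Pair um)
  obtain C where "C > 0" "\<forall>s\<in>{a..b}. \<forall>y\<in>U. norm (y, F s y) \<le> C" by (rule graph_bounded)
  then show ?thesis using um(2) by (intro integrable_const_bound[of _ C] AE_I2 m) auto
qed

lemma switch_selections:
  assumes "u \<in> selections a b U" "v \<in> selections a b U" "E \<in> sets (lebesgue_on {a..b})"
  shows "(\<lambda>s. if s \<in> E then u s else v s) \<in> selections a b U"
  using assms unfolding selections_def by (auto intro!: measurable_If_set simp: sets.sets_into_space)

lemma graph_integral_switch: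
  assumes u: "u \<in> selections a b U" and v: "v \<in> selections a b U" and E: "E \<in> sets (lebesgue_on {a..b})"
  shows "graph_integral F a b (\<lambda>s. if s \<in> E then u s else v s)
    = graph_integral F a b v + (\<integral>s. indicator E s *\<^sub>R ((u s, F s (u s)) - (v s, F s (v s))) \<partial>lebesgue_on {a..b})"
proof -
  have "graph_integral F a b (\<lambda>s. if s \<in> E then u s else v s)
      = (\<integral>s. (v s, F s (v s)) + indicator E s *\<^sub>R ((u s, F s (u s)) - (v s, F s (v s))) \<partial>lebesgue_on {a..b})"
    unfolding graph_integral_def by (rule Bochner_Integration.integral_cong) auto
  then show ?thesis unfolding graph_integral_def
    by (simp add: Bochner_Integration.integral_add[OF integrable_graph[OF v]
        integrable_mult_indicator[OF E Bochner_Integration.integrable_diff[OF integrable_graph[OF u] integrable_graph[OF v]]]]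
        del: diff_Pair)
qed

text \<open>
A convex combination of the integrals of \<open>u\<close> and \<open>v\<close> is the integral of the selection that follows \<open>v\<close> on a suitable
measurable set and \<open>u\<close> elsewhere.
\<close>

lemma convex_graph_integrals: "convex (graph_integral F a b ` selections a b U)"
  unfolding convex_alt
proof (intro ballI allI impI)
  fix x y t assume "x \<in> graph_integral F a b ` selections a b U" "y \<in> graph_integral F a b ` selections a b U"
    and t: "0 \<le> t \<and> (t::real) \<le> 1"
  then obtain u v where u: "u \<in> selections a b U" "x = graph_integral F a b u"
    and v: "v \<in> selections a b U" "y = graph_integral F a b v" by auto
  let ?h = "\<lambda>s. (v s, F s (v s)) - (u s, F s (u s))"
  have h: "integrable (lebesgue_on {a..b}) ?h"
    by (rule Bochner_Integration.integrable_diff[OF integrable_graph[OF v(1)] integrable_graph[OF u(1)]])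
  obtain E where E: "E \<in> sets (lebesgue_on {a..b})"
    "(\<integral>s. indicator E s *\<^sub>R ?h s \<partial>lebesgue_on {a..b}) = t *\<^sub>R (\<integral>s. ?h s \<partial>lebesgue_on {a..b})"
    using Lyapunov_convexity[OF h, of t] t by auto
  have hxy: "(\<integral>s. ?h s \<partial>lebesgue_on {a..b}) = y - x"
    unfolding u(2) v(2) graph_integral_def
    by (rule Bochner_Integration.integral_diff[OF integrable_graph[OF v(1)] integrable_graph[OF u(1)]])
  have eq: "graph_integral F a b (\<lambda>s. if s \<in> E then v s else u s) = (1 - t) *\<^sub>R x + t *\<^sub>R y"
    unfolding graph_integral_switch[OF v(1) u(1) E(1)] E(2) hxy u(2)[symmetric] by (simp add: algebra_simps)
  show "(1 - t) *\<^sub>R x + t *\<^sub>R y \<in> graph_integral F a b ` selections a b U"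
    unfolding eq[symmetric] by (rule imageI[OF switch_selections[OF v(1) u(1) E(1)]])
qed

lemma bounded_graph_integrals: "bounded (graph_integral F a b ` selections a b U)"
proof -
  let ?M = "lebesgue_on {a..b}"
  interpret finite_measure ?M by (rule finite_measure_lebesgue_on) simp
  obtain C where C: "C > 0" "\<forall>s\<in>{a..b}. \<forall>y\<in>U. norm (y, F s y) \<le> C" by (rule graph_bounded)
  have "norm (graph_integral F a b u) \<le> C * measure ?M (space ?M)" if u: "u \<in> selections a b U" for u
  proof -
    have "norm (graph_integral F a b u) \<le> (\<integral>s. norm (u s, F s (u s)) \<partial>?M)"
      unfolding graph_integral_def by (rule integral_norm_bound)
    also have "\<dots> \<le> (\<integral>s. C \<partial>?M)"
      by (rule integral_mono[OF integrable_norm[OF integrable_graph[OF u]]])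
         (use u C in \<open>auto simp: selections_def\<close>)
    finally show ?thesis by (simp add: mult.commute)
  qed
  then show ?thesis unfolding bounded_iff by blast
qed

text \<open>
For a measurable set \<open>E\<close>, swapping \<open>u i\<close> and \<open>u j\<close> on \<open>E\<close> produces two selections whose integrals have the same
midpoint as those of \<open>u i\<close> and \<open>u j\<close>. If both integrals are close to the extreme point \<open>e\<close>, then so is the midpoint,
hence also the integrals after the swap. The integral of the difference over \<open>E\<close> is therefore small, uniformly in
\<open>E\<close>.
\<close>

lemma L1_Cauchy_at_extreme_point:
  assumes u: "\<And>n. u n \<in> selections a b U" and lim: "(\<lambda>n. graph_integral F a b (u n)) \<longlonglongrightarrow> e"
    and e: "e extreme_point_of (closure (graph_integral F a b ` selections a b U))" and d: "(d::real) > 0"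
  shows "\<exists>N. \<forall>i\<ge>N. \<forall>j\<ge>N. (\<integral>s. norm (u i s - u j s) \<partial>lebesgue_on {a..b}) < d"
proof -
  let ?M = "lebesgue_on {a..b}" and ?R = "graph_integral F a b ` selections a b U"
  let ?G = "\<lambda>u s. (u s, F s (u s))"
  define D where "D = real DIM('a \<times> 'b)"
  have D: "D > 0" by (simp add: D_def add_pos_pos)
  \<comment> \<open>a bound \<open>2 d'\<close> on all set integrals gives the bound \<open>4 D d' < d\<close> on the \<open>L\<^sup>1\<close> norm\<close>
  define d' where "d' = d / (5 * D)"
  have d': "d' > 0" unfolding d'_def using d D by simp
  have K: "compact (closure ?R)" using bounded_graph_integrals by (rule compact_closure[THEN iffD2])
  obtain r where r: "r > 0" "\<forall>x\<in>closure ?R. \<forall>y\<in>closure ?R. norm (midpoint x y - e) < r \<longrightarrow> norm (x - e) < d'"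
    by (rule midpoints_near_extreme_point[OF K e d'])
  obtain N where N: "\<And>n. n \<ge> N \<Longrightarrow> norm (graph_integral F a b (u n) - e) < min r d'"
    using LIMSEQ_D[OF lim, of "min r d'"] r(1) d' by auto
  have "(\<integral>s. norm (u i s - u j s) \<partial>?M) < d" if ij: "i \<ge> N" "j \<ge> N" for i j
  proof -
    let ?h = "\<lambda>s. ?G (u i) s - ?G (u j) s"
    have h: "integrable ?M ?h"
      by (rule Bochner_Integration.integrable_diff[OF integrable_graph[OF u] integrable_graph[OF u]])
    have small: "norm (\<integral>s. indicator E s *\<^sub>R ?h s \<partial>?M) \<le> 2 * d'" if E: "E \<in> sets ?M" for E
    proof -
      let ?x = "graph_integral F a b (\<lambda>s. if s \<in> E then u i s else u j s)"
      let ?y = "graph_integral F a b (\<lambda>s. if s \<in> E then u j s else u i s)"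
      let ?I = "\<integral>s. indicator E s *\<^sub>R ?h s \<partial>?M"
      have x: "?x = graph_integral F a b (u j) + ?I" by (rule graph_integral_switch[OF u u E])
      have "?y = graph_integral F a b (u i) + (\<integral>s. indicator E s *\<^sub>R (?G (u j) s - ?G (u i) s) \<partial>?M)"
        by (rule graph_integral_switch[OF u u E])
      also have "(\<integral>s. indicator E s *\<^sub>R (?G (u j) s - ?G (u i) s) \<partial>?M) = (\<integral>s. - (indicator E s *\<^sub>R ?h s) \<partial>?M)"
        by (rule Bochner_Integration.integral_cong[OF refl]) (simp add: indicator_def)
      also have "\<dots> = - ?I" by (rule Bochner_Integration.integral_minus)
      finally have y: "?y = graph_integral F a b (u i) - ?I" by simp
      have "?x \<in> closure ?R" "?y \<in> closure ?R"
        using switch_selections[OF u u E] closure_subset by blast+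
      moreover have "norm (midpoint ?x ?y - e) < r"
      proof -
        have "midpoint ?x ?y - e = (1/2) *\<^sub>R ((graph_integral F a b (u i) - e) + (graph_integral F a b (u j) - e))"
          unfolding midpoint_def x y by (simp add: algebra_simps flip: scaleR_add_left)
        then have "norm (midpoint ?x ?y - e) \<le> (1/2) * (norm (graph_integral F a b (u i) - e) + norm (graph_integral F a b (u j) - e))"
          by (simp add: norm_triangle_ineq)
        then show ?thesis using N[OF ij(1)] N[OF ij(2)] by simp
      qed
      ultimately have "norm (?x - e) < d'" using r(2) by blast
      moreover have "?I = (?x - e) - (graph_integral F a b (u j) - e)" by (simp add: x)
      ultimately show ?thesis
        using norm_triangle_ineq4[of "?x - e" "graph_integral F a b (u j) - e"] N[OF ij(2)] by simp
    qed
    have ui: "integrable ?M (u n)" for n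
      using integrable_bounded_linear[OF bounded_linear_fst integrable_graph[OF u]] by simp
    have "(\<integral>s. norm (u i s - u j s) \<partial>?M) \<le> (\<integral>s. norm (?h s) \<partial>?M)"
      by (rule integral_mono[OF integrable_norm[OF Bochner_Integration.integrable_diff[OF ui ui]] integrable_norm[OF h]])
         (auto simp: norm_Pair intro: real_le_rsqrt)
    also have "\<dots> \<le> 2 * DIM('a \<times> 'b) * (2 * d')" by (rule L1_norm_le_of_set_integrals[OF h small])
    also have "\<dots> = 2 * D * (2 * d')" by (simp add: D_def)
    also have "\<dots> = (4/5) * d" using D by (simp add: d'_def)
    also have "\<dots> < d" using d by simp
    finally show ?thesis .
  qed
  then show ?thesis by blast
qed

text \<open>
A subsequence of the \<open>L\<^sup>1\<close> Cauchy sequence of selections converges almost everywhere; the limit has values in the closed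
set \<open>U\<close>, and dominated convergence identifies its integral as \<open>e\<close>.
\<close>

lemma extreme_point_attained:
  assumes e: "e extreme_point_of (closure (graph_integral F a b ` selections a b U))"
  shows "e \<in> graph_integral F a b ` selections a b U"
proof -
  let ?M = "lebesgue_on {a..b}" and ?R = "graph_integral F a b ` selections a b U"
  let ?G = "\<lambda>u s. (u s, F s (u s))"
  have "e \<in> closure ?R" using e by (simp add: extreme_point_of_def)
  then obtain z where z: "\<And>n. z n \<in> ?R" "z \<longlonglongrightarrow> e" unfolding closure_sequential by blast
  then have "\<forall>n. \<exists>u. u \<in> selections a b U \<and> z n = graph_integral F a b u" by blast
  then obtain u where u: "\<And>n. u n \<in> selections a b U" "\<And>n. z n = graph_integral F a b (u n)" by metis
  have lim: "(\<lambda>n. graph_integral F a b (u n)) \<longlonglongrightarrow> e" using z(2) by (simp add: u(2)[symmetric])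
  have ui: "integrable ?M (u n)" for n
    using integrable_bounded_linear[OF bounded_linear_fst integrable_graph[OF u(1)]] by simp
  obtain r where r: "strict_mono r" "AE s in ?M. Cauchy (\<lambda>i. u (r i) s)"
    using cauchy_L1_AE_cauchy_subseq[of ?M u, OF ui L1_Cauchy_at_extreme_point[OF u(1) lim e]] by blast
  obtain N where N: "N \<in> null_sets ?M" "{s\<in>space ?M. \<not> Cauchy (\<lambda>i. u (r i) s)} \<subseteq> N"
    using r(2) by (auto simp: eventually_ae_filter)
  \<comment> \<open>changing the selections on the null set makes them converge at every point\<close>
  define v where "v i s = (if s \<in> N then u 0 s else u (r i) s)" for i s
  have v: "v i \<in> selections a b U" for i
    unfolding v_def using N(1) by (intro switch_selections u) auto
  have "\<exists>y. (\<lambda>i. v i s) \<longlonglongrightarrow> y" if "s \<in> {a..b}" for s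
  proof (cases "s \<in> N")
    case True then show ?thesis by (auto simp: v_def)
  next
    case False
    then have "Cauchy (\<lambda>i. u (r i) s)" using N(2) that by auto
    then show ?thesis using False by (simp add: v_def Cauchy_convergent_iff convergent_def)
  qed
  then obtain y where y: "\<And>s. s \<in> {a..b} \<Longrightarrow> (\<lambda>i. v i s) \<longlonglongrightarrow> y s" by metis
  have yU: "y s \<in> U" if s: "s \<in> {a..b}" for s
    by (rule closed_sequentially[OF compact_imp_closed[OF U] _ y[OF s]]) (use v s in \<open>auto simp: selections_def\<close>)
  have ysel: "y \<in> selections a b U"
    unfolding selections_def
  proof (intro CollectI conjI ballI yU)
    show "y \<in> borel_measurable ?M"
      by (rule borel_measurable_LIMSEQ_metric[of v]) (use v y in \<open>auto simp: selections_def\<close>)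
  qed
  obtain C where C: "C > 0" "\<forall>s\<in>{a..b}. \<forall>y\<in>U. norm (y, F s y) \<le> C" by (rule graph_bounded)
  interpret finite_measure ?M by (rule finite_measure_lebesgue_on) simp
  have "(\<lambda>i. graph_integral F a b (v i)) \<longlonglongrightarrow> graph_integral F a b y"
    unfolding graph_integral_def
  proof (rule integral_dominated_convergence[where w = "\<lambda>_. C"])
    show "AE s in ?M. (\<lambda>i. ?G (v i) s) \<longlonglongrightarrow> ?G y s"
    proof (intro AE_I2 tendsto_Pair)
      fix s assume "s \<in> space ?M"
      then have s: "s \<in> {a..b}" by simp
      show "(\<lambda>i. v i s) \<longlonglongrightarrow> y s" by (rule y[OF s])
      have "(\<lambda>i. (\<lambda>(s, u). F s u) (s, v i s)) \<longlonglongrightarrow> (\<lambda>(s, u). F s u) (s, y s)"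
        by (rule continuous_on_tendsto_compose[OF F])
           (use s v yU[OF s] y[OF s] in \<open>auto simp: selections_def intro!: tendsto_intros always_eventually\<close>)
      then show "(\<lambda>i. F s (v i s)) \<longlonglongrightarrow> F s (y s)" by simp
    qed
    show "AE s in ?M. norm (?G (v i) s) \<le> C" for i
      using C v[of i] by (intro AE_I2) (auto simp: selections_def)
  qed (use integrable_graph[OF ysel] integrable_graph[OF v] in \<open>auto\<close>)
  moreover have "graph_integral F a b (v i) = graph_integral F a b (u (r i))" for i
    unfolding graph_integral_def
  proof (rule integral_cong_AE)
    show "AE s in ?M. ?G (v i) s = ?G (u (r i)) s"
      by (rule AE_I'[OF N(1)]) (auto simp: v_def)
  qed (use integrable_graph[OF v] integrable_graph[OF u(1)] in auto)
  moreover have "(\<lambda>i. graph_integral F a b (u (r i))) \<longlonglongrightarrow> e"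
    using LIMSEQ_subseq_LIMSEQ[OF lim r(1)] by (simp add: o_def)
  ultimately have "e = graph_integral F a b y" using LIMSEQ_unique by fastforce
  then show ?thesis using ysel by blast
qed

text \<open>
The closure of this set is the convex hull of its extreme points. These belong to the set, and the set is convex, so it
is already closed.
\<close>

lemma compact_graph_integrals: "compact (graph_integral F a b ` selections a b U)"
proof -
  let ?R = "graph_integral F a b ` selections a b U"
  have K: "compact (closure ?R)" "convex (closure ?R)"
    using bounded_graph_integrals convex_graph_integrals by (auto simp: compact_closure convex_closure)
  have "closure ?R = convex hull {x. x extreme_point_of (closure ?R)}"
    by (rule Krein_Milman_Minkowski[OF K])
  also have "\<dots> \<subseteq> ?R"
    by (rule hull_minimal) (use extreme_point_attained convex_graph_integrals in auto)
  finally have "closure ?R = ?R" using closure_subset by blast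
  then show ?thesis using K(1) by simp
qed

theorem compact_integrals_of_selections:
  "compact ((\<lambda>u. \<integral>s. F s (u s) \<partial>lebesgue_on {a..b}) ` selections a b U)"
proof -
  have "(\<integral>s. F s (u s) \<partial>lebesgue_on {a..b}) = snd (graph_integral F a b u)" if "u \<in> selections a b U" for u
    unfolding graph_integral_def
    using integral_bounded_linear[OF bounded_linear_snd integrable_graph[OF that]] by simp
  then have "(\<lambda>u. \<integral>s. F s (u s) \<partial>lebesgue_on {a..b}) ` selections a b U
      = snd ` graph_integral F a b ` selections a b U"
    by (auto simp: image_image)
  then show ?thesis
    using compact_continuous_image[OF continuous_on_snd[OF continuous_on_id] compact_graph_integrals] by simp
qed

end

section \<open>Signals assembled from cells of the sampling grid\<close>

text \<open>
A bound on \<open>S\<close> is an essential bound of every function with values in \<open>S\<close>.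
\<close>

lemma signals_iff_of_bounded:
  assumes "bounded S"
  shows "u \<in> signals D S \<longleftrightarrow> u \<in> D \<rightarrow>\<^sub>E S \<and> u \<in> borel_measurable (lebesgue_on D)"
proof -
  obtain c where c: "\<And>y. y \<in> S \<Longrightarrow> norm y \<le> c" using assms by (auto simp: bounded_iff)
  have "\<exists>c. AE t in lebesgue_on K. norm (u t) \<le> c" if "u \<in> D \<rightarrow>\<^sub>E S" "K \<subseteq> D" for K
    using that by (intro exI[of _ c] AE_I2) (auto intro!: c)
  then show ?thesis unfolding signals_def by blast
qed

lemma constant_signal:
  assumes "y \<in> S" "bounded S"
  shows "(\<lambda>t\<in>D. y) \<in> signals D S"
  unfolding signals_iff_of_bounded[OF assms(2)]
proof
  have "(\<lambda>t\<in>D. y) \<in> borel_measurable (lebesgue_on D) \<longleftrightarrow> (\<lambda>t. y) \<in> borel_measurable (lebesgue_on D)"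
    by (rule measurable_cong) simp
  then show "(\<lambda>t\<in>D. y) \<in> borel_measurable (lebesgue_on D)" by simp
qed (use assms in auto)

text \<open>
The cells are half open, so at a sampling instant the signal of the cell that begins there is used.
\<close>

definition concat_signals :: "real \<Rightarrow> (nat \<Rightarrow> real \<Rightarrow> 'a) \<Rightarrow> real \<Rightarrow> 'a" where
  "concat_signals \<tau> us t = (if 0 \<le> t then us (nat \<lfloor>t / \<tau>\<rfloor>) (t - real (nat \<lfloor>t / \<tau>\<rfloor>) * \<tau>) else undefined)"

lemma concat_signals_cell:
  assumes "0 < \<tau>" "t \<in> {real n * \<tau>..<(real n + 1) * \<tau>}"
  shows "concat_signals \<tau> us t = us n (t - real n * \<tau>)"
proof -
  have "\<lfloor>t / \<tau>\<rfloor> = int n" using assms by (intro floor_unique) (auto simp: pos_le_divide_eq pos_divide_less_eq)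
  moreover have "0 \<le> t" using assms by (auto intro: order_trans[of 0 "real n * \<tau>"])
  ultimately show ?thesis by (simp add: concat_signals_def)
qed

lemma cell_exists:
  assumes "0 < (\<tau>::real)" "0 \<le> t"
  obtains n where "t \<in> {real n * \<tau>..<(real n + 1) * \<tau>}"
proof
  have "0 \<le> \<lfloor>t / \<tau>\<rfloor>" using assms by simp
  then have "real (nat \<lfloor>t / \<tau>\<rfloor>) = of_int \<lfloor>t / \<tau>\<rfloor>" by simp
  then show "t \<in> {real (nat \<lfloor>t / \<tau>\<rfloor>) * \<tau>..<(real (nat \<lfloor>t / \<tau>\<rfloor>) + 1) * \<tau>}"
    using assms floor_divide_lower[of \<tau> t] floor_divide_upper[of \<tau> t] by simp
qed

lemma concat_signals_in_signals:
  fixes us :: "nat \<Rightarrow> real \<Rightarrow> real^'m"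
  assumes \<tau>: "0 < \<tau>" and S: "bounded S" and us: "\<And>n. us n \<in> signals {0..\<tau>} S"
  shows "concat_signals \<tau> us \<in> signals {0..} S"
  unfolding signals_iff_of_bounded[OF S]
proof
  have usP: "us n t \<in> S" if "t \<in> {0..\<tau>}" for n t
    using us[of n] that by (auto simp: signals_iff_of_bounded[OF S])
  let ?C = "\<lambda>n::nat. {real n * \<tau>..<(real n + 1) * \<tau>}"
  have local_time: "t - real n * \<tau> \<in> {0..\<tau>}" if "t \<in> ?C n" for t n
    using that by (auto simp: algebra_simps)
  have "concat_signals \<tau> us t \<in> S" if "t \<ge> 0" for t
  proof -
    obtain n where n: "t \<in> ?C n" using cell_exists[OF \<tau> \<open>t \<ge> 0\<close>] by blast
    show ?thesis unfolding concat_signals_cell[OF \<tau> n] by (rule usP[OF local_time[OF n]])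
  qed
  moreover have "concat_signals \<tau> us t = undefined" if "t \<notin> {0..}" for t
    using that by (simp add: concat_signals_def)
  ultimately show "concat_signals \<tau> us \<in> {0..} \<rightarrow>\<^sub>E S" by (intro PiE_I) auto
  show "concat_signals \<tau> us \<in> borel_measurable (lebesgue_on {0..})"
  proof (rule measurable_piecewise_restrict[of "range ?C"])
    show "space (lebesgue_on {0..}) \<subseteq> \<Union>(range ?C)" using cell_exists[OF \<tau>] by auto metis
    fix \<Omega> assume "\<Omega> \<in> range ?C"
    then obtain n where n: "\<Omega> = ?C n" by blast
    have sub: "\<Omega> \<subseteq> {0..}" using n \<tau> by (auto intro: order_trans[of 0 "real n * \<tau>"])
    have "\<Omega> \<in> sets lebesgue" unfolding n by simp
    with sub show "\<Omega> \<inter> space (lebesgue_on {0..}) \<in> sets (lebesgue_on {0..})"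
      by (auto simp: sets_restrict_space_iff Int_absorb2)
    have eq: "restrict_space (lebesgue_on {0..}) \<Omega> = lebesgue_on \<Omega>"
      using \<open>\<Omega> \<in> sets lebesgue\<close> sub by (subst restrict_restrict_space) (auto simp: Int_absorb1)
    define g where "g t = (if t \<in> {0..\<tau>} then us n t else 0)" for t
    have "us n \<in> borel_measurable (lebesgue_on {0..\<tau>})"
      using us[of n] by (simp add: signals_iff_of_bounded[OF S])
    then have g: "g \<in> borel_measurable lebesgue" unfolding g_def by (rule borel_measurable_if_I) simp
    have "(\<lambda>t. - real n * \<tau> + t) \<in> lebesgue \<rightarrow>\<^sub>M lebesgue"
      using lebesgue_affine_measurable[of "\<lambda>_. 1::real" "- real n * \<tau>"] by simp
    from measurable_restrict_space1[OF measurable_compose[OF this g]]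
    have "(\<lambda>t. g (- real n * \<tau> + t)) \<in> borel_measurable (lebesgue_on \<Omega>)" .
    moreover have "concat_signals \<tau> us t = g (- real n * \<tau> + t)" if "t \<in> space (lebesgue_on \<Omega>)" for t
    proof -
      have t: "t \<in> ?C n" using that n by simp
      show ?thesis using concat_signals_cell[OF \<tau> t, of us] local_time[OF t] by (simp add: g_def)
    qed
    ultimately show "concat_signals \<tau> us \<in> borel_measurable (restrict_space (lebesgue_on {0..}) \<Omega>)"
      unfolding eq by (subst measurable_cong) auto
  qed auto
qed

text \<open>
At the right end of the cell the concatenation already follows the next signal; the equation is only claimed almost
everywhere, so this point is added to the null set.
\<close>

lemma is_solution_cell:
  assumes \<tau>: "0 < \<tau>"
    and sol: "is_solution \<Sigma> {0..} (concat_signals \<tau> us) (concat_signals \<tau> vs) x"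
  shows "is_solution \<Sigma> {0..\<tau>} (us n) (vs n) (\<lambda>s. x (real n * \<tau> + s))"
proof -
  let ?c = "real n * \<tau>"
  have c: "0 \<le> ?c" using \<tau> by simp
  have "abs_continuous_on (?c + 0) (?c + \<tau>) x"
    using sol \<tau> c unfolding is_solution_def loc_abs_continuous_on_def by auto
  then have ac: "abs_continuous_on 0 \<tau> (\<lambda>s. x (?c + s))" by (rule abs_continuous_on_shift)
  obtain N where N: "negligible N" and der: "\<And>t. t \<in> {0..} - N \<Longrightarrow>
      (x has_vector_derivative (matA \<Sigma> *v x t + matB \<Sigma> *v concat_signals \<tau> us t + matG \<Sigma> *v concat_signals \<tau> vs t)) (at t within {0..})"
    using sol unfolding is_solution_def by (subst (asm) ode_ae_iff_negligible) auto
  have "ode_ae \<Sigma> {0..\<tau>} (us n) (vs n) (\<lambda>s. x (?c + s))"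
  proof (subst ode_ae_iff_negligible, simp, intro exI conjI ballI)
    show "negligible ((+) (- ?c) ` N \<union> {\<tau>})"
      by (intro negligible_Un negligible_translation N negligible_sing)
    fix s assume s: "s \<in> {0..\<tau>} - ((+) (- ?c) ` N \<union> {\<tau>})"
    then have tN: "?c + s \<in> {0..} - N" using c by (auto simp: image_iff)
    have "?c + s \<in> {?c..<(real n + 1) * \<tau>}" using s by (auto simp: algebra_simps)
    from concat_signals_cell[OF \<tau> this] have val: "concat_signals \<tau> us (?c + s) = us n s" "concat_signals \<tau> vs (?c + s) = vs n s"
      by auto
    have "(x has_vector_derivative (matA \<Sigma> *v x (?c + s) + matB \<Sigma> *v us n s + matG \<Sigma> *v vs n s)) (at (?c + s) within (+) ?c ` {0..\<tau>})"
      by (rule has_vector_derivative_within_subset[OF der[OF tN, unfolded val]]) (use c in auto)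
    then have "((x \<circ> (+) ?c) has_vector_derivative 1 *\<^sub>R (matA \<Sigma> *v x (?c + s) + matB \<Sigma> *v us n s + matG \<Sigma> *v vs n s)) (at s within {0..\<tau>})"
      by (intro vector_diff_chain_within) (auto intro!: derivative_eq_intros)
    then show "((\<lambda>s. x (?c + s)) has_vector_derivative (matA \<Sigma> *v x (?c + s) + matB \<Sigma> *v us n s + matG \<Sigma> *v vs n s)) (at s within {0..\<tau>})"
      by (simp add: o_def)
  qed
  then show ?thesis unfolding is_solution_def using ac \<tau> by (simp add: loc_abs_continuous_on_Icc)
qed

text \<open>
Inside a cell the derivative within the cell is the full derivative; the countably many sampling instants form a null
set.
\<close>

lemma ode_ae_concat:
  assumes \<tau>: "0 < \<tau>"
    and ode: "\<And>n. ode_ae \<Sigma> {real n * \<tau>..<(real n + 1) * \<tau>}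
        (\<lambda>t. us n (t - real n * \<tau>)) (\<lambda>t. vs n (t - real n * \<tau>)) x"
  shows "ode_ae \<Sigma> {0..} (concat_signals \<tau> us) (concat_signals \<tau> vs) x"
proof -
  let ?C = "\<lambda>n::nat. {real n * \<tau>..<(real n + 1) * \<tau>}"
  have "\<exists>N. negligible N \<and> (\<forall>t\<in>?C n - N. (x has_vector_derivative
      (matA \<Sigma> *v x t + matB \<Sigma> *v us n (t - real n * \<tau>) + matG \<Sigma> *v vs n (t - real n * \<tau>))) (at t within ?C n))" for n
    using ode[of n] by (subst (asm) ode_ae_iff_negligible) auto
  then obtain N where N: "\<And>n. negligible (N n)" "\<And>n t. t \<in> ?C n - N n \<Longrightarrow> (x has_vector_derivative
      (matA \<Sigma> *v x t + matB \<Sigma> *v us n (t - real n * \<tau>) + matG \<Sigma> *v vs n (t - real n * \<tau>))) (at t within ?C n)"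
    by metis
  show ?thesis
  proof (subst ode_ae_iff_negligible, simp, intro exI conjI ballI)
    show "negligible (\<Union>n. N n \<union> {real n * \<tau>})"
      using N(1) by (intro negligible_countable_Union) auto
    fix t assume t: "t \<in> {0..} - (\<Union>n. N n \<union> {real n * \<tau>})"
    then obtain n where n: "t \<in> ?C n" using cell_exists[OF \<tau>, of t] by auto
    have "t \<noteq> real n * \<tau>" using t by auto
    then have "t \<in> interior (?C n)" using n by simp
    then have "at t within ?C n = at t" by (rule at_within_interior)
    then show "(x has_vector_derivative
        (matA \<Sigma> *v x t + matB \<Sigma> *v concat_signals \<tau> us t + matG \<Sigma> *v concat_signals \<tau> vs t)) (at t within {0..})"
      using N(2)[of t n] n t unfolding concat_signals_cell[OF \<tau> n]
      by (auto intro: has_vector_derivative_at_within)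
  qed
qed

lemma ode_ae_cell:
  assumes \<tau>: "0 < \<tau>" and ode: "ode_ae \<Sigma> {0..} (concat_signals \<tau> us) (concat_signals \<tau> vs) x"
  shows "ode_ae \<Sigma> {real n * \<tau>..<(real n + 1) * \<tau>} (\<lambda>t. us n (t - real n * \<tau>)) (\<lambda>t. vs n (t - real n * \<tau>)) x"
proof -
  let ?C = "{real n * \<tau>..<(real n + 1) * \<tau>}"
  have sub: "?C \<subseteq> {0..}" using \<tau> by (auto intro: order_trans[of 0 "real n * \<tau>"])
  obtain N where N: "negligible N" and der: "\<And>t. t \<in> {0..} - N \<Longrightarrow>
      (x has_vector_derivative (matA \<Sigma> *v x t + matB \<Sigma> *v concat_signals \<tau> us t + matG \<Sigma> *v concat_signals \<tau> vs t)) (at t within {0..})"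
    using ode by (subst (asm) ode_ae_iff_negligible) auto
  show ?thesis
  proof (subst ode_ae_iff_negligible, simp, intro exI conjI ballI)
    fix t assume t: "t \<in> ?C - N"
    then have tC: "t \<in> ?C" and t0: "t \<in> {0..} - N" using sub by auto
    show "(x has_vector_derivative (matA \<Sigma> *v x t + matB \<Sigma> *v us n (t - real n * \<tau>) + matG \<Sigma> *v vs n (t - real n * \<tau>))) (at t within ?C)"
      using has_vector_derivative_within_subset[OF der[OF t0] sub]
      unfolding concat_signals_cell[OF \<tau> tC] .
  qed (rule N)
qed

section \<open>Superposition and compactness of the reachable sets\<close>

text \<open>
Control and disturbance enter the equation in the same way. Exchanging them turns every statement on controls into one on
disturbances.
\<close>

definition swap_inputs ::
  "('n::finite, 'm::finite, 'k::finite) lin_sys \<Rightarrow> ('n, 'k, 'm) lin_sys" where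
  "swap_inputs \<Sigma> = \<lparr>matA = matA \<Sigma>, matB = matG \<Sigma>, matG = matB \<Sigma>,
     Xset = Xset \<Sigma>, Uset = Vset \<Sigma>, Vset = Uset \<Sigma>\<rparr>"

lemma swap_inputs_simps [simp]:
  "matA (swap_inputs \<Sigma>) = matA \<Sigma>" "matB (swap_inputs \<Sigma>) = matG \<Sigma>" "matG (swap_inputs \<Sigma>) = matB \<Sigma>"
  "Xset (swap_inputs \<Sigma>) = Xset \<Sigma>" "Uset (swap_inputs \<Sigma>) = Vset \<Sigma>" "Vset (swap_inputs \<Sigma>) = Uset \<Sigma>"
  by (simp_all add: swap_inputs_def)

lemma is_solution_swap_inputs: "is_solution (swap_inputs \<Sigma>) D v u x = is_solution \<Sigma> D u v x"
  by (simp add: is_solution_def ode_ae_def ac_simps)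

lemma sol_swap_inputs: "sol (swap_inputs \<Sigma>) t z v u = sol \<Sigma> t z u v"
  by (simp add: sol_def is_solution_swap_inputs)

lemma reach_A_swap_inputs: "reach_A (swap_inputs \<Sigma>) \<tau> = reach_B \<Sigma> \<tau>"
  by (simp add: reach_A_def reach_B_def A_signals_def B_signals_def sol_swap_inputs)

text \<open>
These assumptions are invariant under \<^const>\<open>swap_inputs\<close>, so that results on controls transfer to disturbances.
\<close>

locale input_bounded_system =
  fixes \<Sigma> :: "('n::finite, 'm::finite, 'k::finite) lin_sys" and \<tau> :: real
  assumes U: "Uset \<Sigma> \<noteq> {}" "compact (Uset \<Sigma>)" and V: "Vset \<Sigma> \<noteq> {}" "compact (Vset \<Sigma>)"
    and X0: "0 \<in> Xset \<Sigma>" and complete: "forward_complete \<Sigma>" and \<tau>: "0 < \<tau>"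
begin

lemma input_bounded_system_swap: "input_bounded_system (swap_inputs \<Sigma>) \<tau>"
proof
  show "forward_complete (swap_inputs \<Sigma>)"
    using complete unfolding forward_complete_def generates_def is_solution_swap_inputs swap_inputs_simps
    by blast
qed (use U V X0 \<tau> in simp_all)

lemma Ubdd: "bounded (Uset \<Sigma>)" and Vbdd: "bounded (Vset \<Sigma>)"
  using U V by (auto intro: compact_imp_bounded)

lemma ex_trajectory_concat:
  assumes "q \<in> Xset \<Sigma>" "\<And>n. us n \<in> A_signals \<Sigma> \<tau>" "\<And>n. vs n \<in> B_signals \<Sigma> \<tau>"
  shows "\<exists>x. generates \<Sigma> {0..} (concat_signals \<tau> us) (concat_signals \<tau> vs) x \<and> x 0 = q"
  using complete assms concat_signals_in_signals[OF \<tau> Ubdd, of us] concat_signals_in_signals[OF \<tau> Vbdd, of vs]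
  unfolding forward_complete_def A_signals_def B_signals_def by blast

text \<open>
The signals on one period are repeated periodically to obtain signals on the half line, for which forward completeness
provides a trajectory.
\<close>

lemma ex_solution:
  assumes "q \<in> Xset \<Sigma>" "u \<in> A_signals \<Sigma> \<tau>" "v \<in> B_signals \<Sigma> \<tau>"
  shows "\<exists>x. is_solution \<Sigma> {0..\<tau>} u v x \<and> x 0 = q \<and> x \<tau> \<in> Xset \<Sigma>"
proof -
  obtain x where x: "generates \<Sigma> {0..} (concat_signals \<tau> (\<lambda>_. u)) (concat_signals \<tau> (\<lambda>_. v)) x" "x 0 = q"
    using ex_trajectory_concat[of q "\<lambda>_. u" "\<lambda>_. v"] assms by blast
  then have "is_solution \<Sigma> {0..\<tau>} u v (\<lambda>s. x (real 0 * \<tau> + s))"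
    unfolding generates_def by (intro is_solution_cell[OF \<tau>, where us = "\<lambda>_. u" and vs = "\<lambda>_. v"]) auto
  moreover have "x \<tau> \<in> Xset \<Sigma>" using x(1) \<tau> by (simp add: generates_def)
  ultimately show ?thesis using x(2) by auto
qed

lemma sol_in_Xset:
  assumes "q \<in> Xset \<Sigma>" "u \<in> A_signals \<Sigma> \<tau>" "v \<in> B_signals \<Sigma> \<tau>"
  shows "sol \<Sigma> \<tau> q u v \<in> Xset \<Sigma>"
  using ex_solution[OF assms] sol_eqI[of \<Sigma> \<tau> u v _ q] \<tau> by auto

text \<open>
Forward completeness only speaks of admissible disturbances, and zero need not be one. The solution \<open>x\<close> with a constant
admissible disturbance \<open>v0\<close> minus the solution \<open>z\<close> with that disturbance and no control solves the equation with
control \<open>u\<close> and zero disturbance.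
\<close>

lemma forced_response_has_integral:
  assumes u: "u \<in> A_signals \<Sigma> \<tau>"
  shows "((\<lambda>s. mat_exp ((\<tau> - s) *\<^sub>R matA \<Sigma>) *v (matB \<Sigma> *v u s)) has_integral sol \<Sigma> \<tau> 0 u (\<lambda>_. 0)) {0..\<tau>}"
proof -
  have \<tau>0: "0 \<le> \<tau>" using \<tau> by simp
  obtain v0 where v0: "v0 \<in> Vset \<Sigma>" using V by auto
  obtain x where x: "is_solution \<Sigma> {0..\<tau>} u (\<lambda>t\<in>{0..\<tau>}. v0) x" "x 0 = 0"
    using ex_solution[OF X0 u] constant_signal[OF v0 Vbdd] unfolding B_signals_def by blast
  obtain z where z: "z 0 = 0" "is_solution \<Sigma> {0..\<tau>} (\<lambda>_. 0) (\<lambda>_. v0) z"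
    using ex_solution_constant_inputs[OF \<tau>0] by blast
  have y: "is_solution \<Sigma> {0..\<tau>} u (\<lambda>_. 0) (\<lambda>t. x t - z t)"
    by (rule is_solution_cong[OF is_solution_diff[OF x(1) z(2) \<tau>0]]) auto
  have "sol \<Sigma> \<tau> 0 u (\<lambda>_. 0) = x \<tau> - z \<tau>" by (rule sol_eqI[OF y]) (use x z \<tau>0 in auto)
  then show ?thesis using variation_of_constants[OF y \<tau>0] x(2) z(1) by simp
qed

lemma disturbance_response_has_integral:
  assumes v: "v \<in> B_signals \<Sigma> \<tau>"
  shows "((\<lambda>s. mat_exp ((\<tau> - s) *\<^sub>R matA \<Sigma>) *v (matG \<Sigma> *v v s)) has_integral sol \<Sigma> \<tau> 0 (\<lambda>_. 0) v) {0..\<tau>}"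
  using input_bounded_system.forced_response_has_integral[OF input_bounded_system_swap, of v] v
  by (simp add: sol_swap_inputs A_signals_def B_signals_def)

lemma sol_superposition:
  assumes q: "q \<in> Xset \<Sigma>" and u: "u \<in> A_signals \<Sigma> \<tau>" and v: "v \<in> B_signals \<Sigma> \<tau>"
  shows "sol \<Sigma> \<tau> q u v = mat_exp (\<tau> *\<^sub>R matA \<Sigma>) *v q + sol \<Sigma> \<tau> 0 u (\<lambda>_. 0) + sol \<Sigma> \<tau> 0 (\<lambda>_. 0) v"
proof -
  have \<tau>0: "0 \<le> \<tau>" using \<tau> by simp
  obtain x where x: "is_solution \<Sigma> {0..\<tau>} u v x" "x 0 = q" using ex_solution[OF q u v] by blast
  have "((\<lambda>s. mat_exp ((\<tau> - s) *\<^sub>R matA \<Sigma>) *v (matB \<Sigma> *v u s + matG \<Sigma> *v v s))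
      has_integral (sol \<Sigma> \<tau> 0 u (\<lambda>_. 0) + sol \<Sigma> \<tau> 0 (\<lambda>_. 0) v)) {0..\<tau>}"
    using has_integral_add[OF forced_response_has_integral[OF u] disturbance_response_has_integral[OF v]]
    by (simp add: matrix_vector_right_distrib)
  from has_integral_unique[OF variation_of_constants[OF x(1) \<tau>0] this] x \<tau>0 sol_eqI[OF x \<tau>0]
  show ?thesis by (simp add: algebra_simps)
qed

text \<open>
By the variation of constants formula the reachable set is a set of integrals of selections of the compact input set,
with integrand \<open>e\<^bsup>(\<tau>-s)A\<^esup> B u(s)\<close>.
\<close>

lemma compact_reach_A: "compact (reach_A \<Sigma> \<tau>)"
proof -
  define F where "F s y = mat_exp ((\<tau> - s) *\<^sub>R matA \<Sigma>) *v (matB \<Sigma> *v y)" for s y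
  have Fcont: "continuous_on ({0..\<tau>} \<times> Uset \<Sigma>) (\<lambda>(s, y). F s y)"
    unfolding F_def split_def by (intro continuous_intros)
  have eq: "sol \<Sigma> \<tau> 0 u (\<lambda>_. 0) = (\<integral>s. F s (u s) \<partial>lebesgue_on {0..\<tau>})" if u: "u \<in> A_signals \<Sigma> \<tau>" for u
  proof -
    have "u \<in> selections 0 \<tau> (Uset \<Sigma>)"
      using u by (auto simp: A_signals_def signals_iff_of_bounded[OF Ubdd] selections_def)
    from integrable_bounded_linear[OF bounded_linear_snd integrable_graph[OF U(2) Fcont this]]
    have "integrable (lebesgue_on {0..\<tau>}) (\<lambda>s. F s (u s))" by simp
    from has_integral_integral_lebesgue_on[OF this]
    have "((\<lambda>s. F s (u s)) has_integral (\<integral>s. F s (u s) \<partial>lebesgue_on {0..\<tau>})) {0..\<tau>}" by simp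
    then show ?thesis using forced_response_has_integral[OF u] unfolding F_def by (rule has_integral_unique[rotated])
  qed
  have "reach_A \<Sigma> \<tau> = (\<lambda>u. \<integral>s. F s (u s) \<partial>lebesgue_on {0..\<tau>}) ` selections 0 \<tau> (Uset \<Sigma>)"
  proof (intro subset_antisym subsetI)
    fix y assume "y \<in> reach_A \<Sigma> \<tau>"
    then obtain u where u: "u \<in> A_signals \<Sigma> \<tau>" "y = sol \<Sigma> \<tau> 0 u (\<lambda>_. 0)" by (auto simp: reach_A_def)
    then have "u \<in> selections 0 \<tau> (Uset \<Sigma>)"
      by (auto simp: A_signals_def signals_iff_of_bounded[OF Ubdd] selections_def)
    then show "y \<in> (\<lambda>u. \<integral>s. F s (u s) \<partial>lebesgue_on {0..\<tau>}) ` selections 0 \<tau> (Uset \<Sigma>)"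
      using eq[OF u(1)] u(2) by blast
  next
    fix y assume "y \<in> (\<lambda>u. \<integral>s. F s (u s) \<partial>lebesgue_on {0..\<tau>}) ` selections 0 \<tau> (Uset \<Sigma>)"
    then obtain u where u: "u \<in> selections 0 \<tau> (Uset \<Sigma>)" "y = (\<integral>s. F s (u s) \<partial>lebesgue_on {0..\<tau>})" by blast
    have "restrict u {0..\<tau>} \<in> borel_measurable (lebesgue_on {0..\<tau>}) \<longleftrightarrow> u \<in> borel_measurable (lebesgue_on {0..\<tau>})"
      by (rule measurable_cong) simp
    then have r: "restrict u {0..\<tau>} \<in> A_signals \<Sigma> \<tau>"
      using u(1) by (auto simp: A_signals_def signals_iff_of_bounded[OF Ubdd] selections_def)
    have "y = sol \<Sigma> \<tau> 0 (restrict u {0..\<tau>}) (\<lambda>_. 0)"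
      unfolding u(2) eq[OF r] by (rule Bochner_Integration.integral_cong) auto
    then show "y \<in> reach_A \<Sigma> \<tau>" using r unfolding reach_A_def by blast
  qed
  then show ?thesis using compact_integrals_of_selections[OF U(2) Fcont] by simp
qed

lemma compact_reach_B: "compact (reach_B \<Sigma> \<tau>)"
  using input_bounded_system.compact_reach_A[OF input_bounded_system_swap] by (simp add: reach_A_swap_inputs)

end

section \<open>Bisimilarity with the abstraction is closeness\<close>

lemma hausdorff_dist_commute: "hausdorff_dist S1 S2 = hausdorff_dist S2 S1"
  by (simp add: hausdorff_dist_def max.commute dinf_def infnorm_sub)

text \<open>
Compactness of \<open>S2\<close> turns the bound on an infimum into a point at distance at most \<open>c\<close>.
\<close>

lemma hausdorff_dist_attained:
  assumes h: "hausdorff_dist S1 S2 \<le> ennreal c" and c: "0 \<le> c" and S2: "compact S2" and x: "x \<in> S1"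
  shows "\<exists>y\<in>S2. dinf x y \<le> c"
proof -
  have le: "(INF y\<in>S2. ennreal (dinf x y)) \<le> ennreal c"
    using h x unfolding hausdorff_dist_def by (meson SUP_upper max.boundedE order_trans)
  have ne: "S2 \<noteq> {}" using le by (auto simp: top_unique)
  have "continuous_on S2 (\<lambda>y. infnorm (x - y))" by (intro continuous_intros)
  then obtain y where y: "y \<in> S2" "\<And>z. z \<in> S2 \<Longrightarrow> dinf x y \<le> dinf x z"
    using continuous_attains_inf[OF S2 ne] unfolding dinf_def by blast
  have "ennreal (dinf x y) \<le> (INF y\<in>S2. ennreal (dinf x y))"
    using y(2) by (intro INF_greatest ennreal_leI)
  then have "ennreal (dinf x y) \<le> ennreal c" using le by order
  then show ?thesis using y(1) c by (auto simp: ennreal_le_iff)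
qed

lemma infnorm_sum4_le: "infnorm (p + (q + (r + s))) \<le> infnorm p + (infnorm q + (infnorm r + infnorm s))"
  by (intro order_trans[OF infnorm_triangle] add_left_mono order_refl)

lemma row_sum_norm_nonneg: "0 \<le> row_sum_norm M"
proof -
  have "0 \<le> (\<Sum>j\<in>UNIV. \<bar>M $ undefined $ j\<bar>)" by (simp add: sum_nonneg)
  also have "\<dots> \<le> row_sum_norm M" unfolding row_sum_norm_def by (rule Max_ge) auto
  finally show ?thesis .
qed

text \<open>
The inequality \<open>contraction\<close> says that an error of size \<open>\<epsilon>\<close> does not grow: what is left of the old error plus the
three quantization errors stays below \<open>\<epsilon>\<close>.
\<close>

locale symbolic_abstraction = input_bounded_system \<Sigma> \<tau>
  for \<Sigma> :: "('n::finite, 'm::finite, 'k::finite) lin_sys" and \<tau> :: real +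
  fixes \<epsilon> \<eta> \<mu> :: real and T :: "(real^'n, real^'n, real^'n, real^'n) ats"
  assumes pos: "0 < \<epsilon>" "0 < \<mu>"
    and T: "T \<in> abstractions \<Sigma> \<tau> \<eta> \<mu>" and nb: "non_blocking T" and fin: "finite_ats T"
    and contraction: "row_sum_norm (mat_exp (\<tau> *\<^sub>R matA \<Sigma>)) * \<epsilon> + \<mu> + \<eta> / 2 < \<epsilon>"
begin

abbreviation "control_response u \<equiv> sol \<Sigma> \<tau> 0 u (\<lambda>_. 0)"
abbreviation "disturbance_response v \<equiv> sol \<Sigma> \<tau> 0 (\<lambda>_. 0) v"

lemma states_subset: "states T \<subseteq> Xset \<Sigma>"
  using T by (auto simp: abstractions_def grid_def)

lemma transitions_iff: "(q, a, b, q') \<in> transitions T \<longleftrightarrow>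
   q \<in> states T \<and> a \<in> controls T \<and> b \<in> disturbances T \<and> q' \<in> states T \<and>
   infnorm (mat_exp (\<tau> *\<^sub>R matA \<Sigma>) *v q + a + b - q') \<le> \<eta> / 2"
  using T \<tau> by (simp add: abstractions_def sol_homogeneous)

lemma hausdorff_controls: "hausdorff_dist (controls T) (reach_A \<Sigma> \<tau>) \<le> ennreal (\<mu> / 2)"
  and hausdorff_disturbances: "hausdorff_dist (disturbances T) (reach_B \<Sigma> \<tau>) \<le> ennreal (\<mu> / 2)"
  using T by (auto simp: abstractions_def)

lemma ex_control_near:
  assumes "u \<in> A_signals \<Sigma> \<tau>"
  shows "\<exists>a\<in>controls T. infnorm (control_response u - a) \<le> \<mu> / 2"
proof -
  have "control_response u \<in> reach_A \<Sigma> \<tau>" using assms by (auto simp: reach_A_def)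
  moreover have "compact (controls T)" using fin by (simp add: finite_ats_def finite_imp_compact)
  ultimately show ?thesis
    using hausdorff_dist_attained[OF hausdorff_controls[unfolded hausdorff_dist_commute[of "controls T"]]] pos
    by (simp add: dinf_def)
qed

lemma ex_disturbance_near:
  assumes "v \<in> B_signals \<Sigma> \<tau>"
  shows "\<exists>b\<in>disturbances T. infnorm (disturbance_response v - b) \<le> \<mu> / 2"
proof -
  have "disturbance_response v \<in> reach_B \<Sigma> \<tau>" using assms by (auto simp: reach_B_def)
  moreover have "compact (disturbances T)" using fin by (simp add: finite_ats_def finite_imp_compact)
  ultimately show ?thesis
    using hausdorff_dist_attained[OF hausdorff_disturbances[unfolded hausdorff_dist_commute[of "disturbances T"]]] pos
    by (simp add: dinf_def)
qed

lemma ex_control_signal_near: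
  "a \<in> controls T \<Longrightarrow> \<exists>u\<in>A_signals \<Sigma> \<tau>. infnorm (control_response u - a) \<le> \<mu> / 2"
  using hausdorff_dist_attained[OF hausdorff_controls _ compact_reach_A] pos
  by (force simp: reach_A_def dinf_def infnorm_sub[of a])

lemma ex_disturbance_signal_near:
  "b \<in> disturbances T \<Longrightarrow> \<exists>v\<in>B_signals \<Sigma> \<tau>. infnorm (disturbance_response v - b) \<le> \<mu> / 2"
  using hausdorff_dist_attained[OF hausdorff_disturbances _ compact_reach_B] pos
  by (force simp: reach_B_def dinf_def infnorm_sub[of b])

lemma ex_successor:
  assumes "q \<in> states T" "a \<in> controls T" "b \<in> disturbances T"
  shows "\<exists>q'\<in>states T. (q, a, b, q') \<in> transitions T"
  using nb assms unfolding non_blocking_def by blast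

text \<open>
By superposition the difference of the two successors is a sum of four terms: the image of the old difference under
\<open>e\<^bsup>A\<tau>\<^esup>\<close>, the errors in control and disturbance, and the rounding error of the state.
\<close>

lemma successors_close:
  assumes q: "q1 \<in> Xset \<Sigma>" "dinf q1 q2 \<le> \<epsilon>"
    and u: "u \<in> A_signals \<Sigma> \<tau>" "infnorm (control_response u - a) \<le> \<mu> / 2"
    and v: "v \<in> B_signals \<Sigma> \<tau>" "infnorm (disturbance_response v - b) \<le> \<mu> / 2"
    and tr: "(q2, a, b, q2') \<in> transitions T"
  shows "dinf (sol \<Sigma> \<tau> q1 u v) q2' \<le> \<epsilon>"
proof -
  let ?E = "mat_exp (\<tau> *\<^sub>R matA \<Sigma>)"
  have "infnorm (?E *v (q1 - q2)) \<le> row_sum_norm ?E * infnorm (q1 - q2)" by (rule infnorm_mult_vec_le)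
  also have "\<dots> \<le> row_sum_norm ?E * \<epsilon>"
    using q(2) row_sum_norm_nonneg by (intro mult_left_mono) (auto simp: dinf_def)
  finally have 1: "infnorm (?E *v (q1 - q2)) \<le> row_sum_norm ?E * \<epsilon>" .
  have 2: "infnorm (?E *v q2 + a + b - q2') \<le> \<eta> / 2" using tr by (simp add: transitions_iff)
  have "sol \<Sigma> \<tau> q1 u v - q2' = ?E *v (q1 - q2) + ((control_response u - a)
      + ((disturbance_response v - b) + (?E *v q2 + a + b - q2')))"
    by (simp add: sol_superposition[OF q(1) u(1) v(1)] matrix_vector_mult_diff_distrib algebra_simps)
  then have "infnorm (sol \<Sigma> \<tau> q1 u v - q2') \<le> infnorm (?E *v (q1 - q2)) + (infnorm (control_response u - a)
      + (infnorm (disturbance_response v - b) + infnorm (?E *v q2 + a + b - q2')))"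
    by (simp only: infnorm_sum4_le)
  then show ?thesis using 1 2 u(2) v(2) contraction by (simp add: dinf_def)
qed

text \<open>
In either direction the matching control and disturbance are chosen with responses within \<open>\<mu>/2\<close>. On the symbolic side a
successor exists because the abstraction is non-blocking.
\<close>

lemma aea_bisimulation_closeness:
  "aea_bisimulation dinf \<epsilon> (sampling_system \<Sigma> \<tau>) T {(q1, q2). q1 \<in> Xset \<Sigma> \<and> q2 \<in> states T \<and> dinf q1 q2 \<le> \<epsilon>}"
  (is "aea_bisimulation dinf \<epsilon> _ T ?R")
  unfolding aea_bisimulation_def
proof (intro conjI ballI)
  show "?R \<subseteq> states (sampling_system \<Sigma> \<tau>) \<times> states T" by (auto simp: sampling_system_def)
  fix p assume "p \<in> ?R"
  then obtain q1 q2 where p: "p = (q1, q2)" and q: "q1 \<in> Xset \<Sigma>" "q2 \<in> states T" "dinf q1 q2 \<le> \<epsilon>" by auto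
  have tr1: "(q1, u, v, sol \<Sigma> \<tau> q1 u v) \<in> transitions (sampling_system \<Sigma> \<tau>)"
    if "u \<in> A_signals \<Sigma> \<tau>" "v \<in> B_signals \<Sigma> \<tau>" for u v
    using that q(1) sol_in_Xset by (simp add: sampling_system_def)
  have obs: "obs T q2 = q2" using T q(2) by (simp add: abstractions_def)
  have forth: "\<exists>a2\<in>controls T. \<forall>b2\<in>disturbances T. \<forall>q2'\<in>states T. (q2, a2, b2, q2') \<in> transitions T \<longrightarrow>
      (\<exists>b1\<in>disturbances (sampling_system \<Sigma> \<tau>). \<exists>q1'\<in>states (sampling_system \<Sigma> \<tau>).
        (q1, u, b1, q1') \<in> transitions (sampling_system \<Sigma> \<tau>) \<and> (q1', q2') \<in> ?R)"
    if u: "u \<in> controls (sampling_system \<Sigma> \<tau>)" for u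
  proof -
    have u: "u \<in> A_signals \<Sigma> \<tau>" using u by (simp add: sampling_system_def)
    obtain a where a: "a \<in> controls T" "infnorm (control_response u - a) \<le> \<mu> / 2" using ex_control_near[OF u] by blast
    show ?thesis
    proof (intro bexI[OF _ a(1)] ballI impI)
      fix b q2' assume b: "b \<in> disturbances T" and q2': "q2' \<in> states T" and tr: "(q2, a, b, q2') \<in> transitions T"
      obtain v where v: "v \<in> B_signals \<Sigma> \<tau>" "infnorm (disturbance_response v - b) \<le> \<mu> / 2"
        using ex_disturbance_signal_near[OF b] by blast
      show "\<exists>b1\<in>disturbances (sampling_system \<Sigma> \<tau>). \<exists>q1'\<in>states (sampling_system \<Sigma> \<tau>).
          (q1, u, b1, q1') \<in> transitions (sampling_system \<Sigma> \<tau>) \<and> (q1', q2') \<in> ?R"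
        using tr1[OF u v(1)] successors_close[OF q(1,3) u a(2) v tr] sol_in_Xset[OF q(1) u v(1)] q2' v(1)
        by (intro bexI[of _ v] bexI[of _ "sol \<Sigma> \<tau> q1 u v"]) (auto simp: sampling_system_def)
    qed
  qed
  have simulates: "\<exists>a1\<in>controls (sampling_system \<Sigma> \<tau>). \<forall>b1\<in>disturbances (sampling_system \<Sigma> \<tau>). \<forall>q1'\<in>states (sampling_system \<Sigma> \<tau>).
      (q1, a1, b1, q1') \<in> transitions (sampling_system \<Sigma> \<tau>) \<longrightarrow>
      (\<exists>b2\<in>disturbances T. \<exists>q2'\<in>states T. (q2, a, b2, q2') \<in> transitions T \<and> (q1', q2') \<in> ?R)"
    if a: "a \<in> controls T" for a
  proof -
    obtain u where u: "u \<in> A_signals \<Sigma> \<tau>" "infnorm (control_response u - a) \<le> \<mu> / 2"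
      using ex_control_signal_near[OF a] by blast
    show ?thesis
    proof (intro bexI[of _ u] ballI impI)
      fix v q1' assume "v \<in> disturbances (sampling_system \<Sigma> \<tau>)"
        and "(q1, u, v, q1') \<in> transitions (sampling_system \<Sigma> \<tau>)"
      then have v: "v \<in> B_signals \<Sigma> \<tau>" and q1': "q1' \<in> Xset \<Sigma>" "q1' = sol \<Sigma> \<tau> q1 u v"
        by (auto simp: sampling_system_def)
      obtain b where b: "b \<in> disturbances T" "infnorm (disturbance_response v - b) \<le> \<mu> / 2"
        using ex_disturbance_near[OF v] by blast
      obtain q2' where q2': "q2' \<in> states T" "(q2, a, b, q2') \<in> transitions T" using ex_successor[OF q(2) a b(1)] by blast
      show "\<exists>b2\<in>disturbances T. \<exists>q2'\<in>states T. (q2, a, b2, q2') \<in> transitions T \<and> (q1', q2') \<in> ?R"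
        using successors_close[OF q(1,3) u v b(2) q2'(2)] q1' q2' b(1) by blast
    qed (use u in \<open>simp add: sampling_system_def\<close>)
  qed
  show "case p of (q1, q2) \<Rightarrow>
      dinf (obs (sampling_system \<Sigma> \<tau>) q1) (obs T q2) \<le> \<epsilon> \<and>
      (\<forall>a1\<in>controls (sampling_system \<Sigma> \<tau>). \<exists>a2\<in>controls T. \<forall>b2\<in>disturbances T. \<forall>q2'\<in>states T.
        (q2, a2, b2, q2') \<in> transitions T \<longrightarrow>
        (\<exists>b1\<in>disturbances (sampling_system \<Sigma> \<tau>). \<exists>q1'\<in>states (sampling_system \<Sigma> \<tau>).
          (q1, a1, b1, q1') \<in> transitions (sampling_system \<Sigma> \<tau>) \<and> (q1', q2') \<in> ?R)) \<and>
      (\<forall>a2\<in>controls T. \<exists>a1\<in>controls (sampling_system \<Sigma> \<tau>). \<forall>b1\<in>disturbances (sampling_system \<Sigma> \<tau>). \<forall>q1'\<in>states (sampling_system \<Sigma> \<tau>).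
        (q1, a1, b1, q1') \<in> transitions (sampling_system \<Sigma> \<tau>) \<longrightarrow>
        (\<exists>b2\<in>disturbances T. \<exists>q2'\<in>states T. (q2, a2, b2, q2') \<in> transitions T \<and> (q1', q2') \<in> ?R))"
    unfolding p case_prod_conv using forth simulates q(3) obs
    by (intro conjI ballI) (simp_all only: sampling_system_def ats.simps)
qed

lemma aea_bisimilar_iff:
  "aea_bisimilar dinf \<epsilon> (sampling_system \<Sigma> \<tau>) T q1 q2 \<longleftrightarrow> q1 \<in> Xset \<Sigma> \<and> q2 \<in> states T \<and> dinf q1 q2 \<le> \<epsilon>"
proof
  assume "aea_bisimilar dinf \<epsilon> (sampling_system \<Sigma> \<tau>) T q1 q2"
  then obtain R where R: "aea_bisimulation dinf \<epsilon> (sampling_system \<Sigma> \<tau>) T R" "(q1, q2) \<in> R"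
    unfolding aea_bisimilar_def by blast
  then have "q1 \<in> Xset \<Sigma>" "q2 \<in> states T" "dinf q1 (obs T q2) \<le> \<epsilon>"
    unfolding aea_bisimulation_def by (auto simp: sampling_system_def)
  then show "q1 \<in> Xset \<Sigma> \<and> q2 \<in> states T \<and> dinf q1 q2 \<le> \<epsilon>" using T by (simp add: abstractions_def)
qed (use aea_bisimulation_closeness in \<open>auto simp: aea_bisimilar_def\<close>)

end

section \<open>Transfer of satisfaction between the two logics\<close>

lemma ball_inf_subset:
  assumes "dinf x y \<le> \<epsilon>"
  shows "ball_inf \<delta> x \<subseteq> ball_inf (\<delta> + \<epsilon>) y"
proof
  fix z assume "z \<in> ball_inf \<delta> x"
  then have "infnorm (x - z) \<le> \<delta>" "infnorm (y - x) \<le> \<epsilon>"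
    using assms by (auto simp: ball_inf_def dinf_def infnorm_sub)
  then show "z \<in> ball_inf (\<delta> + \<epsilon>) y"
    using infnorm_triangle[of "y - x" "x - z"] by (simp add: ball_inf_def dinf_def)
qed

text \<open>
The ball of radius \<open>d\<close> around \<open>\<sigma> i\<close> is contained in the ball of radius \<open>d + \<epsilon>\<close> around \<open>\<rho> i\<close>, so the stronger
literals at \<open>\<rho> i\<close> imply the weaker ones at \<open>\<sigma> i\<close>. Formulas are in negation normal form, hence monotone in their literals.
\<close>

lemma sat_dt_tr_shift:
  assumes "\<forall>i. dinf (\<sigma> i) (\<rho> i) \<le> \<epsilon>" "sat_dt \<rho> i (tr_shift \<epsilon> \<psi>)"
  shows "sat_dt \<sigma> i \<psi>"
  using assms(2)
proof (induction \<psi> arbitrary: i)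
  case (RProp d p)
  then show ?case using ball_inf_subset[OF assms(1)[rule_format, of i], of d] by auto
next
  case (RNegProp d p)
  then show ?case using ball_inf_subset[OF assms(1)[rule_format, of i], of d] by auto
next
  case (RUntil \<psi>1 \<psi>2)
  then show ?case by (simp only: tr_shift.simps sat_dt.simps) blast
next
  case (RDualUntil \<psi>1 \<psi>2)
  then show ?case by (simp only: tr_shift.simps sat_dt.simps) blast
qed auto

text \<open>
A formula that holds robustly at a sampling instant holds at every time of the cell that begins there. For literals this
is the bound \<open>\<delta>\<close> on the motion within a cell; the temporal operators are handled by locating the cell of each time
point.
\<close>

lemma sat_ct_of_sampled:
  assumes \<tau>: "0 < \<tau>"
    and near: "\<And>i t. t \<in> {real i * \<tau>..<(real i + 1) * \<tau>} \<Longrightarrow> dinf (x (real i * \<tau>)) (x t) \<le> \<delta>"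
    and sat: "sat_dt (\<lambda>i. x (real i * \<tau>)) i (tr \<delta> \<phi>)" and t: "t \<in> {real i * \<tau>..<(real i + 1) * \<tau>}"
  shows "sat_ct x t \<phi>"
  using sat t
proof (induction \<phi> arbitrary: i t)
  case (Prop p)
  then show ?case using near[of t i] by (auto simp: ball_inf_def)
next
  case (NegProp p)
  then show ?case using near[of t i] by (auto simp: ball_inf_def)
next
  case (Until \<phi>1 \<phi>2)
  let ?C = "\<lambda>i::nat. {real i * \<tau>..<(real i + 1) * \<tau>}"
  obtain j where j: "j \<ge> i" "sat_dt (\<lambda>i. x (real i * \<tau>)) j (tr \<delta> \<phi>2)"
    "\<forall>k\<in>{i..<j}. sat_dt (\<lambda>i. x (real i * \<tau>)) k (tr \<delta> \<phi>1)" using Until.prems(1) by auto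
  define t1 where "t1 = max t (real j * \<tau>)"
  have "t1 \<in> ?C j"
  proof (cases "i = j")
    case False
    then have "(real i + 1) * \<tau> \<le> real j * \<tau>" using j(1) \<tau> by (intro mult_right_mono) auto
    then have "t < real j * \<tau>" using Until.prems(2) by (auto intro: less_le_trans)
    then show ?thesis using \<tau> by (simp add: t1_def)
  qed (use Until.prems(2) in \<open>auto simp: t1_def\<close>)
  then have "sat_ct x t1 \<phi>2" using Until.IH(2)[OF j(2)] by blast
  moreover have "sat_ct x t' \<phi>1" if t': "t' \<in> {t..<t1}" for t'
  proof -
    have "t' < real j * \<tau>" "real i * \<tau> \<le> t'" using t' Until.prems(2) by (auto simp: t1_def)
    have "0 \<le> t'" using \<open>real i * \<tau> \<le> t'\<close> \<tau> by (meson mult_nonneg_nonneg of_nat_0_le_iff less_imp_le order_trans)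
    obtain k where k: "t' \<in> ?C k" using cell_exists[OF \<tau> \<open>0 \<le> t'\<close>] by blast
    have "real k * \<tau> < real j * \<tau>" using k \<open>t' < real j * \<tau>\<close> by simp
    then have "k < j" using \<tau> by simp
    have "real i * \<tau> < (real k + 1) * \<tau>" using k \<open>real i * \<tau> \<le> t'\<close> by simp
    then have "real i < real k + 1" using \<tau> by simp
    then have "i \<le> k" by linarith
    then show ?thesis using Until.IH(1)[of k t'] j(3) k \<open>k < j\<close> by simp
  qed
  ultimately show ?case unfolding sat_ct.simps
    by (intro exI[of _ t1] exI[of _ "t1 + 1"]) (auto simp: t1_def)
next
  case (DualUntil \<phi>1 \<phi>2)
  let ?C = "\<lambda>i::nat. {real i * \<tau>..<(real i + 1) * \<tau>}"
  \<comment> \<open>In both clauses \<open>\<phi>2\<close> fails at some time in the cell of \<open>t1\<close>: at \<open>t1\<close> itself or shortly after it.\<close>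
  have release: "\<exists>t'\<in>{t..<t1}. sat_ct x t' \<phi>1"
    if t1: "t \<le> t1" "t1 \<in> ?C j" and s: "s \<in> ?C j" "\<not> sat_ct x s \<phi>2" for t1 j s
  proof -
    have "real i * \<tau> < (real j + 1) * \<tau>" using t1 DualUntil.prems(2) by auto
    then have "real i < real j + 1" using \<tau> by simp
    then have "i \<le> j" by linarith
    have "\<not> sat_dt (\<lambda>i. x (real i * \<tau>)) j (tr \<delta> \<phi>2)" using DualUntil.IH(2) s by blast
    then obtain k where k: "k \<in> {i..<j}" "sat_dt (\<lambda>i. x (real i * \<tau>)) k (tr \<delta> \<phi>1)"
      using DualUntil.prems(1) \<open>i \<le> j\<close> by auto
    define t' where "t' = max t (real k * \<tau>)"
    have kj: "(real k + 1) * \<tau> \<le> real j * \<tau>" using k(1) \<tau> by (intro mult_right_mono) auto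
    have "(real i + 1) * \<tau> \<le> (real k + 1) * \<tau>" using k(1) \<tau> by (intro mult_right_mono) auto
    then have "t < (real k + 1) * \<tau>" using DualUntil.prems(2) by auto
    then have "t' \<in> ?C k" using \<tau> by (auto simp: t'_def)
    then have "sat_ct x t' \<phi>1" using DualUntil.IH(1)[OF k(2)] by blast
    moreover have "t' \<in> {t..<t1}" using \<open>t' \<in> ?C k\<close> kj t1(2) by (auto simp: t'_def)
    ultimately show ?thesis by blast
  qed
  show ?case unfolding sat_ct.simps
  proof (intro allI impI conjI)
    fix t1 t2 assume t12: "t \<le> t1 \<and> t1 < t2"
    have "0 \<le> real i * \<tau>" using \<tau> by simp
    then have "0 \<le> t1" using t12 DualUntil.prems(2) by auto
    then obtain j where j: "t1 \<in> ?C j" using cell_exists[OF \<tau>] by blast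
    show "\<exists>t'\<in>{t..<t1}. sat_ct x t' \<phi>1" if "\<not> sat_ct x t1 \<phi>2"
      using release[OF _ j j that] t12 by blast
    show "\<exists>t''\<in>{t..t1}. sat_ct x t'' \<phi>1" if "\<forall>t'\<in>{t1<..t2}. \<not> sat_ct x t' \<phi>2"
    proof -
      obtain s where s: "t1 < s" "s < min t2 ((real j + 1) * \<tau>)"
        using dense[of t1 "min t2 ((real j + 1) * \<tau>)"] t12 j by auto
      then have "s \<in> ?C j" "\<not> sat_ct x s \<phi>2" using j that by auto
      then show ?thesis using release[OF _ j] t12 by force
    qed
  qed
qed auto

section \<open>Outcome strings and infinite paths\<close>

lemma Out_plus_iff:
  "s \<in> Out_plus T q f \<longleftrightarrow> s \<in> plus_strings (states T) \<and> s ! 0 = q \<and>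
     (\<forall>i. Suc i < length s \<longrightarrow>
        (\<exists>a \<in> f (take (Suc i) s). \<exists>b \<in> disturbances T. (s ! i, a, b, s ! Suc i) \<in> transitions T))"
  by (auto simp: Out_plus_def Out_n_def)

lemma Out_plus_snoc:
  assumes s: "s \<in> Out_plus T q f" and a: "a \<in> f s" and b: "b \<in> disturbances T"
    and q': "q' \<in> states T" "(last s, a, b, q') \<in> transitions T"
  shows "s @ [q'] \<in> Out_plus T q f"
proof -
  have ne: "s \<noteq> []" using s by (auto simp: Out_plus_iff plus_strings_def)
  show ?thesis unfolding Out_plus_iff
  proof (intro conjI allI impI)
    show "s @ [q'] \<in> plus_strings (states T)" using s q' by (auto simp: Out_plus_iff plus_strings_def)
    show "(s @ [q']) ! 0 = q" using s ne by (auto simp: Out_plus_iff nth_append)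
    fix i assume i: "Suc i < length (s @ [q'])"
    show "\<exists>a\<in>f (take (Suc i) (s @ [q'])). \<exists>b\<in>disturbances T. ((s @ [q']) ! i, a, b, (s @ [q']) ! Suc i) \<in> transitions T"
    proof (cases "Suc i < length s")
      case True
      then show ?thesis using s by (auto simp: Out_plus_iff nth_append)
    next
      case False
      then have l: "length s = Suc i" using i by simp
      have "last s = s ! i" using l ne by (simp add: last_conv_nth)
      then show ?thesis using a b q'(2) l by (auto simp: nth_append)
    qed
  qed
qed

lemma Out_plus_take:
  assumes "s \<in> Out_plus T q f" "0 < n"
  shows "take n s \<in> Out_plus T q f"
  using assms set_take_subset[of n s] by (auto simp: Out_plus_iff plus_strings_def min_def)

text \<open>
A string with extensions of every length in \<open>L\<close> has a one-letter extension with the same property. Otherwise each of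
the finitely many letters would fail from some length on, because \<open>L\<close> is closed under prefixes, and a member of \<open>L\<close>
longer than all these lengths could not continue the string.
\<close>

lemma Koenig_prefix_closed:
  fixes L :: "'q list set"
  assumes fin: "finite Q" and sub: "\<And>s. s \<in> L \<Longrightarrow> set s \<subseteq> Q"
    and prefix: "\<And>s n. s \<in> L \<Longrightarrow> take n s \<in> L"
    and inf: "\<And>n. \<exists>s\<in>L. length s = n"
  shows "\<exists>\<sigma>. \<forall>n. map \<sigma> [0..<n] \<in> L"
proof -
  \<comment> \<open>a string with arbitrarily long extensions\<close>
  define P where "P s \<longleftrightarrow> (\<forall>n\<ge>length s. \<exists>r\<in>L. length r = n \<and> take (length s) r = s)" for s
  have P_nil: "P []" using inf by (simp add: P_def)
  have step: "\<exists>q. P (s @ [q])" if s: "P s" for s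
  proof (rule ccontr)
    assume "\<nexists>q. P (s @ [q])"
    then have "\<forall>q. \<exists>n. n \<ge> Suc (length s) \<and> \<not> (\<exists>r\<in>L. length r = n \<and> take (Suc (length s)) r = s @ [q])"
      by (simp add: P_def)
    then obtain n where n: "\<And>q. n q \<ge> Suc (length s)"
      "\<And>q. \<not> (\<exists>r\<in>L. length r = n q \<and> take (Suc (length s)) r = s @ [q])" by metis
    define m where "m = Max (insert (Suc (length s)) (n ` Q))"
    have m: "Suc (length s) \<le> m" "\<And>q. q \<in> Q \<Longrightarrow> n q \<le> m" using fin by (auto simp: m_def)
    obtain r where r: "r \<in> L" "length r = m" "take (length s) r = s"
      using s m(1) unfolding P_def by (meson Suc_leD)
    let ?q = "r ! length s"
    have "?q \<in> Q" using sub[OF r(1)] r(2) m(1) by (auto intro: nth_mem)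
    have "take (Suc (length s)) r = s @ [?q]" using r m(1) by (simp add: take_Suc_conv_app_nth)
    moreover have "take (Suc (length s)) (take (n ?q) r) = take (Suc (length s)) r"
      using n(1)[of ?q] by (simp add: min_def)
    moreover have "length (take (n ?q) r) = n ?q" using m(2)[OF \<open>?q \<in> Q\<close>] r(2) by simp
    ultimately show False using n(2)[of ?q] prefix[OF r(1), of "n ?q"] by auto
  qed
  define S where "S = rec_nat [] (\<lambda>_ s. s @ [SOME q. P (s @ [q])])"
  have S_Suc: "S (Suc n) = S n @ [SOME q. P (S n @ [q])]" for n by (simp add: S_def)
  have PS: "P (S n)" for n
  proof (induction n)
    case 0 show ?case using P_nil by (simp add: S_def)
  next
    case (Suc n)
    then show ?case unfolding S_Suc using someI_ex[OF step] by blast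
  qed
  have map: "S n = map (\<lambda>i. last (S (Suc i))) [0..<n]" for n
    by (induction n) (simp_all add: S_Suc, simp add: S_def)
  have len: "length (S n) = n" for n by (subst map) simp
  have "S n \<in> L" for n
    using PS[of n] len[of n] unfolding P_def by (metis order_refl take_all)
  then show ?thesis using map by metis
qed

section \<open>Refinement of the control strategy\<close>

locale controller_refinement = symbolic_abstraction \<Sigma> \<tau> \<epsilon> \<eta> \<mu> T
  for \<Sigma> :: "('n::finite, 'm::finite, 'k::finite) lin_sys" and \<tau> \<epsilon> \<eta> \<mu> and T +
  fixes q0 :: "real^'n" and f :: "(real^'n) list \<Rightarrow> (real^'n) set"
  assumes q0: "q0 \<in> states T" and strategy: "control_strategy T f"
begin

abbreviation "similar \<equiv> aea_bisimilar_strings dinf \<epsilon> (sampling_system \<Sigma> \<tau>) T"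

lemma similar_iff:
  "similar s s' \<longleftrightarrow> list_all2 (\<lambda>q1 q2. q1 \<in> Xset \<Sigma> \<and> q2 \<in> states T \<and> dinf q1 q2 \<le> \<epsilon>) s s'"
proof -
  have "aea_bisimilar dinf \<epsilon> (sampling_system \<Sigma> \<tau>) T = (\<lambda>q1 q2. q1 \<in> Xset \<Sigma> \<and> q2 \<in> states T \<and> dinf q1 q2 \<le> \<epsilon>)"
    by (intro ext) (rule aea_bisimilar_iff)
  then show ?thesis by (simp add: aea_bisimilar_strings_def)
qed

text \<open>
The signals that the definition of a derived controller permits after the string \<open>s\<close> of sampled states.
\<close>

definition admissible :: "(real^'n) list \<Rightarrow> (real \<Rightarrow> real^'m) \<Rightarrow> bool" where
  "admissible s u \<longleftrightarrow> u \<in> A_signals \<Sigma> \<tau> \<and> (\<exists>s'\<in>Out_plus T q0 f. similar s s' \<and>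
     (\<exists>a\<in>f s'. infnorm (control_response u - a) \<le> \<mu> / 2))"

definition refined_controller :: "(real^'n) list \<rightharpoonup> (real \<Rightarrow> real^'m)" where
  "refined_controller s =
     (if \<exists>s'\<in>Out_plus T q0 f. similar s s' then Some (SOME u. admissible s u) else None)"

lemma refined_controller_eq_None_iff: "refined_controller s = None \<longleftrightarrow> \<not> (\<exists>s'\<in>Out_plus T q0 f. similar s s')"
  by (simp add: refined_controller_def)

lemma refined_controller_admissible:
  assumes "refined_controller s = Some u"
  shows "admissible s u"
proof -
  from assms obtain s' where s': "s' \<in> Out_plus T q0 f" "similar s s'"
    by (auto simp: refined_controller_def split: if_splits)
  then have "f s' \<subseteq> controls T" "f s' \<noteq> {}"
    using strategy by (auto simp: control_strategy_def Out_plus_iff)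
  then obtain a where a: "a \<in> f s'" "a \<in> controls T" by blast
  obtain u' where "u' \<in> A_signals \<Sigma> \<tau>" "infnorm (control_response u' - a) \<le> \<mu> / 2"
    using ex_control_signal_near[OF a(2)] by blast
  then have "admissible s u'" using s' a(1) unfolding admissible_def by blast
  then have "admissible s (SOME u. admissible s u)" by (rule someI[of "admissible s"])
  then show ?thesis using assms by (auto simp: refined_controller_def split: if_splits)
qed

lemma refined_controller_domain:
  assumes "refined_controller s = Some u"
  shows "s \<in> plus_strings (Xset \<Sigma>)"
proof -
  from assms obtain s' where s': "s' \<in> Out_plus T q0 f" "similar s s'"
    by (auto simp: refined_controller_def split: if_splits)
  then have "s \<noteq> []" by (auto simp: similar_iff Out_plus_iff plus_strings_def)
  moreover have "set s \<subseteq> Xset \<Sigma>"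
    using s'(2) unfolding similar_iff by (auto simp: list_all2_conv_all_nth in_set_conv_nth)
  ultimately show ?thesis by (simp add: plus_strings_def)
qed

lemma is_controller_refined:
  "is_controller \<Sigma> \<tau> ({q \<in> Xset \<Sigma>. dinf q q0 \<le> \<epsilon>}, refined_controller)"
  using refined_controller_domain refined_controller_admissible
  by (auto simp: is_controller_def admissible_def ran_def)

lemma derived_from_refined:
  "derived_from \<Sigma> \<tau> \<epsilon> \<mu> T q0 f ({q \<in> Xset \<Sigma>. dinf q q0 \<le> \<epsilon>}, refined_controller)"
  unfolding derived_from_def Let_def case_prod_conv
proof (intro conjI ballI refl)
  fix s
  show "if \<exists>s1\<in>Out_plus T q0 f. similar s s1
    then \<exists>u. refined_controller s = Some u \<and> (\<exists>s'\<in>Out_plus T q0 f. similar s s' \<and>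
        (\<exists>a\<in>f s'. infnorm (control_response u - a) \<le> \<mu> / 2))
    else refined_controller s = None"
  proof (cases "refined_controller s")
    case None
    then show ?thesis by (simp add: refined_controller_eq_None_iff)
  next
    case (Some u)
    then have "\<exists>s'\<in>Out_plus T q0 f. similar s s'" using refined_controller_eq_None_iff[of s] by auto
    then show ?thesis using Some refined_controller_admissible[OF Some] by (simp add: admissible_def)
  qed
qed

text \<open>
The string \<open>s\<close> is close to an outcome \<open>s'\<close> from which the symbolic control behind \<open>u\<close> is allowed. Its answer to the
symbolic disturbance within \<open>\<mu>/2\<close> of the response to \<open>v\<close> extends \<open>s'\<close>, and the two new states are close again.
\<close>

lemma similar_extension:
  assumes u: "refined_controller s = Some u" and v: "v \<in> B_signals \<Sigma> \<tau>"
  shows "\<exists>s'\<in>Out_plus T q0 f. similar (s @ [sol \<Sigma> \<tau> (last s) u v]) s'"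
proof -
  obtain s' a where s': "s' \<in> Out_plus T q0 f" "similar s s'"
    and a: "a \<in> f s'" "infnorm (control_response u - a) \<le> \<mu> / 2" and uA: "u \<in> A_signals \<Sigma> \<tau>"
    using refined_controller_admissible[OF u] unfolding admissible_def by blast
  obtain b where b: "b \<in> disturbances T" "infnorm (disturbance_response v - b) \<le> \<mu> / 2"
    using ex_disturbance_near[OF v] by blast
  have s'T: "s' \<noteq> []" "s' \<in> plus_strings (states T)" using s'(1) by (auto simp: Out_plus_iff plus_strings_def)
  have aT: "a \<in> controls T" using strategy s'T(2) a(1) by (auto simp: control_strategy_def)
  have len: "length s = length s'" using s'(2) unfolding similar_iff by (rule list_all2_lengthD)
  then have "s \<noteq> []" using s'T(1) by auto
  have last: "last s \<in> Xset \<Sigma>" "last s' \<in> states T" "dinf (last s) (last s') \<le> \<epsilon>"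
    using s'(2) s'T(1) \<open>s \<noteq> []\<close> len unfolding similar_iff
    by (auto simp: last_conv_nth list_all2_conv_all_nth)
  obtain q' where q': "q' \<in> states T" "(last s', a, b, q') \<in> transitions T"
    using ex_successor[OF last(2) aT b(1)] by blast
  have "s' @ [q'] \<in> Out_plus T q0 f" by (rule Out_plus_snoc[OF s'(1) a(1) b(1) q'])
  moreover have "similar (s @ [sol \<Sigma> \<tau> (last s) u v]) (s' @ [q'])"
    using s'(2) q'(1) sol_in_Xset[OF last(1) uA v] successors_close[OF last(1,3) uA a(2) v b(2) q'(2)]
    unfolding similar_iff by (auto intro!: list_all2_appendI)
  ultimately show ?thesis by blast
qed

text \<open>
The sampled states are determined recursively, starting at \<open>q0\<close> and answering every string with the controller against a
constant disturbance. Forward completeness gives one trajectory for the concatenated inputs, and uniqueness of solutions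
on each cell shows that it passes through these states.
\<close>

lemma ex_controlled_trajectory: "\<exists>x. controlled_trajectory \<Sigma> \<tau> (X0, refined_controller) x"
proof -
  obtain v0 where "v0 \<in> Vset \<Sigma>" using V by auto
  define v where "v = (\<lambda>t\<in>{0..\<tau>}. v0)"
  have v: "v \<in> B_signals \<Sigma> \<tau>" unfolding v_def B_signals_def by (rule constant_signal[OF \<open>v0 \<in> Vset \<Sigma>\<close> Vbdd])
  define next_input where "next_input s = the (refined_controller s)" for s
  define S where "S = rec_nat [q0] (\<lambda>_ s. s @ [sol \<Sigma> \<tau> (last s) (next_input s) v])"
  define us where "us n = next_input (S n)" for n
  have S_0: "S 0 = [q0]" and S_Suc: "S (Suc n) = S n @ [sol \<Sigma> \<tau> (last (S n)) (us n) v]" for n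
    by (simp_all add: S_def us_def)
  have defined: "refined_controller (S n) = Some (us n)" for n
  proof -
    have "refined_controller (S n) \<noteq> None"
    proof (induction n)
      case 0
      have "[q0] \<in> Out_plus T q0 f" using q0 by (simp add: Out_plus_iff plus_strings_def)
      moreover have "similar [q0] [q0]"
        using q0 states_subset pos by (auto simp: similar_iff dinf_def infnorm_0)
      ultimately show ?case unfolding refined_controller_eq_None_iff S_0 by blast
    next
      case (Suc n)
      then have "refined_controller (S n) = Some (us n)" by (auto simp: us_def next_input_def)
      from similar_extension[OF this v] show ?case
        unfolding refined_controller_eq_None_iff S_Suc by blast
    qed
    then show ?thesis by (auto simp: us_def next_input_def)
  qed
  have us: "us n \<in> A_signals \<Sigma> \<tau>" for n
    using refined_controller_admissible[OF defined] by (simp add: admissible_def)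
  have "q0 \<in> Xset \<Sigma>" using q0 states_subset by blast
  then obtain x where x: "generates \<Sigma> {0..} (concat_signals \<tau> us) (concat_signals \<tau> (\<lambda>_. v)) x" "x 0 = q0"
    using ex_trajectory_concat[of q0 us "\<lambda>_. v"] us v by blast
  then have sol: "is_solution \<Sigma> {0..} (concat_signals \<tau> us) (concat_signals \<tau> (\<lambda>_. v)) x"
    by (simp add: generates_def)
  have sampled: "S n = map (\<lambda>i. x (real i * \<tau>)) [0..<Suc n]" for n
  proof (induction n)
    case 0 show ?case using x(2) by (simp add: S_0)
  next
    case (Suc n)
    then have "last (S n) = x (real n * \<tau>)" by simp
    moreover have "sol \<Sigma> \<tau> (x (real n * \<tau>)) (us n) v = x (real n * \<tau> + \<tau>)"
      by (rule sol_eqI[OF is_solution_cell[OF \<tau> sol]]) (use \<tau> in auto)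
    moreover have "real n * \<tau> + \<tau> = real (Suc n) * \<tau>" by (simp add: algebra_simps)
    ultimately show ?case unfolding S_Suc using Suc.IH by simp
  qed
  have "controlled_trajectory \<Sigma> \<tau> (X0, refined_controller) x"
    unfolding controlled_trajectory_def case_prod_conv
  proof (intro conjI allI impI)
    show "loc_abs_continuous_on {0..} x" using sol by (simp add: is_solution_def)
    show "x t \<in> Xset \<Sigma>" if "0 \<le> t" for t using x(1) that by (simp add: generates_def)
    fix n :: nat assume "1 \<le> n"
    then obtain m where n: "n = Suc m" by (cases n) auto
    have "ode_ae \<Sigma> {real m * \<tau>..<(real m + 1) * \<tau>} (\<lambda>t. us m (t - real m * \<tau>)) (\<lambda>t. v (t - real m * \<tau>)) x"
      using ode_ae_cell[OF \<tau>, of \<Sigma> us "\<lambda>_. v" x m] sol by (simp add: is_solution_def)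
    moreover have "refined_controller (map (\<lambda>i. x (real i * \<tau>)) [0..<n]) = Some (us m)"
      using defined[of m] unfolding sampled n .
    ultimately show "\<exists>u. refined_controller (map (\<lambda>i. x (real i * \<tau>)) [0..<n]) = Some u \<and>
      (\<exists>v\<in>B_signals \<Sigma> \<tau>. ode_ae \<Sigma> {(real n - 1) * \<tau>..<real n * \<tau>}
        (\<lambda>t. u (t - (real n - 1) * \<tau>)) (\<lambda>t. v (t - (real n - 1) * \<tau>)) x)"
      using v by (auto simp: n add.commute intro!: bexI[of _ v])
  qed
  then show ?thesis by blast
qed

text \<open>
The cells are numbered from 0, as for \<^const>\<open>concat_signals\<close>, instead of from 1.
\<close>

lemma controlled_trajectory_cell:
  assumes x: "controlled_trajectory \<Sigma> \<tau> (X0, refined_controller) x"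
  shows "\<exists>u v. refined_controller (map (\<lambda>i. x (real i * \<tau>)) [0..<Suc n]) = Some u \<and> v \<in> B_signals \<Sigma> \<tau> \<and>
    ode_ae \<Sigma> {real n * \<tau>..<(real n + 1) * \<tau>} (\<lambda>t. u (t - real n * \<tau>)) (\<lambda>t. v (t - real n * \<tau>)) x"
proof -
  have "\<forall>n\<ge>1. \<exists>u. refined_controller (map (\<lambda>i. x (real i * \<tau>)) [0..<n]) = Some u \<and>
      (\<exists>v\<in>B_signals \<Sigma> \<tau>. ode_ae \<Sigma> {(real n - 1) * \<tau>..<real n * \<tau>}
        (\<lambda>t. u (t - (real n - 1) * \<tau>)) (\<lambda>t. v (t - (real n - 1) * \<tau>)) x)"
    using x unfolding controlled_trajectory_def case_prod_conv by (elim conjE)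
  moreover have "1 \<le> Suc n" "real (Suc n) - 1 = real n" "real (Suc n) = real n + 1" by simp_all
  ultimately show ?thesis by metis
qed

lemma controlled_trajectory_imp_trajectory:
  assumes x: "controlled_trajectory \<Sigma> \<tau> (X0, refined_controller) x"
  shows "trajectory \<Sigma> {0..} x"
proof -
  have "\<exists>u v. u \<in> A_signals \<Sigma> \<tau> \<and> v \<in> B_signals \<Sigma> \<tau> \<and>
      ode_ae \<Sigma> {real n * \<tau>..<(real n + 1) * \<tau>} (\<lambda>t. u (t - real n * \<tau>)) (\<lambda>t. v (t - real n * \<tau>)) x" for n
    using controlled_trajectory_cell[OF x, of n] refined_controller_admissible unfolding admissible_def by blast
  then obtain us vs where uv: "\<And>n. us n \<in> A_signals \<Sigma> \<tau>" "\<And>n. vs n \<in> B_signals \<Sigma> \<tau>"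
    "\<And>n. ode_ae \<Sigma> {real n * \<tau>..<(real n + 1) * \<tau>} (\<lambda>t. us n (t - real n * \<tau>)) (\<lambda>t. vs n (t - real n * \<tau>)) x"
    by metis
  have "is_solution \<Sigma> {0..} (concat_signals \<tau> us) (concat_signals \<tau> vs) x"
    using ode_ae_concat[OF \<tau> uv(3)] x by (simp add: is_solution_def controlled_trajectory_def)
  then have "generates \<Sigma> {0..} (concat_signals \<tau> us) (concat_signals \<tau> vs) x"
    using x by (simp add: generates_def controlled_trajectory_def)
  moreover have "concat_signals \<tau> us \<in> signals {0..} (Uset \<Sigma>)" "concat_signals \<tau> vs \<in> signals {0..} (Vset \<Sigma>)"
    using uv(1,2) unfolding A_signals_def B_signals_def
    by (auto intro: concat_signals_in_signals[OF \<tau>] Ubdd Vbdd)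
  ultimately show ?thesis unfolding trajectory_def by blast
qed

text \<open>
For each length there is an outcome string close to the sampled states, but these strings may disagree with each other.
The set of all such strings is closed under prefixes and the abstraction has finitely many states, so there is an infinite
path all of whose prefixes belong to the set.
\<close>

lemma controlled_trajectory_shadowed:
  assumes x: "controlled_trajectory \<Sigma> \<tau> (X0, refined_controller) x"
  shows "\<exists>\<rho>\<in>Out_inf T q0 f. \<forall>i. dinf (x (real i * \<tau>)) (\<rho> i) \<le> \<epsilon>"
proof -
  define \<sigma> where "\<sigma> i = x (real i * \<tau>)" for i
  let ?close = "\<lambda>q1 q2. q1 \<in> Xset \<Sigma> \<and> q2 \<in> states T \<and> dinf q1 q2 \<le> \<epsilon>"
  define L where "L = {s. (s = [] \<or> s \<in> Out_plus T q0 f) \<and> list_all2 ?close (map \<sigma> [0..<length s]) s}"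
  have "\<exists>\<rho>. \<forall>n. map \<rho> [0..<n] \<in> L"
  proof (rule Koenig_prefix_closed[of "states T"])
    show "finite (states T)" using fin by (simp add: finite_ats_def)
    show "set s \<subseteq> states T" if "s \<in> L" for s
      using that by (auto simp: L_def Out_plus_iff plus_strings_def)
    show "take n s \<in> L" if "s \<in> L" for s n
    proof -
      have "list_all2 ?close (take n (map \<sigma> [0..<length s])) (take n s)"
        using that by (intro list_all2_takeI) (simp add: L_def)
      moreover have "take n (map \<sigma> [0..<length s]) = map \<sigma> [0..<length (take n s)]"
        by (simp add: take_map min_def)
      moreover have "take n s = [] \<or> take n s \<in> Out_plus T q0 f"
        using that Out_plus_take[of s T q0 f n] by (cases "n = 0") (auto simp: L_def)
      ultimately show ?thesis by (simp add: L_def)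
    qed
    show "\<exists>s\<in>L. length s = n" for n
    proof (cases "n = 0")
      case True
      then show ?thesis by (intro bexI[of _ "[]"]) (auto simp: L_def)
    next
      case False
      then obtain m where "n = Suc m" by (cases n) auto
      then have "refined_controller (map \<sigma> [0..<n]) \<noteq> None"
        using controlled_trajectory_cell[OF x, of m] unfolding \<sigma>_def by force
      then obtain s where s: "s \<in> Out_plus T q0 f" "list_all2 ?close (map \<sigma> [0..<n]) s"
        unfolding refined_controller_eq_None_iff similar_iff by blast
      then have "length s = n" using list_all2_lengthD by fastforce
      then show ?thesis using s by (intro bexI[of _ s]) (auto simp: L_def)
    qed
  qed
  then obtain \<rho> where \<rho>: "\<And>n. map \<rho> [0..<n] \<in> L" by blast
  have out: "map \<rho> [0..<Suc n] \<in> Out_plus T q0 f" for n using \<rho>[of "Suc n"] by (auto simp: L_def)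
  have close: "?close (\<sigma> i) (\<rho> i)" for i
    using \<rho>[of "Suc i"] by (auto simp: L_def list_all2_conv_all_nth nth_append)
  have "\<rho> \<in> Out_inf T q0 f"
    unfolding Out_inf_def
  proof (intro CollectI conjI allI)
    show "range \<rho> \<subseteq> states T" using close by auto
    show "\<rho> 0 = q0" using out[of 0] by (simp add: Out_plus_iff)
    fix i
    have "Suc i < length (map \<rho> [0..<Suc (Suc i)])" by simp
    then have "\<exists>a\<in>f (take (Suc i) (map \<rho> [0..<Suc (Suc i)])). \<exists>b\<in>disturbances T.
        (map \<rho> [0..<Suc (Suc i)] ! i, a, b, map \<rho> [0..<Suc (Suc i)] ! Suc i) \<in> transitions T"
      using out[of "Suc i"] unfolding Out_plus_iff by blast
    moreover have "take (Suc i) (map \<rho> [0..<Suc (Suc i)]) = map \<rho> [0..<Suc i]"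
      by (simp add: take_map take_upt del: upt_Suc)
    moreover have "map \<rho> [0..<Suc (Suc i)] ! i = \<rho> i" "map \<rho> [0..<Suc (Suc i)] ! Suc i = \<rho> (Suc i)"
      by (simp_all add: nth_append del: upt_Suc)
    ultimately show "\<exists>a\<in>f (map \<rho> [0..<Suc i]). \<exists>b\<in>disturbances T. (\<rho> i, a, b, \<rho> (Suc i)) \<in> transitions T"
      by simp
  qed
  then show ?thesis using close by (auto simp: \<sigma>_def)
qed

end

theorem theorem5:
  fixes \<Sigma> :: "('n::finite, 'm::finite, 'k::finite) lin_sys"
    and \<epsilon> \<delta> \<tau> \<eta> \<mu> :: real
    and Ph :: "(real^'n) set set"
    and \<phi>0 :: "(real^'n) set ltl"
    and T :: "(real^'n, real^'n, real^'n, real^'n) ats"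
    and q0 :: "real^'n"
    and f :: "(real^'n) list \<Rightarrow> (real^'n) set"
  assumes "Uset \<Sigma> \<noteq> {}" and "Vset \<Sigma> \<noteq> {}"
    and "compact (Uset \<Sigma> \<times> Vset \<Sigma>)"
    and "polytope (Xset \<Sigma>)" and "interior (Xset \<Sigma>) \<noteq> {}" and "0 \<in> Xset \<Sigma>"
    and "asymptotically_stable \<Sigma>"
    and "forward_complete \<Sigma>"
    and "\<epsilon> > 0" and "\<delta> > 0" and "\<tau> > 0" and "\<eta> > 0" and "\<mu> > 0"
    and "finite Ph" and "\<forall>p\<in>Ph. open_half_space p"
    and "props \<phi>0 \<subseteq> Ph"
    and "non_blocking (sampling_system \<Sigma> \<tau>)"
    and "T \<in> abstractions \<Sigma> \<tau> \<eta> \<mu>" and "non_blocking T" and "finite_ats T"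
    and "row_sum_norm (mat_exp (\<tau> *\<^sub>R matA \<Sigma>)) * \<epsilon> + \<mu> + \<eta> / 2 < \<epsilon>"
    and "\<And>x n t. trajectory \<Sigma> {0..} x \<Longrightarrow> n \<ge> (1::nat) \<Longrightarrow>
           t \<in> {(real n - 1) * \<tau>..<real n * \<tau>} \<Longrightarrow> infnorm (x t - x ((real n - 1) * \<tau>)) \<le> \<delta>"
    and "q0 \<in> states T" and "control_strategy T f"
    and "\<forall>\<sigma> \<in> Out_inf T q0 f. satisfies_dt \<sigma> (tr_shift \<epsilon> (tr \<delta> \<phi>0))"
  shows "\<exists>C :: ('n, 'm) controller. is_controller \<Sigma> \<tau> C \<and> derived_from \<Sigma> \<tau> \<epsilon> \<mu> T q0 f C \<and>
           (\<exists>x. controlled_trajectory \<Sigma> \<tau> C x) \<and>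
           (\<forall>x. controlled_trajectory \<Sigma> \<tau> C x \<longrightarrow> satisfies_ct x \<phi>0)"
proof -
  have "compact (fst ` (Uset \<Sigma> \<times> Vset \<Sigma>))" "compact (snd ` (Uset \<Sigma> \<times> Vset \<Sigma>))"
    by (intro compact_continuous_image continuous_on_fst continuous_on_snd continuous_on_id assms(3))+
  then have "compact (Uset \<Sigma>)" "compact (Vset \<Sigma>)" using assms(1,2) by simp_all
  then interpret controller_refinement \<Sigma> \<tau> \<epsilon> \<eta> \<mu> T q0 f
    using assms by unfold_locales auto
  let ?X0 = "{q \<in> Xset \<Sigma>. dinf q q0 \<le> \<epsilon>}"
  have "satisfies_ct x \<phi>0" if x: "controlled_trajectory \<Sigma> \<tau> (?X0, refined_controller) x" for x
  proof -
    note traj = controlled_trajectory_imp_trajectory[OF x]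
    have near: "dinf (x (real i * \<tau>)) (x t) \<le> \<delta>" if "t \<in> {real i * \<tau>..<(real i + 1) * \<tau>}" for i t
      using assms(22)[OF traj, of "Suc i" t] that by (simp add: dinf_def infnorm_sub add.commute)
    obtain \<rho> where \<rho>: "\<rho> \<in> Out_inf T q0 f" "\<forall>i. dinf (x (real i * \<tau>)) (\<rho> i) \<le> \<epsilon>"
      using controlled_trajectory_shadowed[OF x] by blast
    have "sat_dt \<rho> 0 (tr_shift \<epsilon> (tr \<delta> \<phi>0))" using assms(25) \<rho>(1) by (simp add: satisfies_dt_def)
    then have "sat_dt (\<lambda>i. x (real i * \<tau>)) 0 (tr \<delta> \<phi>0)" using sat_dt_tr_shift[OF \<rho>(2)] by blast
    then show ?thesis
      unfolding satisfies_ct_def using \<tau> by (intro sat_ct_of_sampled[where x = x, OF \<tau> near]) auto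
  qed
  then show ?thesis
    using is_controller_refined derived_from_refined ex_controlled_trajectory by blast
qed

end
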